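(* Let $\alpha\in(1,2)$, let $a:\mathbb{R}\to(0,\infty)$ be continuous with $\int_{\mathbb{R}}a(x)^{-1}\mathrm{d}x=1$, and let $\mu(\mathrm{d}x)=a(x)^{-1}\mathrm{d}x$. Let $(\mathscr{E},\mathscr{F})$ be the Dirichlet form of the time-changed symmetric $\alpha$-stable process $Y$ with generator $a(x)\Delta^{\alpha/2}$, and let $\mathscr{D}(L)$ be the domain of its $L^2(\mu)$-generator $L$. Let $\xi\in(0,1]$. Then there is a constant $C>0$ such that, with $\phi(p)=C(2-p)^\xi$, $$\sup_{p\in[1,2)}\frac{\mu(f^2)-\mu(|f|^p)^{2/p}}{\phi(p)}\leqslant\mathscr{E}(f,f)\quad\text{for all }f\in\mathscr{D}(L),$$ if and only if $$\sup_{x\in\mathbb{R}}\left\{|x|^{\alpha-1}\mu\big((-|x|,|x|)^c\big)\log^\xi\!\left(\mu\big((-|x|,|x|)^c\big)^{-1}\right)\right\}<\infty.$$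
   Context: The Dirichlet form of $Y$ is $$\mathscr{E}(f,g)=\frac12\int_{\mathbb{R}}\int_{\mathbb{R}}(f(x)-f(y))(g(x)-g(y))\frac{C_\alpha\,\mathrm{d}x\,\mathrm{d}y}{|x-y|^{1+\alpha}},\qquad \mathscr{F}=\{f\in L^2(\mu):\mathscr{E}(f,f)<\infty\},$$ with $C_\alpha=\frac{\alpha2^{\alpha-1}\Gamma((\alpha+1)/2)}{\pi^{1/2}\Gamma(1-\alpha/2)}$. $L$ is the self-adjoint operator on $L^2(\mu)$ associated with $(\mathscr{E},\mathscr{F})$, i.e. $\mathscr{E}(f,g)=-\int (Lf)g\,\mathrm{d}\mu$ for $f\in\mathscr{D}(L)$, $g\in\mathscr{F}$. Here $\mu(f)=\int f\,\mathrm{d}\mu$, $\log^\xi(t)=(\log t)^\xi$, and $A^c=\mathbb{R}\setminus A$. *)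

theory Defs
  imports "HOL-Analysis.Analysis"
begin

definition mu :: "(real \<Rightarrow> real) \<Rightarrow> real measure" where
  "mu a = density lborel (\<lambda>x. ennreal (1 / a x))"

definition stable_const :: "real \<Rightarrow> real" where
  "stable_const \<alpha> =
     \<alpha> * 2 powr (\<alpha> - 1) * Gamma ((\<alpha> + 1) / 2) / (sqrt pi * Gamma (1 - \<alpha> / 2))"

text \<open>On the diagonal the increments vanish, so the convention for division by zero is harmless.\<close>

definition form_integrand ::
  "real \<Rightarrow> (real \<Rightarrow> real) \<Rightarrow> (real \<Rightarrow> real) \<Rightarrow> real \<times> real \<Rightarrow> real" where
  "form_integrand \<alpha> f g = (\<lambda>(x, y).
     (f x - f y) * (g x - g y) * (stable_const \<alpha> / \<bar>x - y\<bar> powr (1 + \<alpha>)))"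

definition form :: "real \<Rightarrow> (real \<Rightarrow> real) \<Rightarrow> (real \<Rightarrow> real) \<Rightarrow> real" where
  "form \<alpha> f g = 1 / 2 * (\<integral>z. form_integrand \<alpha> f g z \<partial>(lborel \<Otimes>\<^sub>M lborel))"

text \<open>Elements of \<open>L\<^sup>2\<close> are represented by Borel functions; the sets \<open>L2\<close>, \<open>form_dom\<close> and
  \<open>generator_dom\<close> below are closed under almost everywhere equality of such functions.\<close>

definition L2 :: "real measure \<Rightarrow> (real \<Rightarrow> real) set" where
  "L2 M = {f \<in> borel_measurable M. integrable M (\<lambda>x. (f x)\<^sup>2)}"

text \<open>The value of \<open>form\<close> is real (and \<open>0\<close> for a divergent integral), so finiteness of the
  energy is expressed by the extended nonnegative integral of the nonnegative integrand. By
  Cauchy-Schwarz the integral in \<open>form \<alpha> f g\<close> then converges absolutely for \<open>f\<close>, \<open>g\<close> in the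
  form domain.\<close>

definition form_dom :: "(real \<Rightarrow> real) \<Rightarrow> real \<Rightarrow> (real \<Rightarrow> real) set" where
  "form_dom a \<alpha> =
     {f \<in> L2 (mu a). (\<integral>\<^sup>+z. ennreal (form_integrand \<alpha> f f z) \<partial>(lborel \<Otimes>\<^sub>M lborel)) < \<infinity>}"

text \<open>The graph of \<open>L\<close>, the self-adjoint operator associated with the form: \<open>f\<close> is in its domain
  iff \<open>g \<mapsto> form \<alpha> f g\<close> is represented on the form domain by an element \<open>- L f\<close> of \<open>L\<^sup>2\<close>.\<close>

definition generator :: "(real \<Rightarrow> real) \<Rightarrow> real \<Rightarrow> ((real \<Rightarrow> real) \<times> (real \<Rightarrow> real)) set" where
  "generator a \<alpha> = {(f, Lf). f \<in> form_dom a \<alpha> \<and> Lf \<in> L2 (mu a) \<and>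
     (\<forall>g \<in> form_dom a \<alpha>. form \<alpha> f g = - (\<integral>x. Lf x * g x \<partial>mu a))}"

definition generator_dom :: "(real \<Rightarrow> real) \<Rightarrow> real \<Rightarrow> (real \<Rightarrow> real) set" where
  "generator_dom a \<alpha> = Domain (generator a \<alpha>)"

end

theory Submission
  imports Defs
begin

text \<open>Write \<open>q = 2 - p\<close> and \<open>tail R\<close> for the mass of \<open>{x. \<bar>x\<bar> \<ge> R}\<close>.

  Necessity: the generator domain need not contain any explicit bump, but it approximates every \<open>f\<close>
  in the form domain by resolvents that do not increase the energy, obtained by minimising
  \<open>energy u + k \<parallel>u - f\<parallel>\<^sup>2\<close>; so the inequality passes to ramps that vanish on \<open>[-R/2, R/2]\<close> and equal
  \<open>1\<close> outside \<open>[-R, R]\<close>, whose energy is of order \<open>R\<^bsup>1 - \<alpha>\<^esup>\<close>. Hoelder's inequality on the support and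
  the choice \<open>q = 1 / ln (1 / tail (R/2))\<close> give the tail condition with \<open>tail (R/2)\<close> inside the
  logarithm, and that is replaced by \<open>tail R\<close> by comparing \<open>tail (R/2)\<^sup>2\<close> with \<open>tail R\<close>.

  Sufficiency: by convexity the deficit \<open>\<mu>(f\<^sup>2) - \<mu>(\<bar>f\<bar>\<^sup>p)\<^bsup>2/p\<^esup>\<close> is at most \<open>\<mu>(psi p s \<bar>f\<bar>)\<close> for every
  \<open>s > 0\<close>, where \<open>psi p s\<close> vanishes to second order at \<open>s\<close> and is bounded by
  \<open>q\<^sup>\<xi> (x - s)\<^sup>2 ln\<^sup>\<xi>\<close> of the relative distance. With \<open>h = \<bar>\<bar>f\<bar> - \<bar>f x0\<bar>\<bar>\<close> for some \<open>x0\<close> near the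
  origin and \<open>s = \<bar>f x0\<bar> + \<parallel>h\<parallel>\<close> it remains to prove a Hardy inequality for \<open>h\<close> with a
  logarithmic weight. This follows from Maz'ya's truncation method: the dyadic truncations of \<open>h\<close>
  have total energy at most that of \<open>h\<close>, and since \<open>\<alpha> > 1\<close> the Hoelder estimate keeps each level set away
  from the origin, so that the tail condition controls its measure.\<close>

section \<open>Pointwise inequalities\<close>

text \<open>The exponent \<xi> enters \<open>psi\<close> through one interpolation:
  \<open>psi\<close> has a quadratic bound without gain in \<open>q\<close> and another with the
  extra factor \<open>q\<close> times a logarithm, and the smaller of the two is at most the
  quadratic bound times the power \<xi> of that factor. Taking \<open>s\<close> at least
  \<parallel>h\<parallel> measures the relative distance in units of \<parallel>h\<parallel>; on the
  set where \<open>h\<close> is of order \<open>2^k \<parallel>h\<parallel>\<close> Markov's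
  inequality then turns the logarithm of the height into the logarithm of the inverse measure, which
  is the quantity in the tail condition. The norm \<parallel>h\<parallel> itself is controlled
  without a separate Poincare inequality: values of \<open>h\<close> below \<parallel>h\<parallel>/2
  account for at most a quarter of \<parallel>h\<parallel>^2, so the weighted integral over the
  larger values bounds \<parallel>h\<parallel>^2 as well. Elements of the form domain are Borel
  functions determined up to null sets, so point values are used only where the inner integral of
  the energy is finite, which is almost everywhere. In the necessity part the ramp needs a distance
  of order R to climb cheaply, and this is what puts R/2 inside the logarithm.\<close>

lemma powr_unit_exponent_le:
  fixes x y \<xi> :: real
  assumes "0 < \<xi>" "\<xi> \<le> 1" "0 \<le> x" "x \<le> 1" "x \<le> y"
  shows "x \<le> y powr \<xi>"
proof (cases "x = 0")
  case False
  have "x = x powr 1" using assms by simp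
  also have "\<dots> \<le> x powr \<xi>" using assms False by (intro powr_mono') auto
  also have "\<dots> \<le> y powr \<xi>" using assms by (intro powr_mono2) auto
  finally show ?thesis .
qed simp

lemma powr_le_self:
  fixes x \<xi> :: real
  assumes "0 < \<xi>" "\<xi> \<le> 1" "1 \<le> x"
  shows "x powr \<xi> \<le> x"
  using powr_mono[of \<xi> 1 x] assms by simp

text \<open>For the p-th moment t, the term \<open>t powr (2 / p)\<close> of the deficit is replaced
  by its tangent at \<open>s powr p\<close>. The result is affine in t, so under a probability
  measure it is the integral of this pointwise function.\<close>

definition psi :: "real \<Rightarrow> real \<Rightarrow> real \<Rightarrow> real" where
  "psi p s x = x\<^sup>2 - (2 / p) * (s powr (2 - p) * x powr p) + ((2 - p) / p) * s\<^sup>2"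

lemma psi_scale:
  assumes "s > 0" "x \<ge> 0"
  shows "psi p s x = s\<^sup>2 * psi p 1 (x / s)"
proof -
  have "s\<^sup>2 * (x / s) powr p = s powr (2 - p) * x powr p"
    using assms by (simp add: powr_divide powr_diff)
  then show ?thesis
    using assms by (simp add: psi_def field_simps power2_eq_square)
qed

text \<open>By exp(-u) \<ge> 1 - u with u = (2 - p) ln x, \<open>p * psi p 1 x\<close> is at most 2
  - p times the entropy function 2 x^2 ln x - x^2 + 1. Up to x = 2 this function is bounded by a
  multiple of (x - 1)^2; beyond, x \<le> 2 (x - 1) bounds its leading term by 8 (x - 1)^2 ln x,
  whence the constant 8.\<close>

lemma psi_one_le_sq:
  assumes "1 \<le> p" "p < 2" "x \<ge> 0"
  shows "psi p 1 x \<le> 8 * (x - 1)\<^sup>2"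
    and "psi p 1 x \<le> 8 * (x - 1)\<^sup>2 * ((2 - p) * (1 + ln (1 + \<bar>x - 1\<bar>)))"
proof -
  define q where "q = 2 - p"
  have q: "0 < q" "q \<le> 1" using assms by (auto simp: q_def)
  have p: "p > 0" "p = 2 - q" using assms by (auto simp: q_def)
  have main: "psi p 1 x \<le> q * (2 * x\<^sup>2 * ln x - x\<^sup>2 + 1)"
  proof (cases "x = 0")
    case True
    have "q / p \<le> q / 1" using assms q by (intro divide_left_mono) auto
    then show ?thesis using True assms q by (simp add: psi_def q_def)
  next
    case False
    then have x: "x > 0" using assms by simp
    have "x powr p = x\<^sup>2 * exp (- (q * ln x))"
      using x by (simp add: p(2) powr_diff powr_def[of x q] exp_minus divide_inverse)
    also have "\<dots> \<ge> x\<^sup>2 * (1 - q * ln x)"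
      using exp_ge_add_one_self[of "- (q * ln x)"] by (intro mult_left_mono) auto
    finally have xp: "x powr p \<ge> x\<^sup>2 * (1 - q * ln x)" .
    have "psi p 1 x = x\<^sup>2 - (2 / p) * x powr p + q / p" by (simp add: psi_def q_def)
    then have "p * psi p 1 x = p * x\<^sup>2 - 2 * x powr p + q"
      using p(1) by (simp add: right_diff_distrib distrib_left)
    also have "\<dots> \<le> p * x\<^sup>2 - 2 * (x\<^sup>2 * (1 - q * ln x)) + q" using xp by simp
    also have "\<dots> = q * (2 * x\<^sup>2 * ln x - x\<^sup>2 + 1)" unfolding p(2) by (simp add: algebra_simps)
    finally have *: "p * psi p 1 x \<le> q * (2 * x\<^sup>2 * ln x - x\<^sup>2 + 1)" .
    \<comment> \<open>The entropy factor is nonnegative, in fact at least (x - 1)^2, so the factor 1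
      / p \<le> 1 in front of it may be dropped.\<close>
    have lnx: "ln x \<ge> 1 - 1 / x"
      using ln_le_minus_one[of "1/x"] x by (simp add: ln_div)
    have "2 * x\<^sup>2 * ln x - x\<^sup>2 + 1 \<ge> 2 * x\<^sup>2 * (1 - 1/x) - x\<^sup>2 + 1"
      using mult_left_mono[OF lnx, of "2 * x\<^sup>2"] by simp
    also have "2 * x\<^sup>2 * (1 - 1/x) - x\<^sup>2 + 1 = (x - 1)\<^sup>2"
      using x by (simp add: field_simps power2_eq_square)
    finally have nn: "0 \<le> 2 * x\<^sup>2 * ln x - x\<^sup>2 + 1"
      by (meson order_trans zero_le_power2)
    have "psi p 1 x \<le> q * (2 * x\<^sup>2 * ln x - x\<^sup>2 + 1)"
    proof (cases "psi p 1 x \<le> 0")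
      case True
      then show ?thesis using nn q by (meson mult_nonneg_nonneg less_imp_le order_trans)
    next
      case False
      then have "psi p 1 x \<le> p * psi p 1 x" using assms by (simp add: mult_le_cancel_right1)
      then show ?thesis using * by simp
    qed
    then show ?thesis .
  qed
  have small: "2 * x\<^sup>2 * ln x - x\<^sup>2 + 1 \<le> 5 * (x - 1)\<^sup>2" if "x \<le> 2"
  proof (cases "x = 0")
    case False
    then have x: "x > 0" using assms by simp
    have "2 * x\<^sup>2 * ln x \<le> 2 * x\<^sup>2 * (x - 1)"
      using ln_le_minus_one[of x] x by (intro mult_left_mono) auto
    \<comment> \<open>The algebra is the exact factorisation 2 x^2 (x - 1) - x^2 + 1 = (x - 1)^2 (2
      x + 1).\<close>
    then have "2 * x\<^sup>2 * ln x - x\<^sup>2 + 1 \<le> (x - 1)\<^sup>2 * (2 * x + 1)"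
      by (simp add: algebra_simps power2_eq_square power3_eq_cube)
    also have "\<dots> \<le> (x - 1)\<^sup>2 * 5" using that by (intro mult_left_mono) auto
    finally show ?thesis by simp
  qed simp
  have big: "x\<^sup>2 \<le> 4 * (x - 1)\<^sup>2" if "x \<ge> 2"
  proof -
    have "x\<^sup>2 \<le> (2 * (x - 1))\<^sup>2" using that by (intro power_mono) auto
    then show ?thesis by (simp only: power_mult_distrib) simp
  qed
  have bnd: "psi p 1 x \<le> q * (5 * (x - 1)\<^sup>2)" if "x \<le> 2"
    using main small[OF that] q by (meson mult_left_mono order_trans less_imp_le)
  show "psi p 1 x \<le> 8 * (x - 1)\<^sup>2"
  proof (cases "x \<le> 2")
    case True
    have "q * (5 * (x - 1)\<^sup>2) \<le> 1 * (5 * (x - 1)\<^sup>2)" using q by (intro mult_right_mono) auto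
    then show ?thesis using bnd[OF True] by (smt (verit) zero_le_power2)
  next
    case False
    then have "1 \<le> x powr p" using assms by (intro ge_one_powr_ge_zero) auto
    moreover have "psi p 1 x = x\<^sup>2 - (2 / p) * (x powr p) + (2/p - 1)"
      using p(1) by (simp add: psi_def diff_divide_distrib)
    moreover have "(2 / p) * 1 \<le> (2 / p) * x powr p"
      using \<open>1 \<le> x powr p\<close> p by (intro mult_left_mono) auto
    ultimately have "psi p 1 x \<le> x\<^sup>2" by linarith
    then show ?thesis using big False by (smt (verit) zero_le_power2)
  qed
  have L: "1 \<le> 1 + ln (1 + \<bar>x - 1\<bar>)" by simp
  show "psi p 1 x \<le> 8 * (x - 1)\<^sup>2 * ((2 - p) * (1 + ln (1 + \<bar>x - 1\<bar>)))"
  proof (cases "x \<le> 2")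
    case True
    have "psi p 1 x \<le> q * (5 * (x - 1)\<^sup>2)" by (rule bnd[OF True])
    also have "\<dots> \<le> q * (8 * (x - 1)\<^sup>2)" using q by (intro mult_left_mono) auto
    also have "\<dots> = 8 * (x - 1)\<^sup>2 * (q * 1)" by simp
    also have "\<dots> \<le> 8 * (x - 1)\<^sup>2 * (q * (1 + ln (1 + \<bar>x - 1\<bar>)))"
      using L q by (intro mult_left_mono) auto
    finally show ?thesis by (simp add: q_def)
  next
    case False
    have lx: "0 \<le> ln x" using False by simp
    have "1 \<le> x\<^sup>2" using False by (simp add: one_le_power)
    then have "psi p 1 x \<le> q * (2 * x\<^sup>2 * ln x)"
      using main q by (smt (verit) mult_left_mono)
    also have "\<dots> \<le> q * (2 * (4 * (x - 1)\<^sup>2) * ln x)"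
      using big False q lx by (intro mult_left_mono mult_right_mono) auto
    also have "\<dots> = 8 * (x - 1)\<^sup>2 * (q * ln x)" by simp
    also have "\<dots> \<le> 8 * (x - 1)\<^sup>2 * (q * (1 + ln (1 + \<bar>x - 1\<bar>)))"
      using False q by (intro mult_left_mono) auto
    finally show ?thesis by (simp add: q_def)
  qed
qed

text \<open>Scaling reduces to s = 1. There the two bounds combine to the factor min 1 t with t = (2
  - p) L, and min 1 t \<le> t^\<xi> for 0 < \<xi> \<le> 1.\<close>

lemma psi_le:
  assumes p: "1 \<le> p" "p < 2" and \<xi>: "0 < \<xi>" "\<xi> \<le> 1" and "0 < s" "0 \<le> x"
  shows "psi p s x \<le> 8 * (2 - p) powr \<xi> * ((x - s)\<^sup>2 * (1 + ln (1 + \<bar>x - s\<bar> / s)) powr \<xi>)"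
proof -
  define y where "y = x / s"
  have y: "y \<ge> 0" using assms by (simp add: y_def)
  define L where "L = 1 + ln (1 + \<bar>y - 1\<bar>)"
  have L: "1 \<le> L" by (simp add: L_def)
  have "psi p 1 y \<le> 8 * (y - 1)\<^sup>2 * min 1 ((2 - p) * L)"
    using psi_one_le_sq[OF p y] by (simp add: L_def min_def)
  also have "\<dots> \<le> 8 * (y - 1)\<^sup>2 * ((2 - p) * L) powr \<xi>"
    using p L by (intro mult_left_mono powr_unit_exponent_le \<xi>) auto
  also have "((2 - p) * L) powr \<xi> = (2 - p) powr \<xi> * L powr \<xi>"
    using p L by (intro powr_mult)
  finally have *: "psi p 1 y \<le> 8 * (y - 1)\<^sup>2 * ((2 - p) powr \<xi> * L powr \<xi>)" .
  have "psi p s x = s\<^sup>2 * psi p 1 y"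
    unfolding y_def by (intro psi_scale assms)
  also have "\<dots> \<le> s\<^sup>2 * (8 * (y - 1)\<^sup>2 * ((2 - p) powr \<xi> * L powr \<xi>))"
    using * by (intro mult_left_mono) auto
  also have "\<dots> = 8 * (2 - p) powr \<xi> * ((s * (y - 1))\<^sup>2 * L powr \<xi>)"
    by (simp add: power_mult_distrib)
  also have "s * (y - 1) = x - s" using assms by (simp add: y_def field_simps)
  also have "L = 1 + ln (1 + \<bar>x - s\<bar> / s)"
  proof -
    have "y - 1 = (x - s) / s" using assms by (simp add: y_def field_simps)
    then show ?thesis using assms by (simp add: L_def)
  qed
  finally show ?thesis .
qed

text \<open>The tangent of the convex function \<open>t \<mapsto> t powr (2 / p)\<close> at \<open>s powr p\<close>.\<close>

lemma powr_tangent_le: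
  fixes p s t :: real
  assumes p: "1 \<le> p" "p < 2" and "0 < s" "0 \<le> t"
  shows "(2 / p) * (s powr (2 - p) * t) - ((2 - p) / p) * s\<^sup>2 \<le> t powr (2 / p)"
proof (cases "t = 0")
  case True then show ?thesis using assms by simp
next
  case False
  then have t: "t > 0" using assms by simp
  \<comment> \<open>The tangent inequality is the weighted inequality between geometric and
    arithmetic mean for \<open>t powr (2/p)\<close> and s^2, with weights p/2 and (2 - p)/2.\<close>
  have "(t powr (2/p)) powr (p/2) * (s\<^sup>2) powr ((2-p)/2) \<le> (p/2) * t powr (2/p) + ((2-p)/2) * s\<^sup>2"
    by (rule Youngs_inequality_0) (use p t assms in \<open>auto simp: field_simps\<close>)
  also have "(t powr (2/p)) powr (p/2) = t" using p t by (simp add: powr_powr)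
  also have "(s\<^sup>2) powr ((2-p)/2) = s powr (2-p)"
  proof -
    have "s\<^sup>2 = s powr 2" "2 * ((2-p)/2) = 2 - p" using assms by simp_all
    then show ?thesis by (simp only: powr_powr)
  qed
  finally have "t * s powr (2 - p) \<le> (p/2) * t powr (2/p) + ((2-p)/2) * s\<^sup>2" .
  then have "(2/p) * (t * s powr (2 - p)) \<le> (2/p) * ((p/2) * t powr (2/p) + ((2-p)/2) * s\<^sup>2)"
    using p by (intro mult_left_mono) auto
  then show ?thesis using p by (simp add: distrib_left mult_ac)
qed

text \<open>Passing from M to m adds t = ln (M / m) to a logarithmic term l \<ge> 1, hence
  multiplies it by at most 1 + t \<le> exp t = M / m, which the prefactor m gains back. This carries
  an estimate of a measure over to its logarithmic profile, including measure zero.\<close>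

lemma log_profile_mono:
  fixes m M \<xi> :: real
  assumes \<xi>: "0 < \<xi>" "\<xi> \<le> 1" and m: "0 \<le> m" "m \<le> M" "M \<le> 1"
  shows "m * (1 + ln (4 / m)) powr \<xi> \<le> M * (1 + ln (4 / M)) powr \<xi>"
proof (cases "m = 0")
  case False
  then have m0: "0 < m" "0 < M" using m by auto
  define l where "l = 1 + ln (4 / M)"
  have l: "1 \<le> l" using m m0 by (simp add: l_def)
  define t where "t = ln (M / m)"
  have t: "0 \<le> t" using m m0 by (simp add: t_def)
  have "1 + ln (4 / m) = l + t" using m0 by (simp add: l_def t_def ln_div)
  also have "\<dots> \<le> l * (1 + t)" using l t by (simp add: algebra_simps mult_le_cancel_right1)
  finally have "(1 + ln (4 / m)) powr \<xi> \<le> (l * (1 + t)) powr \<xi>"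
    using m m0 \<xi> by (intro powr_mono2) auto
  also have "\<dots> = l powr \<xi> * (1 + t) powr \<xi>" using l t by (simp add: powr_mult)
  also have "\<dots> \<le> l powr \<xi> * (1 + t)" using \<xi> t by (intro mult_left_mono powr_le_self) auto
  also have "\<dots> \<le> l powr \<xi> * exp t" by (intro mult_left_mono exp_ge_add_one_self) auto
  also have "exp t = M / m" using m0 by (simp add: t_def)
  finally show ?thesis using m0 by (simp add: l_def field_simps)
qed (use m in simp)

section \<open>Dyadic slices of the values of a function\<close>

definition trunc_level :: "real \<Rightarrow> real \<Rightarrow> real" where
  "trunc_level b u = min (max (u - b) 0) b"

lemma trunc_level_contraction:
  assumes "b \<ge> 0" shows "\<bar>trunc_level b u - trunc_level b v\<bar> \<le> \<bar>u - v\<bar>"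
  using assms by (auto simp: trunc_level_def min_def max_def)

text \<open>The slices [b 2^k, b 2^(k+1)] of the value axis fit end to end, so their sum is a single
  clamp of height b (2^n - 1).\<close>

lemma sum_trunc_level:
  assumes "b \<ge> 0"
  shows "(\<Sum>k<n. trunc_level (b * 2 ^ k) u) = min (max (u - b) 0) (b * (2 ^ n - 1))"
proof (induction n)
  case (Suc n)
  define c where "c = b * 2 ^ n"
  have c: "b \<le> c" using assms by (auto simp: c_def mult_le_cancel_left1)
  have "trunc_level c u + min (max (u - b) 0) (c - b) = min (max (u - b) 0) (2 * c - b)"
    using c assms by (simp add: trunc_level_def min_def max_def)
  moreover have "b * (2 ^ Suc n - 1) = 2 * c - b" "b * (2 ^ n - 1) = c - b"
    by (simp_all add: c_def algebra_simps)
  ultimately show ?case using Suc.IH by (simp add: c_def add.commute)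
qed simp

lemma sum_power2_le_power2_sum:
  fixes f :: "'a \<Rightarrow> real"
  assumes "\<And>i. i \<in> A \<Longrightarrow> 0 \<le> f i"
  shows "(\<Sum>i\<in>A. (f i)\<^sup>2) \<le> (\<Sum>i\<in>A. f i)\<^sup>2"
  using assms
proof (induction A rule: infinite_finite_induct)
  case (insert x F)
  then have "0 \<le> f x * sum f F" by (intro mult_nonneg_nonneg sum_nonneg) auto
  then show ?case using insert by (simp add: power2_sum)
qed auto

text \<open>Each slice is nondecreasing in the value, so all increments have the same sign and the
  sum of their squares is at most the square of their sum; the sum of the slices is
  1-Lipschitz.\<close>

lemma sum_trunc_level_diff_le:
  assumes "b \<ge> 0"
  shows "(\<Sum>k<n. (trunc_level (b * 2 ^ k) u - trunc_level (b * 2 ^ k) v)\<^sup>2) \<le> (u - v)\<^sup>2"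
proof -
  have *: "(\<Sum>k<n. (trunc_level (b * 2 ^ k) u - trunc_level (b * 2 ^ k) v)\<^sup>2) \<le> (u - v)\<^sup>2"
    if "v \<le> u" for u v
  proof -
    have "(\<Sum>k<n. (trunc_level (b * 2 ^ k) u - trunc_level (b * 2 ^ k) v)\<^sup>2)
        \<le> (\<Sum>k<n. trunc_level (b * 2 ^ k) u - trunc_level (b * 2 ^ k) v)\<^sup>2"
      using that by (intro sum_power2_le_power2_sum) (auto simp: trunc_level_def)
    also have "\<dots> \<le> (u - v)\<^sup>2"
      unfolding sum_subtractf sum_trunc_level[OF assms]
      using that assms by (intro power_mono) (auto simp: min_def max_def)
    finally show ?thesis .
  qed
  show ?thesis
    using *[of v u] *[of u v] by (cases "v \<le> u") (auto simp: power2_commute)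
qed

section \<open>Energy and Hoelder regularity\<close>

lemma stable_const_pos:
  assumes "0 < \<alpha>" "\<alpha> < 2"
  shows "0 < stable_const \<alpha>"
  unfolding stable_const_def using assms
  by (intro divide_pos_pos mult_pos_pos Gamma_real_pos) auto

lemma form_integrand_same:
  "form_integrand \<alpha> f f (x, y) = (f x - f y)\<^sup>2 * (stable_const \<alpha> / \<bar>x - y\<bar> powr (1 + \<alpha>))"
  by (simp add: form_integrand_def power2_eq_square)

lemma form_integrand_nonneg:
  assumes "0 < \<alpha>" "\<alpha> < 2"
  shows "0 \<le> form_integrand \<alpha> f f z"
  using stable_const_pos[OF assms] by (cases z) (simp add: form_integrand_same)

lemma form_integrand_measurable [measurable]:
  assumes [measurable]: "f \<in> borel_measurable borel" "g \<in> borel_measurable borel"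
  shows "form_integrand \<alpha> f g \<in> borel_measurable (lborel \<Otimes>\<^sub>M lborel)"
  unfolding form_integrand_def by measurable

text \<open>Twice the Dirichlet form, with values in the extended nonnegative reals so that
  truncations and limits can be handled before finiteness is known.\<close>

definition energy :: "real \<Rightarrow> (real \<Rightarrow> real) \<Rightarrow> ennreal" where
  "energy \<alpha> f = (\<integral>\<^sup>+z. ennreal (form_integrand \<alpha> f f z) \<partial>(lborel \<Otimes>\<^sub>M lborel))"

text \<open>Finiteness at x serves as the regularity condition under which the value
  \<open>f x\<close> itself, and not only the class of f, is meaningful.\<close>

definition energy_at :: "real \<Rightarrow> (real \<Rightarrow> real) \<Rightarrow> real \<Rightarrow> ennreal" where
  "energy_at \<alpha> f x = (\<integral>\<^sup>+y. ennreal (form_integrand \<alpha> f f (x, y)) \<partial>lborel)"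

lemma energy_at_measurable [measurable]:
  assumes [measurable]: "f \<in> borel_measurable borel"
  shows "energy_at \<alpha> f \<in> borel_measurable borel"
proof -
  have "(\<lambda>x. \<integral>\<^sup>+y. ennreal (form_integrand \<alpha> f f (x, y)) \<partial>lborel) \<in> borel_measurable lborel"
    by measurable
  then show ?thesis by (simp add: energy_at_def[abs_def])
qed

lemma energy_eq_energy_at:
  assumes [measurable]: "f \<in> borel_measurable borel"
  shows "energy \<alpha> f = (\<integral>\<^sup>+x. energy_at \<alpha> f x \<partial>lborel)"
  unfolding energy_def energy_at_def
  by (rule lborel.nn_integral_fst[symmetric]) measurable

lemma AE_energy_at_finite:
  assumes [measurable]: "f \<in> borel_measurable borel" and "energy \<alpha> f < \<infinity>"
  shows "AE x in lborel. energy_at \<alpha> f x < \<infinity>"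
proof -
  have "(\<integral>\<^sup>+x. energy_at \<alpha> f x \<partial>lborel) \<noteq> \<infinity>"
    using assms(2) energy_eq_energy_at[OF assms(1), of \<alpha>] by simp
  then have "AE x in lborel. energy_at \<alpha> f x \<noteq> \<infinity>"
    by (rule nn_integral_noteq_infinite[rotated]) simp
  then show ?thesis by eventually_elim (simp add: less_top)
qed

lemma form_integrand_mono:
  assumes "0 < \<alpha>" "\<alpha> < 2" and "\<bar>f x - f y\<bar> \<le> \<bar>g x - g y\<bar>"
  shows "form_integrand \<alpha> f f (x, y) \<le> form_integrand \<alpha> g g (x, y)"
  unfolding form_integrand_same using stable_const_pos[OF assms(1,2)] assms(3)
  by (intro mult_right_mono) (auto simp: abs_le_square_iff)

text \<open>The contraction property of a Dirichlet form; it covers truncations, absolute values and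
  shifts by constants.\<close>

lemma energy_mono:
  assumes "0 < \<alpha>" "\<alpha> < 2" and "\<And>x y. \<bar>f x - f y\<bar> \<le> \<bar>g x - g y\<bar>"
  shows "energy \<alpha> f \<le> energy \<alpha> g"
  unfolding energy_def
  by (intro nn_integral_mono ennreal_leI) (auto intro: form_integrand_mono assms)

lemma energy_at_mono:
  assumes "0 < \<alpha>" "\<alpha> < 2" and "\<And>x y. \<bar>f x - f y\<bar> \<le> \<bar>g x - g y\<bar>"
  shows "energy_at \<alpha> f x \<le> energy_at \<alpha> g x"
  unfolding energy_at_def
  by (intro nn_integral_mono ennreal_leI) (auto intro: form_integrand_mono assms)

section \<open>Means over intervals and Campanato's estimate\<close>

definition mean_on :: "real set \<Rightarrow> (real \<Rightarrow> real) \<Rightarrow> real" where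
  "mean_on A f = (LINT v:A|lborel. f v) / measure lborel A"

text \<open>Jensen's inequality for the square, by Cauchy-Schwarz against the indicator of A.
  Finiteness of the right-hand side makes f integrable on A; otherwise the Bochner integral in
  \<open>mean_on\<close> would take the default value 0.\<close>

lemma mean_on_deviation:
  fixes f :: "real \<Rightarrow> real" and L c :: real
  assumes [measurable]: "f \<in> borel_measurable borel" "A \<in> sets borel"
    and A: "emeasure lborel A = ennreal L" "0 < L"
    and fin: "(\<integral>\<^sup>+v\<in>A. ennreal ((c - f v)\<^sup>2) \<partial>lborel) < \<infinity>"
  shows "ennreal ((c - mean_on A f)\<^sup>2) \<le> (\<integral>\<^sup>+v\<in>A. ennreal ((c - f v)\<^sup>2) \<partial>lborel) / ennreal L"
proof -
  let ?Q = "\<integral>\<^sup>+v\<in>A. ennreal ((c - f v)\<^sup>2) \<partial>lborel"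
  let ?P = "\<integral>\<^sup>+v. ennreal (norm (indicator A v * (c - f v))) \<partial>lborel"
  have mA: "measure lborel A = L" using A by (simp add: measure_def)
  have "?P\<^sup>2 = (\<integral>\<^sup>+v. ennreal \<bar>c - f v\<bar> * indicator A v * indicator A v \<partial>lborel)\<^sup>2"
    by (intro arg_cong[where f="\<lambda>x. x\<^sup>2"] nn_integral_cong) (auto simp: indicator_def abs_mult)
  also have "\<dots> \<le> (\<integral>\<^sup>+v. (ennreal \<bar>c - f v\<bar> * indicator A v)\<^sup>2 \<partial>lborel) * (\<integral>\<^sup>+v. (indicator A v)\<^sup>2 \<partial>lborel)"
    by (intro Cauchy_Schwarz_nn_integral) auto
  also have "(\<integral>\<^sup>+v. (ennreal \<bar>c - f v\<bar> * indicator A v)\<^sup>2 \<partial>lborel) = ?Q"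
    by (intro nn_integral_cong) (auto simp: indicator_def ennreal_power)
  also have "(\<integral>\<^sup>+v. (indicator A v)\<^sup>2 \<partial>lborel) = (\<integral>\<^sup>+v. indicator A v \<partial>lborel)"
    by (intro nn_integral_cong) (auto simp: indicator_def)
  also have "\<dots> = ennreal L" using A by simp
  finally have PQ: "?P\<^sup>2 \<le> ?Q * ennreal L" .
  also have "\<dots> < \<infinity>" using fin by (simp add: ennreal_mult_less_top)
  finally have "?P\<^sup>2 < \<infinity>" .
  then have Pfin: "?P < \<infinity>" by (auto simp: less_top[symmetric])
  have int: "integrable lborel (\<lambda>v. indicator A v * (c - f v))"
    by (rule integrableI_bounded) (use Pfin in auto)
  have intA: "integrable lborel (\<lambda>v. indicator A v * c)"
    using A by (intro integrable_mult_left integrable_real_indicator) auto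
  have intf: "integrable lborel (\<lambda>v. indicator A v * f v)"
    using Bochner_Integration.integrable_diff[OF intA int]
    by (rule Bochner_Integration.integrable_cong[THEN iffD1, rotated 2]) (auto simp: algebra_simps)
  have "(\<integral>v. indicator A v * (c - f v) \<partial>lborel) = (\<integral>v. indicator A v * c - indicator A v * f v \<partial>lborel)"
    by (simp add: algebra_simps)
  also have "\<dots> = (\<integral>v. indicator A v * c \<partial>lborel) - (\<integral>v. indicator A v * f v \<partial>lborel)"
    by (intro Bochner_Integration.integral_diff intA intf)
  also have "\<dots> = L * (c - mean_on A f)"
    using A mA by (simp add: mean_on_def set_lebesgue_integral_def field_simps)
  finally have eq: "L * (c - mean_on A f) = (\<integral>v. indicator A v * (c - f v) \<partial>lborel)" by simp
  have "ennreal (L * \<bar>c - mean_on A f\<bar>) = ennreal \<bar>\<integral>v. indicator A v * (c - f v) \<partial>lborel\<bar>"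
    using A by (simp add: eq[symmetric] abs_mult)
  also have "\<dots> \<le> ?P"
    using integral_norm_bound_ennreal[OF int] by simp
  finally have "(ennreal (L * \<bar>c - mean_on A f\<bar>))\<^sup>2 \<le> ?P\<^sup>2" by (intro power_mono) auto
  then have *: "ennreal (L\<^sup>2 * (c - mean_on A f)\<^sup>2) \<le> ?Q * ennreal L"
    using PQ A by (simp add: ennreal_power power_mult_distrib)
  obtain q where q: "?Q = ennreal q" "q \<ge> 0"
    using fin by (cases ?Q) auto
  have "L\<^sup>2 * (c - mean_on A f)\<^sup>2 \<le> q * L"
    using * A q by (simp add: ennreal_mult[symmetric])
  then have "L * ((c - mean_on A f)\<^sup>2 * L) \<le> L * q"
    by (simp add: power2_eq_square mult_ac)
  then have "(c - mean_on A f)\<^sup>2 \<le> q / L"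
    using A by (simp add: pos_le_divide_eq)
  then show ?thesis using A q by (simp add: divide_ennreal ennreal_leI)
qed

text \<open>At distance at most d the jump kernel is at least
  \<open>stable_const \<alpha> / d powr (1 + \<alpha>)\<close>, which turns plain squared
  differences into energy.\<close>

lemma sq_le_form_integrand:
  assumes "0 < \<alpha>" "\<alpha> < 2" "\<bar>u - v\<bar> \<le> d"
  shows "(f u - f v)\<^sup>2 \<le> (d powr (1 + \<alpha>) / stable_const \<alpha>) * form_integrand \<alpha> f f (u, v)"
proof (cases "u = v")
  case False
  then have *: "0 < \<bar>u - v\<bar>" by simp
  have "1 \<le> d powr (1 + \<alpha>) / \<bar>u - v\<bar> powr (1 + \<alpha>)"
    using powr_mono2[of "1 + \<alpha>" "\<bar>u - v\<bar>" d] assms * by simp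
  then have "(f u - f v)\<^sup>2 * 1 \<le> (f u - f v)\<^sup>2 * (d powr (1 + \<alpha>) / \<bar>u - v\<bar> powr (1 + \<alpha>))"
    by (intro mult_left_mono) auto
  also have "\<dots> = (d powr (1 + \<alpha>) / stable_const \<alpha>) * form_integrand \<alpha> f f (u, v)"
    using stable_const_pos[OF assms(1,2)] by (simp add: form_integrand_same field_simps)
  finally show ?thesis by simp
qed (use form_integrand_nonneg[OF assms(1,2)] stable_const_pos[OF assms(1,2)] in simp)

lemma set_nn_integral_sq_le_energy_at:
  assumes \<alpha>: "0 < \<alpha>" "\<alpha> < 2" and [measurable]: "f \<in> borel_measurable borel"
    and "\<And>v. v \<in> A \<Longrightarrow> \<bar>x - v\<bar> \<le> d"
  shows "(\<integral>\<^sup>+v\<in>A. ennreal ((f x - f v)\<^sup>2) \<partial>lborel)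
    \<le> ennreal (d powr (1 + \<alpha>) / stable_const \<alpha>) * energy_at \<alpha> f x"
proof -
  have "(\<integral>\<^sup>+v\<in>A. ennreal ((f x - f v)\<^sup>2) \<partial>lborel)
    \<le> (\<integral>\<^sup>+v. ennreal (d powr (1 + \<alpha>) / stable_const \<alpha>) * ennreal (form_integrand \<alpha> f f (x, v)) \<partial>lborel)"
  proof (rule nn_integral_mono)
    fix v
    show "ennreal ((f x - f v)\<^sup>2) * indicator A v
      \<le> ennreal (d powr (1 + \<alpha>) / stable_const \<alpha>) * ennreal (form_integrand \<alpha> f f (x, v))"
    proof (cases "v \<in> A")
      case True
      then show ?thesis
        using stable_const_pos[OF \<alpha>] form_integrand_nonneg[OF \<alpha>]
          sq_le_form_integrand[OF \<alpha>, of x v d f] assms(4)[OF True]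
        by (simp only: ennreal_mult[symmetric] divide_nonneg_nonneg powr_ge_zero less_imp_le) (simp add: ennreal_leI)
    qed simp
  qed
  also have "\<dots> = ennreal (d powr (1 + \<alpha>) / stable_const \<alpha>) * energy_at \<alpha> f x"
    unfolding energy_at_def by (intro nn_integral_cmult) measurable
  finally show ?thesis .
qed

lemma dist_mean_on_le_energy_at:
  assumes \<alpha>: "0 < \<alpha>" "\<alpha> < 2" and f [measurable]: "f \<in> borel_measurable borel" "A \<in> sets borel"
    and A: "emeasure lborel A = ennreal L" "0 < L" "\<And>v. v \<in> A \<Longrightarrow> \<bar>x - v\<bar> \<le> d"
    and fin: "energy_at \<alpha> f x < \<infinity>"
  shows "ennreal ((f x - mean_on A f)\<^sup>2)
    \<le> ennreal (d powr (1 + \<alpha>) / (stable_const \<alpha> * L)) * energy_at \<alpha> f x"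
proof -
  note C = stable_const_pos[OF \<alpha>]
  have le: "(\<integral>\<^sup>+v\<in>A. ennreal ((f x - f v)\<^sup>2) \<partial>lborel)
    \<le> ennreal (d powr (1 + \<alpha>) / stable_const \<alpha>) * energy_at \<alpha> f x"
    by (rule set_nn_integral_sq_le_energy_at) (use assms in auto)
  also have "\<dots> < \<infinity>" using fin by (simp add: ennreal_mult_less_top)
  finally have "ennreal ((f x - mean_on A f)\<^sup>2)
      \<le> (\<integral>\<^sup>+v\<in>A. ennreal ((f x - f v)\<^sup>2) \<partial>lborel) / ennreal L"
    by (intro mean_on_deviation f A)
  also have "\<dots> \<le> (ennreal (d powr (1 + \<alpha>) / stable_const \<alpha>) * energy_at \<alpha> f x) / ennreal L"
    by (intro divide_right_mono_ennreal le)
  also have "\<dots> = ennreal (d powr (1 + \<alpha>) / (stable_const \<alpha> * L)) * energy_at \<alpha> f x"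
    using fin A C by (cases "energy_at \<alpha> f x") (auto simp: ennreal_mult[symmetric] divide_ennreal)
  finally show ?thesis .
qed

text \<open>Jensen is applied twice: over B with u fixed, which produces \<open>energy_at\<close> at
  u, and then over A, where integrating in u restores the full energy.\<close>

lemma dist_mean_on_le_energy:
  assumes \<alpha>: "0 < \<alpha>" "\<alpha> < 2" and f [measurable]: "f \<in> borel_measurable borel"
    and [measurable]: "A \<in> sets borel" "B \<in> sets borel"
    and A: "emeasure lborel A = ennreal L" "0 < L"
    and B: "emeasure lborel B = ennreal K" "0 < K"
    and d: "\<And>u v. u \<in> A \<Longrightarrow> v \<in> B \<Longrightarrow> \<bar>u - v\<bar> \<le> d"
    and fin: "energy \<alpha> f < \<infinity>"
  shows "ennreal ((mean_on B f - mean_on A f)\<^sup>2)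
    \<le> ennreal (d powr (1 + \<alpha>) / (stable_const \<alpha> * K * L)) * energy \<alpha> f"
proof -
  note C = stable_const_pos[OF \<alpha>]
  let ?c = "ennreal (d powr (1 + \<alpha>) / (stable_const \<alpha> * K))"
  let ?I = "\<integral>\<^sup>+u\<in>A. ennreal ((mean_on B f - f u)\<^sup>2) \<partial>lborel"
  have "?I \<le> (\<integral>\<^sup>+u. ?c * energy_at \<alpha> f u \<partial>lborel)"
  proof (rule nn_integral_mono_AE)
    show "AE u in lborel. ennreal ((mean_on B f - f u)\<^sup>2) * indicator A u \<le> ?c * energy_at \<alpha> f u"
      using AE_energy_at_finite[OF f fin]
    proof eventually_elim
      case (elim u)
      show ?case
      proof (cases "u \<in> A")
        case True
        have "ennreal ((f u - mean_on B f)\<^sup>2) \<le> ?c * energy_at \<alpha> f u"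
          using d[OF True] by (intro dist_mean_on_le_energy_at \<alpha> f B elim) auto
        then show ?thesis using True by (simp add: power2_commute)
      qed simp
    qed
  qed
  also have "\<dots> = ?c * energy \<alpha> f"
    by (subst nn_integral_cmult) (simp_all add: energy_eq_energy_at[OF f])
  finally have le: "?I \<le> ?c * energy \<alpha> f" .
  also have "\<dots> < \<infinity>" using fin by (simp add: ennreal_mult_less_top)
  finally have "ennreal ((mean_on B f - mean_on A f)\<^sup>2) \<le> ?I / ennreal L"
    by (intro mean_on_deviation f A) auto
  also have "\<dots> \<le> ?c * energy \<alpha> f / ennreal L"
    by (intro divide_right_mono_ennreal le)
  also have "\<dots> = ennreal (d powr (1 + \<alpha>) / (stable_const \<alpha> * K * L)) * energy \<alpha> f"
    using fin A B C by (cases "energy \<alpha> f") (auto simp: ennreal_mult[symmetric] divide_ennreal)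
  finally show ?thesis .
qed

lemma geometric_telescope:
  fixes m :: "nat \<Rightarrow> real"
  assumes lim: "m \<longlonglongrightarrow> l" and q: "0 \<le> q" "q < 1" "0 \<le> A"
    and step: "\<And>n. \<bar>m (Suc n) - m n\<bar> \<le> A * q ^ n"
  shows "\<bar>l - m 0\<bar> \<le> A / (1 - q)"
proof -
  have *: "\<bar>m n - m 0\<bar> \<le> A * (\<Sum>k<n. q ^ k)" for n
  proof (induction n)
    case (Suc n)
    then show ?case using step[of n] by (simp add: distrib_left)
  qed simp
  have "(\<Sum>k<n. q ^ k) \<le> 1 / (1 - q)" for n
    using q sum_le_suminf[OF summable_geometric[of q], of "{..<n}"] suminf_geometric[of q] by auto
  then have "A * (\<Sum>k<n. q ^ k) \<le> A / (1 - q)" for n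
    using mult_left_mono[of "\<Sum>k<n. q ^ k" "1 / (1 - q)" A] q by simp
  then have "\<bar>m n - m 0\<bar> \<le> A / (1 - q)" for n
    using * order_trans by blast
  moreover have "(\<lambda>n. \<bar>m n - m 0\<bar>) \<longlonglongrightarrow> \<bar>l - m 0\<bar>"
    by (intro tendsto_intros lim)
  ultimately show ?thesis by (intro LIMSEQ_le_const2) auto
qed

text \<open>The chain of means contributes 2 / (1 - q)^2 with ratio q = 2^(-(\<alpha> - 1)/2): the 2
  comes from halving the intervals, the rest from the geometric series. Joining the chains at x and
  y doubles the distance, hence a further factor 4 for its square.\<close>

definition holder_const :: "real \<Rightarrow> real" where
  "holder_const \<alpha> = 8 / (stable_const \<alpha> * (1 - (1 / 2) powr ((\<alpha> - 1) / 2))\<^sup>2)"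

lemma half_powr_less_1:
  assumes "1 < \<alpha>" shows "(1 / 2) powr ((\<alpha> - 1) / 2) < (1::real)"
  using powr_less_mono2[of "(\<alpha> - 1) / 2" "1/2" 1] assms by simp

lemma holder_const_pos:
  assumes "1 < \<alpha>" "\<alpha> < 2" shows "0 < holder_const \<alpha>"
  unfolding holder_const_def
  using stable_const_pos[of \<alpha>] half_powr_less_1[OF assms(1)] assms by simp

text \<open>Means over consecutive intervals of length d and d/2 differ by at most a constant times
  d^((\<alpha> - 1)/2), by comparing d^(1 + \<alpha>) with the product of the two lengths. Since
  \<alpha> > 1 these differences are summable along the halving sequence.\<close>

lemma dist_mean_on_shrinking:
  assumes \<alpha>: "1 < \<alpha>" "\<alpha> < 2" and f [measurable]: "f \<in> borel_measurable borel"
    and A_sets: "\<And>n. A n \<in> sets borel" and A: "\<And>n. emeasure lborel (A n) = ennreal (r / 2 ^ n)" "0 < r"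
    and A_mono: "\<And>n. A (Suc n) \<subseteq> A n"
    and diam: "\<And>n u v. u \<in> A n \<Longrightarrow> v \<in> A n \<Longrightarrow> \<bar>u - v\<bar> \<le> r / 2 ^ n"
    and x: "\<And>n v. v \<in> A n \<Longrightarrow> \<bar>x - v\<bar> \<le> r / 2 ^ n"
    and fin: "energy \<alpha> f = ennreal E" "0 \<le> E" "energy_at \<alpha> f x < \<infinity>"
  shows "\<bar>f x - mean_on (A 0) f\<bar> \<le> sqrt (holder_const \<alpha> / 4 * E * r powr (\<alpha> - 1))"
proof -
  have \<alpha>': "0 < \<alpha>" using \<alpha> by simp
  note C = stable_const_pos[OF \<alpha>' \<alpha>(2)]
  define d where "d n = r / 2 ^ n" for n
  have d: "0 < d n" "d (Suc n) = d n / 2" for n using A by (auto simp: d_def)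
  have d_lim: "d \<longlonglongrightarrow> 0"
    unfolding d_def[abs_def] using LIMSEQ_divide_realpow_zero[of 2 r] by simp
  obtain e where e: "energy_at \<alpha> f x = ennreal e" "0 \<le> e"
    using fin(3) by (cases "energy_at \<alpha> f x") auto
  define q where "q = (1 / 2) powr ((\<alpha> - 1) / 2)"
  have q: "0 \<le> q" "q < 1" using half_powr_less_1[OF \<alpha>(1)] by (auto simp: q_def)
  define B where "B = sqrt (2 * E / stable_const \<alpha> * r powr (\<alpha> - 1))"
  have "\<bar>f x - mean_on (A 0) f\<bar> \<le> B / (1 - q)"
  proof (rule geometric_telescope[OF _ q])
    show "0 \<le> B" using C fin by (simp add: B_def)
    \<comment> \<open>The number e is finite but otherwise uncontrolled. It only identifies the
      limit of the means as \<open>f x\<close>; the quantitative bound comes from the consecutive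
      differences and involves E alone.\<close>
    have le: "(f x - mean_on (A n) f)\<^sup>2 \<le> d n powr \<alpha> / stable_const \<alpha> * e" for n
    proof -
      have "ennreal ((f x - mean_on (A n) f)\<^sup>2)
          \<le> ennreal (d n powr (1 + \<alpha>) / (stable_const \<alpha> * d n)) * energy_at \<alpha> f x"
        using x[of _ n] A(1)[of n] d[of n]
        by (intro dist_mean_on_le_energy_at \<alpha>' \<alpha>(2) f A_sets fin(3)) (auto simp: d_def)
      then have "(f x - mean_on (A n) f)\<^sup>2 \<le> d n powr (1 + \<alpha>) / (stable_const \<alpha> * d n) * e"
        using e C d(1)[of n] by (simp add: ennreal_mult[symmetric])
      also have "d n powr (1 + \<alpha>) / (stable_const \<alpha> * d n) = d n powr \<alpha> / stable_const \<alpha>"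
        using d(1)[of n] C by (simp add: powr_add field_simps)
      finally show ?thesis .
    qed
    have "(\<lambda>n. d n powr \<alpha> / stable_const \<alpha> * e) \<longlonglongrightarrow> 0 powr \<alpha> / stable_const \<alpha> * e"
      using \<alpha> d(1) C by (intro tendsto_intros d_lim) (auto intro!: always_eventually less_imp_le)
    then have "(\<lambda>n. d n powr \<alpha> / stable_const \<alpha> * e) \<longlonglongrightarrow> 0" by simp
    then have "(\<lambda>n. (f x - mean_on (A n) f)\<^sup>2) \<longlonglongrightarrow> 0"
      by (rule tendsto_sandwich[OF _ _ tendsto_const, rotated 2]) (use le in auto)
    then have "(\<lambda>n. sqrt ((f x - mean_on (A n) f)\<^sup>2)) \<longlonglongrightarrow> sqrt 0" by (rule tendsto_real_sqrt)
    then have "(\<lambda>n. f x - mean_on (A n) f) \<longlonglongrightarrow> 0"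
      by (simp add: tendsto_rabs_zero_iff)
    then have "(\<lambda>n. f x - (f x - mean_on (A n) f)) \<longlonglongrightarrow> f x - 0" by (intro tendsto_diff tendsto_const)
    then show "(\<lambda>n. mean_on (A n) f) \<longlonglongrightarrow> f x" by simp
    show "\<bar>mean_on (A (Suc n)) f - mean_on (A n) f\<bar> \<le> B * q ^ n" for n
    proof -
      have "ennreal ((mean_on (A n) f - mean_on (A (Suc n)) f)\<^sup>2)
          \<le> ennreal (d n powr (1 + \<alpha>) / (stable_const \<alpha> * d n * d (Suc n))) * energy \<alpha> f"
        using A(1)[of n] A(1)[of "Suc n"] d[of n] d(1)[of "Suc n"] A_mono[of n] diam[of _ n] fin
        by (intro dist_mean_on_le_energy \<alpha>' \<alpha>(2) f A_sets) (auto simp: d_def subset_iff)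
      then have "(mean_on (A n) f - mean_on (A (Suc n)) f)\<^sup>2
          \<le> d n powr (1 + \<alpha>) / (stable_const \<alpha> * d n * d (Suc n)) * E"
        using fin C d(1)[of n] d(1)[of "Suc n"] by (simp add: ennreal_mult[symmetric])
      also have "d n powr (1 + \<alpha>) / (stable_const \<alpha> * d n * d (Suc n)) * E = 2 * E / stable_const \<alpha> * d n powr (\<alpha> - 1)"
        using d(1)[of n] C by (simp add: d(2) powr_add powr_diff field_simps)
      also have "d n powr (\<alpha> - 1) = r powr (\<alpha> - 1) * (q ^ n)\<^sup>2"
      proof -
        have "(q ^ n)\<^sup>2 = (q\<^sup>2) ^ n" by (simp add: power_mult[symmetric] mult.commute)
        also have "q\<^sup>2 = (1 / 2) powr (\<alpha> - 1)"
          by (simp add: q_def power2_eq_square powr_add[symmetric])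
        also have "((1 / 2) powr (\<alpha> - 1)) ^ n = ((1 / 2) ^ n) powr (\<alpha> - 1)"
          by (simp add: powr_power powr_realpow[symmetric] powr_powr mult.commute)
        finally show ?thesis
          using A(2) by (simp add: d_def powr_divide power_divide)
      qed
      also have "2 * E / stable_const \<alpha> * (r powr (\<alpha> - 1) * (q ^ n)\<^sup>2) = (B * q ^ n)\<^sup>2"
        using C fin(2) by (simp add: B_def power_mult_distrib)
      finally have "\<bar>mean_on (A n) f - mean_on (A (Suc n)) f\<bar> \<le> \<bar>B * q ^ n\<bar>"
        by (simp only: abs_le_square_iff)
      moreover have "0 \<le> B * q ^ n" using q C fin(2) by (simp add: B_def)
      ultimately show ?thesis by linarith
    qed
  qed
  also have "B / (1 - q) = sqrt (holder_const \<alpha> / 4 * E * r powr (\<alpha> - 1))"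
  proof -
    have "B / (1 - q) = sqrt (2 * E / stable_const \<alpha> * r powr (\<alpha> - 1)) / sqrt ((1 - q)\<^sup>2)"
      using q by (simp add: B_def)
    also have "\<dots> = sqrt (holder_const \<alpha> / 4 * E * r powr (\<alpha> - 1))"
      unfolding real_sqrt_divide[symmetric] by (simp add: holder_const_def q_def)
    finally show ?thesis .
  qed
  finally show ?thesis .
qed

text \<open>Campanato's argument: every point of finite \<open>energy_at\<close> is a Lebesgue point, so no passage
  to a continuous version is needed.\<close>

lemma holder_of_energy_at_finite:
  assumes \<alpha>: "1 < \<alpha>" "\<alpha> < 2" and f [measurable]: "f \<in> borel_measurable borel"
    and E: "energy \<alpha> f = ennreal E" "0 \<le> E"
    and x: "energy_at \<alpha> f x < \<infinity>" and y: "energy_at \<alpha> f y < \<infinity>"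
  shows "(f x - f y)\<^sup>2 \<le> holder_const \<alpha> * E * \<bar>x - y\<bar> powr (\<alpha> - 1)"
proof -
  have *: "(f x - f y)\<^sup>2 \<le> holder_const \<alpha> * E * \<bar>x - y\<bar> powr (\<alpha> - 1)"
    if "x < y" and x: "energy_at \<alpha> f x < \<infinity>" and y: "energy_at \<alpha> f y < \<infinity>" for x y
  proof -
    define r where "r = y - x"
    have r: "0 < r" using that by (simp add: r_def)
    have half: "r / 2 ^ Suc n \<le> r / 2 ^ n" for n
      using r by (intro divide_left_mono) auto
    define S where "S = sqrt (holder_const \<alpha> / 4 * E * r powr (\<alpha> - 1))"
    have S: "0 \<le> holder_const \<alpha> / 4 * E * r powr (\<alpha> - 1)"
      using holder_const_pos[OF \<alpha>] E by simp
    have 1: "\<bar>f x - mean_on {x..x + r / 2 ^ 0} f\<bar> \<le> S"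
      unfolding S_def
      by (rule dist_mean_on_shrinking[where A="\<lambda>n. {x..x + r / 2 ^ n}"])
        (use half r x E \<alpha> in \<open>auto intro: order_trans\<close>)
    have 2: "\<bar>f y - mean_on {y - r / 2 ^ 0..y} f\<bar> \<le> S"
      unfolding S_def
      by (rule dist_mean_on_shrinking[where A="\<lambda>n. {y - r / 2 ^ n..y}"])
        (use half r y E \<alpha> in \<open>auto intro: order_trans diff_left_mono\<close>)
    \<comment> \<open>One-sided intervals let both chains start from the same interval between x and
      y, so their initial means agree.\<close>
    have 3: "{x..x + r / 2 ^ 0} = {y - r / 2 ^ 0..y}" by (simp add: r_def)
    have "\<bar>f x - f y\<bar> \<le> \<bar>2 * S\<bar>" using 1 2 unfolding 3 by linarith
    then have "(f x - f y)\<^sup>2 \<le> (2 * S)\<^sup>2" by (simp only: abs_le_square_iff)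
    also have "\<dots> = holder_const \<alpha> * E * r powr (\<alpha> - 1)"
      using S by (simp add: S_def power_mult_distrib)
    finally show ?thesis using that by (simp add: r_def abs_minus_commute)
  qed
  show ?thesis
  proof (cases x y rule: linorder_cases)
    case equal
    then show ?thesis using holder_const_pos[OF \<alpha>] E by simp
  next
    case less
    then show ?thesis using * x y by blast
  next
    case greater
    then show ?thesis using *[OF greater y x] by (simp add: power2_commute abs_minus_commute)
  qed
qed

lemma energy_trunc_level_suminf_le:
  assumes \<alpha>: "0 < \<alpha>" "\<alpha> < 2" and f [measurable]: "f \<in> borel_measurable borel" and "0 \<le> b"
  shows "(\<Sum>k. energy \<alpha> (\<lambda>x. trunc_level (b * 2 ^ k) (f x))) \<le> energy \<alpha> f"
proof -
  note C = stable_const_pos[OF \<alpha>]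
  have [measurable]: "(\<lambda>x. trunc_level (b * 2 ^ k) (f x)) \<in> borel_measurable borel" for k
    unfolding trunc_level_def by measurable
  show ?thesis
  proof (rule suminf_le_const)
    fix n
    have "(\<Sum>k<n. energy \<alpha> (\<lambda>x. trunc_level (b * 2 ^ k) (f x))) =
      (\<integral>\<^sup>+z. (\<Sum>k<n. ennreal (form_integrand \<alpha> (\<lambda>x. trunc_level (b * 2 ^ k) (f x)) (\<lambda>x. trunc_level (b * 2 ^ k) (f x)) z)) \<partial>(lborel \<Otimes>\<^sub>M lborel))"
      unfolding energy_def by (rule nn_integral_sum[symmetric]) measurable
    also have "\<dots> \<le> energy \<alpha> f"
      unfolding energy_def
    proof (rule nn_integral_mono)
      fix z :: "real \<times> real"
      obtain x y where z: "z = (x, y)" by (cases z)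
      have "(\<Sum>k<n. form_integrand \<alpha> (\<lambda>x. trunc_level (b * 2 ^ k) (f x)) (\<lambda>x. trunc_level (b * 2 ^ k) (f x)) z)
        = (\<Sum>k<n. (trunc_level (b * 2 ^ k) (f x) - trunc_level (b * 2 ^ k) (f y))\<^sup>2) * (stable_const \<alpha> / \<bar>x - y\<bar> powr (1 + \<alpha>))"
        by (simp only: z form_integrand_same sum_distrib_right)
      also have "\<dots> \<le> form_integrand \<alpha> f f z"
        unfolding z form_integrand_same
        using C assms(4) by (intro mult_right_mono sum_trunc_level_diff_le) auto
      finally show "(\<Sum>k<n. ennreal (form_integrand \<alpha> (\<lambda>x. trunc_level (b * 2 ^ k) (f x)) (\<lambda>x. trunc_level (b * 2 ^ k) (f x)) z))
          \<le> ennreal (form_integrand \<alpha> f f z)"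
        using form_integrand_nonneg[OF \<alpha>] by (subst sum_ennreal) (auto intro: ennreal_leI)
    qed
    finally show "(\<Sum>k<n. energy \<alpha> (\<lambda>x. trunc_level (b * 2 ^ k) (f x))) \<le> energy \<alpha> f" .
  qed simp
qed

section \<open>Minimisation and the generator\<close>

text \<open>Fatou's lemma is applied first in y for fixed x and then in x, so that almost everywhere
  convergence on the line suffices and no null set has to be lifted to the product.\<close>

lemma energy_fatou:
  assumes \<alpha>: "0 < \<alpha>" "\<alpha> < 2"
    and [measurable]: "\<And>n. u n \<in> borel_measurable borel" "v \<in> borel_measurable borel"
    and lim: "AE x in lborel. (\<lambda>n. u n x) \<longlonglongrightarrow> v x"
  shows "energy \<alpha> v \<le> liminf (\<lambda>n. energy \<alpha> (u n))"
proof -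
  have "energy \<alpha> v = (\<integral>\<^sup>+x. energy_at \<alpha> v x \<partial>lborel)" by (simp add: energy_eq_energy_at)
  also have "\<dots> \<le> (\<integral>\<^sup>+x. liminf (\<lambda>n. energy_at \<alpha> (u n) x) \<partial>lborel)"
  proof (rule nn_integral_mono_AE)
    show "AE x in lborel. energy_at \<alpha> v x \<le> liminf (\<lambda>n. energy_at \<alpha> (u n) x)"
      using lim
    proof eventually_elim
      case (elim x)
      have "energy_at \<alpha> v x = (\<integral>\<^sup>+y. liminf (\<lambda>n. ennreal (form_integrand \<alpha> (u n) (u n) (x, y))) \<partial>lborel)"
        unfolding energy_at_def
      proof (rule nn_integral_cong_AE)
        show "AE y in lborel. ennreal (form_integrand \<alpha> v v (x, y))
            = liminf (\<lambda>n. ennreal (form_integrand \<alpha> (u n) (u n) (x, y)))"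
          using lim
        proof eventually_elim
          case (elim y)
          have "(\<lambda>n. ennreal (form_integrand \<alpha> (u n) (u n) (x, y))) \<longlonglongrightarrow> ennreal (form_integrand \<alpha> v v (x, y))"
            unfolding form_integrand_same
            by (intro tendsto_ennrealI tendsto_intros elim \<open>(\<lambda>n. u n x) \<longlonglongrightarrow> v x\<close>)
          then show ?case by (simp add: lim_imp_Liminf)
        qed
      qed
      also have "\<dots> \<le> liminf (\<lambda>n. energy_at \<alpha> (u n) x)"
        unfolding energy_at_def by (intro nn_integral_liminf) measurable
      finally show ?case .
    qed
  qed
  also have "\<dots> \<le> liminf (\<lambda>n. \<integral>\<^sup>+x. energy_at \<alpha> (u n) x \<partial>lborel)"
    by (intro nn_integral_liminf) measurable
  finally show ?thesis by (simp add: energy_eq_energy_at)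
qed

text \<open>Convexity of the energy, from the parallelogram law for the increments. The uniform
  convexity in the minimisation comes from the penalty term.\<close>

lemma energy_midpoint:
  assumes \<alpha>: "0 < \<alpha>" "\<alpha> < 2"
    and [measurable]: "u \<in> borel_measurable borel" "v \<in> borel_measurable borel"
  shows "2 * energy \<alpha> (\<lambda>x. (u x + v x) / 2) \<le> energy \<alpha> u + energy \<alpha> v"
proof -
  let ?w = "\<lambda>x. (u x + v x) / 2"
  have "2 * energy \<alpha> ?w = (\<integral>\<^sup>+z. 2 * ennreal (form_integrand \<alpha> ?w ?w z) \<partial>(lborel \<Otimes>\<^sub>M lborel))"
    unfolding energy_def by (rule nn_integral_cmult[symmetric]) measurable
  also have "\<dots> \<le> (\<integral>\<^sup>+z. ennreal (form_integrand \<alpha> u u z) + ennreal (form_integrand \<alpha> v v z) \<partial>(lborel \<Otimes>\<^sub>M lborel))"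
  proof (rule nn_integral_mono)
    fix z :: "real \<times> real"
    obtain x y where z: "z = (x, y)" by (cases z)
    have "2 * (?w x - ?w y)\<^sup>2 \<le> (u x - u y)\<^sup>2 + (v x - v y)\<^sup>2"
      using zero_le_power2[of "(u x - u y) - (v x - v y)"] by (simp add: power2_eq_square field_simps)
    then have "2 * (?w x - ?w y)\<^sup>2 * (stable_const \<alpha> / \<bar>x - y\<bar> powr (1 + \<alpha>))
        \<le> ((u x - u y)\<^sup>2 + (v x - v y)\<^sup>2) * (stable_const \<alpha> / \<bar>x - y\<bar> powr (1 + \<alpha>))"
      using stable_const_pos[OF \<alpha>] by (intro mult_right_mono) auto
    then have "2 * form_integrand \<alpha> ?w ?w z \<le> form_integrand \<alpha> u u z + form_integrand \<alpha> v v z"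
      by (simp only: z form_integrand_same distrib_right mult.assoc)
    then have "ennreal (2 * form_integrand \<alpha> ?w ?w z) \<le> ennreal (form_integrand \<alpha> u u z + form_integrand \<alpha> v v z)"
      by (rule ennreal_leI)
    then show "2 * ennreal (form_integrand \<alpha> ?w ?w z) \<le> ennreal (form_integrand \<alpha> u u z) + ennreal (form_integrand \<alpha> v v z)"
      using form_integrand_nonneg[OF \<alpha>] by (simp add: ennreal_mult)
  qed
  also have "\<dots> = energy \<alpha> u + energy \<alpha> v"
    unfolding energy_def by (rule nn_integral_add) measurable
  finally show ?thesis .
qed

lemma energy_lincomb_le:
  assumes \<alpha>: "0 < \<alpha>" "\<alpha> < 2"
    and [measurable]: "u \<in> borel_measurable borel" "v \<in> borel_measurable borel"
  shows "energy \<alpha> (\<lambda>x. u x + t * v x) \<le> 2 * energy \<alpha> u + ennreal (2 * t\<^sup>2) * energy \<alpha> v"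
proof -
  let ?w = "\<lambda>x. u x + t * v x"
  have "energy \<alpha> ?w \<le> (\<integral>\<^sup>+z. 2 * ennreal (form_integrand \<alpha> u u z) + ennreal (2 * t\<^sup>2) * ennreal (form_integrand \<alpha> v v z) \<partial>(lborel \<Otimes>\<^sub>M lborel))"
    unfolding energy_def
  proof (rule nn_integral_mono)
    fix z :: "real \<times> real"
    obtain x y where z: "z = (x, y)" by (cases z)
    have "(?w x - ?w y)\<^sup>2 \<le> 2 * (u x - u y)\<^sup>2 + 2 * t\<^sup>2 * (v x - v y)\<^sup>2"
      using zero_le_power2[of "(u x - u y) - t * (v x - v y)"] by (simp add: power2_eq_square field_simps)
    then have "(?w x - ?w y)\<^sup>2 * (stable_const \<alpha> / \<bar>x - y\<bar> powr (1 + \<alpha>))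
        \<le> (2 * (u x - u y)\<^sup>2 + 2 * t\<^sup>2 * (v x - v y)\<^sup>2) * (stable_const \<alpha> / \<bar>x - y\<bar> powr (1 + \<alpha>))"
      using stable_const_pos[OF \<alpha>] by (intro mult_right_mono) auto
    then have "form_integrand \<alpha> ?w ?w z \<le> 2 * form_integrand \<alpha> u u z + 2 * t\<^sup>2 * form_integrand \<alpha> v v z"
      by (simp only: z form_integrand_same distrib_right mult.assoc)
    then have "ennreal (form_integrand \<alpha> ?w ?w z) \<le> ennreal (2 * form_integrand \<alpha> u u z + 2 * t\<^sup>2 * form_integrand \<alpha> v v z)"
      by (rule ennreal_leI)
    then show "ennreal (form_integrand \<alpha> ?w ?w z) \<le> 2 * ennreal (form_integrand \<alpha> u u z) + ennreal (2 * t\<^sup>2) * ennreal (form_integrand \<alpha> v v z)"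
      using form_integrand_nonneg[OF \<alpha>] by (simp add: ennreal_mult)
  qed
  also have "\<dots> = (\<integral>\<^sup>+z. 2 * ennreal (form_integrand \<alpha> u u z) \<partial>(lborel \<Otimes>\<^sub>M lborel))
      + (\<integral>\<^sup>+z. ennreal (2 * t\<^sup>2) * ennreal (form_integrand \<alpha> v v z) \<partial>(lborel \<Otimes>\<^sub>M lborel))"
    by (rule nn_integral_add) measurable
  also have "(\<integral>\<^sup>+z. 2 * ennreal (form_integrand \<alpha> u u z) \<partial>(lborel \<Otimes>\<^sub>M lborel)) = 2 * energy \<alpha> u"
    unfolding energy_def by (rule nn_integral_cmult) measurable
  also have "(\<integral>\<^sup>+z. ennreal (2 * t\<^sup>2) * ennreal (form_integrand \<alpha> v v z) \<partial>(lborel \<Otimes>\<^sub>M lborel)) = ennreal (2 * t\<^sup>2) * energy \<alpha> v"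
    unfolding energy_def by (rule nn_integral_cmult) measurable
  finally show ?thesis .
qed

text \<open>The step of the Riesz-Fischer argument that extracts pointwise limits: increments
  summable in L^1 are absolutely summable at almost every point.\<close>

lemma AE_convergent_of_summable_nn_integral:
  fixes u :: "nat \<Rightarrow> 'a \<Rightarrow> real"
  assumes [measurable]: "\<And>n. u n \<in> borel_measurable M"
    and fin: "(\<Sum>n. \<integral>\<^sup>+x. ennreal \<bar>u (Suc n) x - u n x\<bar> \<partial>M) < \<infinity>"
  shows "AE x in M. convergent (\<lambda>n. u n x)"
proof -
  have "(\<integral>\<^sup>+x. (\<Sum>n. ennreal \<bar>u (Suc n) x - u n x\<bar>) \<partial>M) \<noteq> \<infinity>"
    using fin by (subst nn_integral_suminf) auto
  then have "AE x in M. (\<Sum>n. ennreal \<bar>u (Suc n) x - u n x\<bar>) \<noteq> \<infinity>"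
    by (rule nn_integral_noteq_infinite[rotated]) measurable
  then show ?thesis
  proof eventually_elim
    case (elim x)
    have "summable (\<lambda>n. \<bar>u (Suc n) x - u n x\<bar>)"
      using elim by (intro summable_suminf_not_top) (auto simp: top_ennreal_def)
    then have "summable (\<lambda>n. u (Suc n) x - u n x)" by (rule summable_rabs_cancel)
    then have "convergent (\<lambda>n. \<Sum>i<n. u (Suc i) x - u i x)" by (simp add: summable_iff_convergent)
    then have "convergent (\<lambda>n. (\<Sum>i<n. u (Suc i) x - u i x) + u 0 x)"
      by (intro convergent_add convergent_const)
    moreover have "(\<Sum>i<n. u (Suc i) x - u i x) + u 0 x = u n x" for n
      by (induction n) auto
    ultimately show ?case by simp
  qed
qed

lemma abs_mult_le_sum_squares:
  fixes x y :: real
  shows "\<bar>x * y\<bar> \<le> x\<^sup>2 + y\<^sup>2"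
proof -
  have "2 * (\<bar>x\<bar> * \<bar>y\<bar>) \<le> x\<^sup>2 + y\<^sup>2" using sum_squares_bound[of "\<bar>x\<bar>" "\<bar>y\<bar>"] by simp
  moreover have "0 \<le> \<bar>x\<bar> * \<bar>y\<bar>" by simp
  ultimately show ?thesis unfolding abs_mult by linarith
qed

text \<open>The first-order condition for a minimum at t = 0.\<close>

lemma quadratic_nonneg_imp_linear_zero:
  fixes b c :: real
  assumes "\<And>t. 0 \<le> t * b + t\<^sup>2 * c"
  shows "b = 0"
proof (rule ccontr)
  assume b: "b \<noteq> 0"
  define d where "d = 1 + \<bar>c\<bar>"
  have d: "0 < d" "\<bar>c\<bar> = d - 1" by (auto simp: d_def)
  \<comment> \<open>With d = 1 + |c| the linear term -b^2 / d outweighs b^2 (d - 1) / d^2 by exactly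
    b^2 / d^2, whatever the sign of c.\<close>
  define t where "t = - b / d"
  have "t * b + t\<^sup>2 * c \<le> t * b + t\<^sup>2 * \<bar>c\<bar>" by (simp add: mult_left_mono)
  also have "\<dots> = - (b\<^sup>2 / d\<^sup>2)"
    using d(1) by (simp add: t_def d(2) field_simps power2_eq_square)
  also have "\<dots> < 0" using b d by simp
  finally show False using assms[of t] by simp
qed

section \<open>The speed measure and the bilinear form on its domain\<close>

locale speed_measure =
  fixes a :: "real \<Rightarrow> real" and \<alpha> :: real
  assumes alpha: "1 < \<alpha>" "\<alpha> < 2"
    and a_cont: "continuous_on UNIV a"
    and a_pos: "\<And>x. 0 < a x"
    and a_int: "(\<integral>x. 1 / a x \<partial>lborel) = 1"
begin

lemma alpha_pos: "0 < \<alpha>" using alpha by simp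

lemma a_measurable [measurable]: "a \<in> borel_measurable borel"
  by (rule borel_measurable_continuous_onI[OF a_cont])

lemma sets_mu [measurable_cong, simp]: "sets (mu a) = sets borel" by (simp add: mu_def)

lemma space_mu [simp]: "space (mu a) = UNIV" by (simp add: mu_def)

lemma emeasure_mu_UNIV: "emeasure (mu a) UNIV = 1"
proof -
  \<comment> \<open>A non-integrable function has Bochner integral 0, so the value 1 forces
    integrability.\<close>
  have "integrable lborel (\<lambda>x. 1 / a x)"
    using a_int not_integrable_integral_eq by fastforce
  then have "(\<integral>\<^sup>+x. ennreal (1 / a x) \<partial>lborel) = ennreal (\<integral>x. 1 / a x \<partial>lborel)"
    using a_pos by (intro nn_integral_eq_integral) (auto intro: less_imp_le)
  then show ?thesis by (simp add: mu_def emeasure_density a_int)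
qed

sublocale mu: finite_measure "mu a"
  by standard (simp add: emeasure_mu_UNIV)

lemma measure_mu_UNIV [simp]: "measure (mu a) UNIV = 1"
  by (simp add: measure_def emeasure_mu_UNIV)

lemma measure_mu_le_1: "measure (mu a) A \<le> 1"
  using mu.bounded_measure[of A] by simp

text \<open>The density 1 / a is positive everywhere, so \<open>mu a\<close> and Lebesgue measure
  have the same null sets. Energies live on the latter, norms on the former.\<close>

lemma AE_mu_iff: "(AE x in mu a. P x) \<longleftrightarrow> (AE x in lborel. P x)"
proof -
  have "(AE x in mu a. P x) \<longleftrightarrow> (AE x in lborel. 0 < ennreal (1 / a x) \<longrightarrow> P x)"
    unfolding mu_def by (rule AE_density) measurable
  then show ?thesis using a_pos by simp
qed

lemma L2_iff: "f \<in> L2 (mu a) \<longleftrightarrow> f \<in> borel_measurable borel \<and> (\<integral>\<^sup>+x. ennreal ((f x)\<^sup>2) \<partial>mu a) < \<infinity>"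
proof -
  have [simp]: "borel_measurable (mu a) = borel_measurable borel"
    by (rule measurable_cong_sets) simp_all
  show ?thesis
    by (auto simp: L2_def integrable_iff_bounded power2_eq_square)
qed

lemma form_dom_iff: "f \<in> form_dom a \<alpha> \<longleftrightarrow> f \<in> borel_measurable borel \<and>
    (\<integral>\<^sup>+x. ennreal ((f x)\<^sup>2) \<partial>mu a) < \<infinity> \<and> energy \<alpha> f < \<infinity>"
  by (auto simp: form_dom_def L2_iff energy_def)

lemma form_dom_measurable: "f \<in> form_dom a \<alpha> \<Longrightarrow> f \<in> borel_measurable borel"
  by (simp add: form_dom_iff)

lemma form_dom_integrable_sq: "f \<in> form_dom a \<alpha> \<Longrightarrow> integrable (mu a) (\<lambda>x. (f x)\<^sup>2)"
  by (simp add: form_dom_def L2_def)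

lemma integrable_product:
  fixes f g :: "real \<Rightarrow> real"
  assumes "f \<in> borel_measurable borel" "g \<in> borel_measurable borel"
    and "integrable (mu a) (\<lambda>x. (f x)\<^sup>2)" "integrable (mu a) (\<lambda>x. (g x)\<^sup>2)"
  shows "integrable (mu a) (\<lambda>x. f x * g x)"
proof (rule Bochner_Integration.integrable_bound)
  show "integrable (mu a) (\<lambda>x. (f x)\<^sup>2 + (g x)\<^sup>2)" using assms by simp
  show "(\<lambda>x. f x * g x) \<in> borel_measurable (mu a)" using assms by measurable
  have "\<bar>f x * g x\<bar> \<le> (f x)\<^sup>2 + (g x)\<^sup>2" for x
    by (rule abs_mult_le_sum_squares)
  then show "AE x in mu a. norm (f x * g x) \<le> norm ((f x)\<^sup>2 + (g x)\<^sup>2)" by simp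
qed

lemma form_integrand_integrable:
  assumes "f \<in> form_dom a \<alpha>"
  shows "integrable (lborel \<Otimes>\<^sub>M lborel) (form_integrand \<alpha> f f)"
proof (rule integrableI_bounded)
  show "form_integrand \<alpha> f f \<in> borel_measurable (lborel \<Otimes>\<^sub>M lborel)"
    using form_dom_measurable[OF assms] by measurable
  show "(\<integral>\<^sup>+z. ennreal (norm (form_integrand \<alpha> f f z)) \<partial>(lborel \<Otimes>\<^sub>M lborel)) < \<infinity>"
    using assms form_integrand_nonneg[OF alpha_pos alpha(2)] by (simp add: form_dom_iff energy_def)
qed

lemma energy_eq_form:
  assumes "f \<in> form_dom a \<alpha>"
  shows "energy \<alpha> f = ennreal (2 * form \<alpha> f f)"
  unfolding energy_def form_def
  using nn_integral_eq_integral[OF form_integrand_integrable[OF assms]]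
    form_integrand_nonneg[OF alpha_pos alpha(2)] by simp

lemma form_nonneg: "0 \<le> form \<alpha> f f"
  unfolding form_def using form_integrand_nonneg[OF alpha_pos alpha(2)] by simp

lemma form_integrand_integrable2:
  assumes "f \<in> form_dom a \<alpha>" "g \<in> form_dom a \<alpha>"
  shows "integrable (lborel \<Otimes>\<^sub>M lborel) (form_integrand \<alpha> f g)"
proof (rule Bochner_Integration.integrable_bound)
  show "integrable (lborel \<Otimes>\<^sub>M lborel) (\<lambda>z. form_integrand \<alpha> f f z + form_integrand \<alpha> g g z)"
    by (intro Bochner_Integration.integrable_add form_integrand_integrable assms)
  show "form_integrand \<alpha> f g \<in> borel_measurable (lborel \<Otimes>\<^sub>M lborel)"
    using form_dom_measurable[OF assms(1)] form_dom_measurable[OF assms(2)] by measurable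
  have "norm (form_integrand \<alpha> f g z) \<le> form_integrand \<alpha> f f z + form_integrand \<alpha> g g z" for z
  proof -
    obtain x y where z: "z = (x, y)" by (cases z)
    let ?k = "stable_const \<alpha> / \<bar>x - y\<bar> powr (1 + \<alpha>)"
    have k: "0 \<le> ?k" using stable_const_pos[OF alpha_pos alpha(2)] by simp
    have "\<bar>(f x - f y) * (g x - g y)\<bar> \<le> (f x - f y)\<^sup>2 + (g x - g y)\<^sup>2"
      by (rule abs_mult_le_sum_squares)
    then have "\<bar>(f x - f y) * (g x - g y)\<bar> * ?k \<le> ((f x - f y)\<^sup>2 + (g x - g y)\<^sup>2) * ?k"
      using k by (rule mult_right_mono)
    moreover have "norm (form_integrand \<alpha> f g z) = \<bar>(f x - f y) * (g x - g y)\<bar> * ?k"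
      using stable_const_pos[OF alpha_pos alpha(2)] by (simp add: z form_integrand_def abs_mult)
    moreover have "((f x - f y)\<^sup>2 + (g x - g y)\<^sup>2) * ?k = form_integrand \<alpha> f f z + form_integrand \<alpha> g g z"
      by (simp only: z form_integrand_same distrib_right)
    ultimately show ?thesis by simp
  qed
  then show "AE z in lborel \<Otimes>\<^sub>M lborel. norm (form_integrand \<alpha> f g z) \<le> norm (form_integrand \<alpha> f f z + form_integrand \<alpha> g g z)"
    using form_integrand_nonneg[OF alpha_pos alpha(2)] by (intro AE_I2) (smt (verit) real_norm_def)
qed

lemma form_dom_lincomb:
  assumes f: "f \<in> form_dom a \<alpha>" and g: "g \<in> form_dom a \<alpha>"
  shows "(\<lambda>x. f x + t * g x) \<in> form_dom a \<alpha>"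
proof -
  note [measurable] = form_dom_measurable[OF f] form_dom_measurable[OF g]
  have "integrable (mu a) (\<lambda>x. (f x)\<^sup>2 + 2 * t * (f x * g x) + t\<^sup>2 * (g x)\<^sup>2)"
    using form_dom_integrable_sq[OF f] form_dom_integrable_sq[OF g]
    by (intro Bochner_Integration.integrable_add integrable_mult_right integrable_product) auto
  also have "(\<lambda>x. (f x)\<^sup>2 + 2 * t * (f x * g x) + t\<^sup>2 * (g x)\<^sup>2) = (\<lambda>x. (f x + t * g x)\<^sup>2)"
    by (auto simp: fun_eq_iff power2_eq_square algebra_simps)
  finally have "integrable (mu a) (\<lambda>x. (f x + t * g x)\<^sup>2)" .
  moreover have "energy \<alpha> (\<lambda>x. f x + t * g x) < \<infinity>"
  proof -
    have "energy \<alpha> (\<lambda>x. f x + t * g x) \<le> 2 * energy \<alpha> f + ennreal (2 * t\<^sup>2) * energy \<alpha> g"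
      by (intro energy_lincomb_le alpha_pos alpha(2)) measurable
    also have "\<dots> < \<infinity>" using f g by (simp add: form_dom_iff ennreal_mult_less_top)
    finally show ?thesis .
  qed
  ultimately show ?thesis by (simp add: form_dom_def L2_def energy_def)
qed

lemma form_lincomb:
  assumes f: "f \<in> form_dom a \<alpha>" and g: "g \<in> form_dom a \<alpha>"
  shows "form \<alpha> (\<lambda>x. f x + t * g x) (\<lambda>x. f x + t * g x)
    = form \<alpha> f f + 2 * t * form \<alpha> f g + t\<^sup>2 * form \<alpha> g g"
proof -
  note i = form_integrand_integrable2[OF f f] form_integrand_integrable2[OF f g] form_integrand_integrable2[OF g g]
  have "form_integrand \<alpha> (\<lambda>x. f x + t * g x) (\<lambda>x. f x + t * g x)
    = (\<lambda>z. form_integrand \<alpha> f f z + (2 * t) * form_integrand \<alpha> f g z + t\<^sup>2 * form_integrand \<alpha> g g z)"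
    by (auto simp: form_integrand_def fun_eq_iff algebra_simps power2_eq_square add_divide_distrib diff_divide_distrib)
  then show ?thesis
    unfolding form_def using i by simp
qed

end

lemma liminf_add_le_ennreal:
  fixes f g :: "nat \<Rightarrow> ennreal"
  shows "liminf f + liminf g \<le> liminf (\<lambda>n. f n + g n)"
proof -
  have "liminf f + liminf g = (SUP n. (INF m\<in>{n..}. f m) + (INF m\<in>{n..}. g m))"
    unfolding liminf_SUP_INF
    by (rule ennreal_SUP_add[symmetric]) (auto simp: incseq_def intro!: INF_superset_mono)
  also have "\<dots> \<le> liminf (\<lambda>n. f n + g n)"
    unfolding liminf_SUP_INF
    by (intro SUP_mono') (auto intro!: INF_greatest add_mono intro: INF_lower)
  finally show ?thesis .
qed

lemma powr_diff_le:
  fixes x y p :: real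
  assumes "0 \<le> x" "x \<le> y" "1 \<le> p"
  shows "y powr p - x powr p \<le> p * y powr (p - 1) * (y - x)"
proof (cases "y = 0")
  case False
  then have y: "0 < y" using assms by simp
  have yp: "y powr p = y * y powr (p - 1)" using y by (simp add: powr_diff)
  show ?thesis
  proof (cases "x = 0")
    case True
    have "1 * y powr p \<le> p * y powr p" using assms by (intro mult_right_mono) auto
    then show ?thesis using True yp by (simp add: mult_ac)
  next
    case False
    then have x: "0 < x" using assms by simp
    have "(x powr p) powr (1/p) * (y powr p) powr (1 - 1/p) \<le> 1/p * x powr p + (1 - 1/p) * y powr p"
      using assms x y by (intro Youngs_inequality_0) auto
    also have "(x powr p) powr (1/p) = x" using assms x by (simp add: powr_powr)
    also have "(y powr p) powr (1 - 1/p) = y powr (p - 1)"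
      using assms by (simp add: powr_powr right_diff_distrib)
    finally have "p * (x * y powr (p - 1)) \<le> p * (1/p * x powr p + (1 - 1/p) * y powr p)"
      using assms by (intro mult_left_mono) auto
    also have "\<dots> = x powr p + (p - 1) * y powr p"
      using assms by (simp add: distrib_left right_diff_distrib left_diff_distrib)
    finally show ?thesis by (simp add: yp algebra_simps)
  qed
qed (use assms in simp)

text \<open>The constants do not depend on p and the error is at most quadratic in u - f, so an L^2
  estimate of u - f controls the p-th moment. The bound f \<le> 1 keeps the derivative of the power
  below 2 (1 + |u - f|).\<close>

lemma powr_perturb_le:
  fixes f u p :: real
  assumes "0 \<le> f" "f \<le> 1" "1 \<le> p" "p < 2"
  shows "\<bar>u\<bar> powr p \<le> f powr p + 2 * \<bar>u - f\<bar> + 2 * (u - f)\<^sup>2"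
proof -
  define d where "d = \<bar>u - f\<bar>"
  have d: "0 \<le> d" by (simp add: d_def)
  have "\<bar>u\<bar> powr p \<le> (f + d) powr p" using assms by (intro powr_mono2) (auto simp: d_def)
  also have "\<dots> \<le> f powr p + p * (f + d) powr (p - 1) * d"
    using powr_diff_le[of f "f + d" p] assms d by simp
  also have "p * (f + d) powr (p - 1) * d \<le> 2 * (1 + d) * d"
  proof -
    have "(f + d) powr (p - 1) \<le> (1 + d) powr (p - 1)" using assms d by (intro powr_mono2) auto
    also have "\<dots> \<le> (1 + d) powr 1" using assms d by (intro powr_mono) auto
    also have "\<dots> = 1 + d" using d by simp
    finally show ?thesis using assms d by (intro mult_right_mono mult_mono) auto
  qed
  also have "2 * (1 + d) * d = 2 * d + 2 * d\<^sup>2" by (simp add: power2_eq_square algebra_simps)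
  finally show ?thesis by (simp add: d_def)
qed

lemma abs_le_weighted_sq:
  fixes t e :: real
  assumes "0 < e" shows "2 * \<bar>t\<bar> \<le> e + t\<^sup>2 / e"
proof -
  have "0 \<le> (\<bar>t\<bar> - e)\<^sup>2" by simp
  then have "2 * \<bar>t\<bar> * e \<le> e * e + t\<^sup>2" by (simp add: power2_diff power2_eq_square[of e] mult_ac)
  then have "2 * \<bar>t\<bar> \<le> (e * e + t\<^sup>2) / e" using assms by (simp add: pos_le_divide_eq)
  then show ?thesis using assms by (simp add: add_divide_distrib)
qed

section \<open>The penalised variational problem and its Euler-Lagrange equation\<close>

context speed_measure
begin

definition penalized :: "(real \<Rightarrow> real) \<Rightarrow> real \<Rightarrow> (real \<Rightarrow> real) \<Rightarrow> ennreal" where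
  "penalized f k u = energy \<alpha> u + (\<integral>\<^sup>+x. ennreal (k * (u x - f x)\<^sup>2) \<partial>mu a)"

text \<open>The penalty satisfies the parallelogram law exactly and the energy is convex. The
  surplus term in u - v makes minimising sequences Cauchy in L^2.\<close>

lemma penalized_midpoint:
  assumes [measurable]: "f \<in> borel_measurable borel" "u \<in> borel_measurable borel" "v \<in> borel_measurable borel"
    and k: "0 \<le> k"
  shows "2 * penalized f k (\<lambda>x. (u x + v x) / 2) + (\<integral>\<^sup>+x. ennreal (k / 2 * (u x - v x)\<^sup>2) \<partial>mu a)
    \<le> penalized f k u + penalized f k v"
proof -
  let ?w = "\<lambda>x. (u x + v x) / 2"
  have "2 * (\<integral>\<^sup>+x. ennreal (k * (?w x - f x)\<^sup>2) \<partial>mu a) + (\<integral>\<^sup>+x. ennreal (k / 2 * (u x - v x)\<^sup>2) \<partial>mu a)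
    = (\<integral>\<^sup>+x. 2 * ennreal (k * (?w x - f x)\<^sup>2) + ennreal (k / 2 * (u x - v x)\<^sup>2) \<partial>mu a)"
    by (subst nn_integral_add) (auto simp: nn_integral_cmult)
  also have "\<dots> = (\<integral>\<^sup>+x. ennreal (k * (u x - f x)\<^sup>2) + ennreal (k * (v x - f x)\<^sup>2) \<partial>mu a)"
  proof (rule nn_integral_cong)
    fix x
    have "2 * (k * (?w x - f x)\<^sup>2) + k / 2 * (u x - v x)\<^sup>2 = k * (u x - f x)\<^sup>2 + k * (v x - f x)\<^sup>2"
      by (simp add: power2_eq_square field_simps)
    then have "ennreal (2 * (k * (?w x - f x)\<^sup>2) + k / 2 * (u x - v x)\<^sup>2) = ennreal (k * (u x - f x)\<^sup>2 + k * (v x - f x)\<^sup>2)"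
      by simp
    moreover have "ennreal (2 * (k * (?w x - f x)\<^sup>2)) = 2 * ennreal (k * (?w x - f x)\<^sup>2)"
      using k by (subst ennreal_mult) auto
    ultimately show "2 * ennreal (k * (?w x - f x)\<^sup>2) + ennreal (k / 2 * (u x - v x)\<^sup>2)
        = ennreal (k * (u x - f x)\<^sup>2) + ennreal (k * (v x - f x)\<^sup>2)"
      using k by (simp only: ennreal_plus[symmetric] mult_nonneg_nonneg zero_le_power2 divide_nonneg_nonneg zero_le_numeral)
        (metis ennreal_plus k mult_nonneg_nonneg zero_le_power2 zero_le_numeral divide_nonneg_nonneg)
  qed
  also have "\<dots> = (\<integral>\<^sup>+x. ennreal (k * (u x - f x)\<^sup>2) \<partial>mu a) + (\<integral>\<^sup>+x. ennreal (k * (v x - f x)\<^sup>2) \<partial>mu a)"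
    by (subst nn_integral_add) auto
  finally have eq: "2 * (\<integral>\<^sup>+x. ennreal (k * (?w x - f x)\<^sup>2) \<partial>mu a) + (\<integral>\<^sup>+x. ennreal (k / 2 * (u x - v x)\<^sup>2) \<partial>mu a)
    = (\<integral>\<^sup>+x. ennreal (k * (u x - f x)\<^sup>2) \<partial>mu a) + (\<integral>\<^sup>+x. ennreal (k * (v x - f x)\<^sup>2) \<partial>mu a)" .
  have "2 * penalized f k ?w + (\<integral>\<^sup>+x. ennreal (k / 2 * (u x - v x)\<^sup>2) \<partial>mu a)
    = 2 * energy \<alpha> ?w + (2 * (\<integral>\<^sup>+x. ennreal (k * (?w x - f x)\<^sup>2) \<partial>mu a) + (\<integral>\<^sup>+x. ennreal (k / 2 * (u x - v x)\<^sup>2) \<partial>mu a))"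
    by (simp only: penalized_def distrib_left add.assoc)
  also have "\<dots> \<le> (energy \<alpha> u + energy \<alpha> v) + ((\<integral>\<^sup>+x. ennreal (k * (u x - f x)\<^sup>2) \<partial>mu a) + (\<integral>\<^sup>+x. ennreal (k * (v x - f x)\<^sup>2) \<partial>mu a))"
    unfolding eq by (intro add_right_mono energy_midpoint alpha_pos alpha(2)) auto
  also have "\<dots> = penalized f k u + penalized f k v"
    by (simp add: penalized_def add_ac)
  finally show ?thesis .
qed

lemma penalized_fatou:
  assumes [measurable]: "f \<in> borel_measurable borel" "\<And>n. u n \<in> borel_measurable borel" "w \<in> borel_measurable borel"
    and lim: "AE x in lborel. (\<lambda>n. u n x) \<longlonglongrightarrow> w x"
  shows "penalized f k w \<le> liminf (\<lambda>n. penalized f k (u n))"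
proof -
  have "(\<integral>\<^sup>+x. ennreal (k * (w x - f x)\<^sup>2) \<partial>mu a) = (\<integral>\<^sup>+x. liminf (\<lambda>n. ennreal (k * (u n x - f x)\<^sup>2)) \<partial>mu a)"
  proof (rule nn_integral_cong_AE)
    have "AE x in mu a. (\<lambda>n. u n x) \<longlonglongrightarrow> w x" using lim by (simp add: AE_mu_iff)
    then show "AE x in mu a. ennreal (k * (w x - f x)\<^sup>2) = liminf (\<lambda>n. ennreal (k * (u n x - f x)\<^sup>2))"
    proof eventually_elim
      case (elim x)
      have "(\<lambda>n. ennreal (k * (u n x - f x)\<^sup>2)) \<longlonglongrightarrow> ennreal (k * (w x - f x)\<^sup>2)"
        by (intro tendsto_ennrealI tendsto_intros elim)
      then show ?case by (simp add: lim_imp_Liminf)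
    qed
  qed
  also have "\<dots> \<le> liminf (\<lambda>n. \<integral>\<^sup>+x. ennreal (k * (u n x - f x)\<^sup>2) \<partial>mu a)"
    by (intro nn_integral_liminf) measurable
  finally have "(\<integral>\<^sup>+x. ennreal (k * (w x - f x)\<^sup>2) \<partial>mu a) \<le> liminf (\<lambda>n. \<integral>\<^sup>+x. ennreal (k * (u n x - f x)\<^sup>2) \<partial>mu a)" .
  moreover have "energy \<alpha> w \<le> liminf (\<lambda>n. energy \<alpha> (u n))"
    by (intro energy_fatou alpha_pos alpha(2) lim) auto
  ultimately show ?thesis
    unfolding penalized_def by (intro order_trans[OF add_mono liminf_add_le_ennreal])
qed

text \<open>The direct method: uniform convexity makes a fast minimising sequence converge almost
  everywhere, and Fatou's lemma gives lower semicontinuity along it.\<close>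

lemma penalized_minimizer:
  assumes f: "f \<in> form_dom a \<alpha>" and k: "0 < k"
  obtains u where "u \<in> form_dom a \<alpha>" "\<And>v. v \<in> form_dom a \<alpha> \<Longrightarrow> penalized f k u \<le> penalized f k v"
proof -
  note [measurable] = form_dom_measurable[OF f]
  define d where "d = (INF v\<in>form_dom a \<alpha>. penalized f k v)"
  have "d \<le> penalized f k f" unfolding d_def by (rule INF_lower[OF f])
  also have "\<dots> = energy \<alpha> f" by (simp add: penalized_def)
  also have "\<dots> < \<infinity>" using f by (simp add: form_dom_iff)
  finally have d_fin: "d < \<infinity>" .
  \<comment> \<open>Errors 4^(-n) make the L^2 distances of successive terms of order 2^(-n), hence
    summable.\<close>
  have "\<exists>v\<in>form_dom a \<alpha>. penalized f k v < d + ennreal ((1/4) ^ n)" for n :: nat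
  proof -
    have "d < d + ennreal ((1/4) ^ n)"
      using d_fin by (cases d) (auto simp: ennreal_plus[symmetric] ennreal_less_iff simp del: ennreal_plus)
    then show ?thesis unfolding d_def by (simp add: INF_less_iff)
  qed
  then obtain u where u: "\<And>n. u n \<in> form_dom a \<alpha>" "\<And>n. penalized f k (u n) < d + ennreal ((1/4) ^ n)"
    by metis
  have um [measurable]: "u n \<in> borel_measurable borel" for n by (rule form_dom_measurable[OF u(1)])
  have step: "(\<integral>\<^sup>+x. ennreal \<bar>u (Suc n) x - u n x\<bar> \<partial>mu a) \<le> ennreal ((1 + 4 / k) * (1/2) ^ n)" for n
  proof -
    let ?w = "\<lambda>x. (u (Suc n) x + u n x) / 2"
    let ?D = "\<integral>\<^sup>+x. ennreal (k / 2 * (u (Suc n) x - u n x)\<^sup>2) \<partial>mu a"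
    have w: "?w \<in> form_dom a \<alpha>"
    proof -
      have "(\<lambda>x. 0 * f x) \<in> form_dom a \<alpha>"
        using form_dom_lincomb[OF f f, of "-1"] by simp
      from form_dom_lincomb[OF this u(1)[of n], of "1/2"] have "(\<lambda>x. u n x / 2) \<in> form_dom a \<alpha>" by simp
      from form_dom_lincomb[OF this u(1)[of "Suc n"], of "1/2"] show ?thesis by (simp add: add_divide_distrib add.commute)
    qed
    have "2 * d + ?D \<le> 2 * penalized f k ?w + ?D"
      unfolding d_def by (intro add_right_mono mult_left_mono INF_lower w) simp
    also have "\<dots> \<le> penalized f k (u (Suc n)) + penalized f k (u n)"
      using k by (intro penalized_midpoint) auto
    also have "\<dots> \<le> (d + ennreal ((1/4) ^ Suc n)) + (d + ennreal ((1/4) ^ n))"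
      using u(2) by (intro add_mono less_imp_le)
    also have "\<dots> \<le> (d + ennreal ((1/4) ^ n)) + (d + ennreal ((1/4) ^ n))"
      by (intro add_mono ennreal_leI order_refl) (auto simp: power_decreasing)
    also have "\<dots> = 2 * d + ennreal (2 * (1/4) ^ n)"
      by (simp add: mult_2[symmetric] ennreal_mult distrib_left)
    finally have "2 * d + ?D \<le> 2 * d + ennreal (2 * (1/4) ^ n)" .
    then have D: "?D \<le> ennreal (2 * (1/4) ^ n)"
      using d_fin by (subst (asm) ennreal_add_left_cancel_le) (auto simp: ennreal_mult_eq_top_iff)
    have "(\<integral>\<^sup>+x. ennreal \<bar>u (Suc n) x - u n x\<bar> \<partial>mu a)
      \<le> (\<integral>\<^sup>+x. ennreal ((1/2) ^ n) + ennreal (2 / k * 2 ^ n) * ennreal (k / 2 * (u (Suc n) x - u n x)\<^sup>2) \<partial>mu a)"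
    proof (rule nn_integral_mono)
      fix x
      \<comment> \<open>The weight 2^(-n) in Young's inequality converts a squared L^2 bound of
        order 4^(-n) into an L^1 bound of order 2^(-n).\<close>
      let ?t = "u (Suc n) x - u n x"
      have "\<bar>?t\<bar> \<le> 2 * \<bar>?t\<bar>" by simp
      also have "\<dots> \<le> (1/2) ^ n + ?t\<^sup>2 / (1/2) ^ n" by (rule abs_le_weighted_sq) simp
      also have "?t\<^sup>2 / (1/2) ^ n = 2 ^ n * ?t\<^sup>2" by (simp add: power_divide mult.commute)
      finally have "\<bar>?t\<bar> \<le> (1/2) ^ n + 2 ^ n * ?t\<^sup>2" .
      then have "\<bar>?t\<bar> \<le> (1/2) ^ n + 2 / k * 2 ^ n * (k / 2 * ?t\<^sup>2)" using k by simp
      then have "ennreal \<bar>?t\<bar> \<le> ennreal ((1/2) ^ n + 2 / k * 2 ^ n * (k / 2 * ?t\<^sup>2))" by (rule ennreal_leI)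
      also have "\<dots> = ennreal ((1/2) ^ n) + ennreal (2 / k * 2 ^ n) * ennreal (k / 2 * ?t\<^sup>2)"
        using k by (subst ennreal_plus) (auto simp: ennreal_mult[symmetric])
      finally show "ennreal \<bar>?t\<bar> \<le> \<dots>" .
    qed
    also have "\<dots> = ennreal ((1/2) ^ n) + ennreal (2 / k * 2 ^ n) * ?D"
      by (subst nn_integral_add) (auto simp: nn_integral_cmult emeasure_mu_UNIV)
    also have "\<dots> \<le> ennreal ((1/2) ^ n) + ennreal (2 / k * 2 ^ n) * ennreal (2 * (1/4) ^ n)"
      by (intro add_left_mono mult_left_mono D) simp
    also have "\<dots> = ennreal ((1/2) ^ n + 2 / k * 2 ^ n * (2 * (1/4) ^ n))"
      using k by (subst ennreal_plus) (auto simp: ennreal_mult[symmetric])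
    also have "(1/2) ^ n + 2 / k * 2 ^ n * (2 * (1/4) ^ n) = (1 + 4 / k) * (1/2::real) ^ n"
    proof -
      have "(2::real) ^ n * (1/4) ^ n = (1/2) ^ n" by (simp add: power_mult_distrib[symmetric])
      then have "2 / k * 2 ^ n * (2 * (1/4) ^ n) = 4 / k * (1/2::real) ^ n" by (simp add: mult_ac)
      then show ?thesis by (simp add: distrib_right)
    qed
    finally show ?thesis .
  qed
  have "(\<Sum>n. \<integral>\<^sup>+x. ennreal \<bar>u (Suc n) x - u n x\<bar> \<partial>mu a) \<le> (\<Sum>n. ennreal ((1 + 4 / k) * (1/2) ^ n))"
    by (intro suminf_le step) auto
  also have "\<dots> = ennreal (\<Sum>n. (1 + 4 / k) * (1/2) ^ n)"
    using k by (intro suminf_ennreal2 summable_mult summable_geometric) auto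
  also have "\<dots> < \<infinity>" by simp
  finally have "AE x in mu a. convergent (\<lambda>n. u n x)"
    by (intro AE_convergent_of_summable_nn_integral) auto
  then have conv: "AE x in lborel. convergent (\<lambda>n. u n x)" by (simp add: AE_mu_iff)
  \<comment> \<open>Where the sequence diverges, \<open>lim\<close> is an arbitrary value; this
    concerns only a null set.\<close>
  define w where "w x = lim (\<lambda>n. u n x)" for x
  have [measurable]: "w \<in> borel_measurable borel"
    unfolding w_def by (rule borel_measurable_lim_metric) simp
  have "AE x in lborel. (\<lambda>n. u n x) \<longlonglongrightarrow> w x"
    using conv by eventually_elim (simp add: w_def convergent_LIMSEQ_iff)
  then have "penalized f k w \<le> liminf (\<lambda>n. penalized f k (u n))"
    by (intro penalized_fatou) auto
  also have "\<dots> \<le> liminf (\<lambda>n. d + ennreal ((1/4) ^ n))"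
    using u(2) by (intro Liminf_mono always_eventually allI less_imp_le)
  also have "(\<lambda>n. d + ennreal ((1/4) ^ n)) \<longlonglongrightarrow> d + ennreal 0"
    by (intro tendsto_add tendsto_const tendsto_ennrealI LIMSEQ_realpow_zero) auto
  then have "liminf (\<lambda>n. d + ennreal ((1/4) ^ n)) = d" by (simp add: lim_imp_Liminf)
  finally have w_d: "penalized f k w \<le> d" .
  have "w \<in> form_dom a \<alpha>"
    unfolding form_dom_iff
  proof (intro conjI)
    have "energy \<alpha> w \<le> penalized f k w" by (simp add: penalized_def)
    then show "energy \<alpha> w < \<infinity>" using w_d d_fin by (meson le_less_trans)
    have "(\<integral>\<^sup>+x. ennreal ((w x)\<^sup>2) \<partial>mu a)
      \<le> (\<integral>\<^sup>+x. ennreal (2 / k) * ennreal (k * (w x - f x)\<^sup>2) + 2 * ennreal ((f x)\<^sup>2) \<partial>mu a)"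
    proof (rule nn_integral_mono)
      fix x
      have "(w x)\<^sup>2 \<le> 2 * (w x - f x)\<^sup>2 + 2 * (f x)\<^sup>2"
        using zero_le_power2[of "w x - 2 * f x"] by (simp add: power2_eq_square algebra_simps)
      then have "(w x)\<^sup>2 \<le> 2 / k * (k * (w x - f x)\<^sup>2) + 2 * (f x)\<^sup>2" using k by simp
      then have "ennreal ((w x)\<^sup>2) \<le> ennreal (2 / k * (k * (w x - f x)\<^sup>2) + 2 * (f x)\<^sup>2)" by (rule ennreal_leI)
      also have "\<dots> = ennreal (2 / k) * ennreal (k * (w x - f x)\<^sup>2) + 2 * ennreal ((f x)\<^sup>2)"
        using k by (subst ennreal_plus) (simp_all only: ennreal_mult[symmetric] divide_nonneg_nonneg
            mult_nonneg_nonneg zero_le_power2 zero_le_numeral less_imp_le ennreal_numeral[symmetric])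
      finally show "ennreal ((w x)\<^sup>2) \<le> \<dots>" .
    qed
    also have "\<dots> = ennreal (2 / k) * (\<integral>\<^sup>+x. ennreal (k * (w x - f x)\<^sup>2) \<partial>mu a) + 2 * (\<integral>\<^sup>+x. ennreal ((f x)\<^sup>2) \<partial>mu a)"
      by (subst nn_integral_add) (auto simp: nn_integral_cmult)
    also have "\<dots> < \<infinity>"
    proof -
      have "(\<integral>\<^sup>+x. ennreal (k * (w x - f x)\<^sup>2) \<partial>mu a) \<le> penalized f k w" by (simp add: penalized_def)
      then have "(\<integral>\<^sup>+x. ennreal (k * (w x - f x)\<^sup>2) \<partial>mu a) < \<infinity>" using w_d d_fin by (meson le_less_trans)
      then show ?thesis using f by (auto simp: form_dom_iff ennreal_mult_less_top)
    qed
    finally show "(\<integral>\<^sup>+x. ennreal ((w x)\<^sup>2) \<partial>mu a) < \<infinity>" .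
  qed simp
  moreover have "penalized f k w \<le> penalized f k v" if "v \<in> form_dom a \<alpha>" for v
    using w_d INF_lower[OF that] unfolding d_def by (rule order_trans)
  ultimately show ?thesis using that by blast
qed

lemma form_dom_diff_integrable_sq:
  assumes "u \<in> form_dom a \<alpha>" "f \<in> form_dom a \<alpha>"
  shows "integrable (mu a) (\<lambda>x. (u x - f x)\<^sup>2)"
  using form_dom_integrable_sq[OF form_dom_lincomb[OF assms, of "-1"]] by simp

lemma penalized_eq_form:
  assumes u: "u \<in> form_dom a \<alpha>" and f: "f \<in> form_dom a \<alpha>" and k: "0 \<le> k"
  shows "penalized f k u = ennreal (2 * form \<alpha> u u + k * (\<integral>x. (u x - f x)\<^sup>2 \<partial>mu a))"
proof -
  have "(\<integral>\<^sup>+x. ennreal (k * (u x - f x)\<^sup>2) \<partial>mu a) = ennreal (\<integral>x. k * (u x - f x)\<^sup>2 \<partial>mu a)"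
    using form_dom_diff_integrable_sq[OF u f] k by (intro nn_integral_eq_integral) auto
  also have "\<dots> = ennreal (k * (\<integral>x. (u x - f x)\<^sup>2 \<partial>mu a))" by simp
  finally show ?thesis
    using form_nonneg[of u] k by (simp add: penalized_def energy_eq_form[OF u])
qed

text \<open>The first variation of the penalised functional along g is 4
  \<open>form \<alpha> u g\<close> plus 2 k times the integral of (u - f) g. Its vanishing says that
  L u = k/2 (u - f); the half appears because \<open>energy\<close> is twice
  \<open>form\<close>.\<close>

lemma minimizer_in_generator:
  assumes f: "f \<in> form_dom a \<alpha>" and k: "0 < k" and u: "u \<in> form_dom a \<alpha>"
    and min: "\<And>v. v \<in> form_dom a \<alpha> \<Longrightarrow> penalized f k u \<le> penalized f k v"
  shows "(u, \<lambda>x. k / 2 * (u x - f x)) \<in> generator a \<alpha>"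
proof -
  note [measurable] = form_dom_measurable[OF f] form_dom_measurable[OF u]
  note uf = form_dom_diff_integrable_sq[OF u f]
  have "(\<lambda>x. k / 2 * (u x - f x)) \<in> L2 (mu a)"
    unfolding L2_def using uf by (simp add: power_mult_distrib power_divide)
  moreover have "form \<alpha> u g = - (\<integral>x. k / 2 * (u x - f x) * g x \<partial>mu a)" if g: "g \<in> form_dom a \<alpha>" for g
  proof -
    note [measurable] = form_dom_measurable[OF g]
    note gg = form_dom_integrable_sq[OF g]
    have ug: "integrable (mu a) (\<lambda>x. (u x - f x) * g x)"
      using uf gg by (intro integrable_product) auto
    define B where "B = (\<integral>x. (u x - f x) * g x \<partial>mu a)"
    define G where "G = (\<integral>x. (g x)\<^sup>2 \<partial>mu a)"
    have "0 \<le> t * (4 * form \<alpha> u g + 2 * k * B) + t\<^sup>2 * (2 * form \<alpha> g g + k * G)" for t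
    proof -
      let ?v = "\<lambda>x. u x + t * g x"
      have v: "?v \<in> form_dom a \<alpha>" by (rule form_dom_lincomb[OF u g])
      have "(\<integral>x. (?v x - f x)\<^sup>2 \<partial>mu a) = (\<integral>x. (u x - f x)\<^sup>2 + 2 * t * ((u x - f x) * g x) + t\<^sup>2 * (g x)\<^sup>2 \<partial>mu a)"
        by (intro Bochner_Integration.integral_cong) (auto simp: power2_eq_square algebra_simps)
      also have "\<dots> = (\<integral>x. (u x - f x)\<^sup>2 \<partial>mu a) + 2 * t * B + t\<^sup>2 * G"
        using uf ug gg by (simp add: B_def G_def)
      finally have vf: "(\<integral>x. (?v x - f x)\<^sup>2 \<partial>mu a) = (\<integral>x. (u x - f x)\<^sup>2 \<partial>mu a) + 2 * t * B + t\<^sup>2 * G" .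
      have "0 \<le> 2 * form \<alpha> ?v ?v + k * (\<integral>x. (?v x - f x)\<^sup>2 \<partial>mu a)"
        using form_nonneg[of ?v] k by simp
      then have "2 * form \<alpha> u u + k * (\<integral>x. (u x - f x)\<^sup>2 \<partial>mu a) \<le> 2 * form \<alpha> ?v ?v + k * (\<integral>x. (?v x - f x)\<^sup>2 \<partial>mu a)"
        using min[OF v] k by (simp only: penalized_eq_form u f v less_imp_le ennreal_le_iff)
      then show ?thesis unfolding vf form_lincomb[OF u g] by (simp add: algebra_simps)
    qed
    then have "4 * form \<alpha> u g + 2 * k * B = 0" by (rule quadratic_nonneg_imp_linear_zero)
    moreover have "(\<integral>x. k / 2 * (u x - f x) * g x \<partial>mu a) = k / 2 * B"
      unfolding B_def by (subst integral_mult_right_zero[symmetric]) (simp add: mult_ac)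
    ultimately show ?thesis by simp
  qed
  ultimately show ?thesis using u by (simp add: generator_def)
qed

text \<open>The minimisers are the resolvents \<open>\<lambda> (\<lambda> - L)\<inverse> f\<close> with \<open>\<lambda> = k / 2\<close>.\<close>

lemma generator_dom_approx:
  assumes f: "f \<in> form_dom a \<alpha>" and \<delta>: "0 < \<delta>"
  obtains u where "u \<in> generator_dom a \<alpha>" "u \<in> form_dom a \<alpha>" "form \<alpha> u u \<le> form \<alpha> f f"
    "(\<integral>x. (u x - f x)\<^sup>2 \<partial>mu a) \<le> \<delta>"
proof -
  \<comment> \<open>Comparing u with the competitor f bounds k times the squared distance by
    \<open>2 * form \<alpha> f f\<close>. The summand 1 keeps k positive when f has no
    energy.\<close>
  define k where "k = 2 * form \<alpha> f f / \<delta> + 1"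
  have k: "0 < k" using form_nonneg[of f] \<delta> by (simp add: k_def add_nonneg_pos)
  obtain u where u: "u \<in> form_dom a \<alpha>" "\<And>v. v \<in> form_dom a \<alpha> \<Longrightarrow> penalized f k u \<le> penalized f k v"
    using penalized_minimizer[OF f k] by blast
  have I: "0 \<le> (\<integral>x. (u x - f x)\<^sup>2 \<partial>mu a)" by simp
  have "2 * form \<alpha> u u + k * (\<integral>x. (u x - f x)\<^sup>2 \<partial>mu a) \<le> 2 * form \<alpha> f f"
    using u(2)[OF f] k form_nonneg[of f] by (simp add: penalized_eq_form u f)
  moreover have "0 \<le> k * (\<integral>x. (u x - f x)\<^sup>2 \<partial>mu a)" using k I by simp
  ultimately have 1: "form \<alpha> u u \<le> form \<alpha> f f" and 2: "k * (\<integral>x. (u x - f x)\<^sup>2 \<partial>mu a) \<le> 2 * form \<alpha> f f"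
    using form_nonneg[of u] by linarith+
  have "2 * form \<alpha> f f \<le> k * \<delta>" using \<delta> by (simp add: k_def distrib_right)
  then have "k * (\<integral>x. (u x - f x)\<^sup>2 \<partial>mu a) \<le> k * \<delta>" using 2 by simp
  then have 3: "(\<integral>x. (u x - f x)\<^sup>2 \<partial>mu a) \<le> \<delta>" using k by simp
  have "u \<in> generator_dom a \<alpha>"
    using minimizer_in_generator[OF f k u] by (auto simp: generator_dom_def)
  then show ?thesis using that u 1 3 by blast
qed

end

section \<open>Energy of a ramp and the tail condition\<close>

context speed_measure
begin

text \<open>For R \<le> 0 the removed interval is empty and the value is 1; in particular the
  logarithm in the tail condition vanishes at R = 0.\<close>

definition tail :: "real \<Rightarrow> real" where
  "tail R = measure (mu a) (- {-R<..<R})"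

lemma tail_nonneg [simp]: "0 \<le> tail R" by (simp add: tail_def)

lemma tail_le_1 [simp]: "tail R \<le> 1" by (simp add: tail_def measure_mu_le_1)

lemma tail_antimono: "R \<le> S \<Longrightarrow> tail S \<le> tail R"
  unfolding tail_def by (intro mu.finite_measure_mono) auto

lemma measure_mu_Icc_pos:
  assumes "l < r" shows "0 < measure (mu a) {l..r}"
proof (rule ccontr)
  assume "\<not> 0 < measure (mu a) {l..r}"
  then have "emeasure (mu a) {l..r} = 0"
    by (simp add: mu.emeasure_eq_measure zero_less_measure_iff)
  then have "AE x in mu a. x \<notin> {l..r}" by (intro AE_not_in) (auto simp: null_sets_def)
  then have "AE x in lborel. x \<notin> {l..r}" by (simp add: AE_mu_iff)
  then have "{l..r} \<in> null_sets lborel" by (simp add: AE_iff_null_sets)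
  then show False using assms by (simp add: null_sets_def)
qed

lemma tail_pos: "0 < tail R"
proof -
  have "0 < measure (mu a) {\<bar>R\<bar>..\<bar>R\<bar> + 1}" by (rule measure_mu_Icc_pos) simp
  also have "\<dots> \<le> tail R" unfolding tail_def by (intro mu.finite_measure_mono) auto
  finally show ?thesis .
qed

text \<open>Makes the logarithm of \<open>inverse (tail 1)\<close> strictly positive, so that it can
  absorb additive constants for R \<ge> 1.\<close>

lemma tail_less_1:
  assumes "0 < R" shows "tail R < 1"
proof -
  have "0 < measure (mu a) {-R/2..R/2}" using assms by (intro measure_mu_Icc_pos) simp
  also have "\<dots> \<le> measure (mu a) {-R<..<R}"
    using assms by (intro mu.finite_measure_mono) auto
  finally have "0 < measure (mu a) {-R<..<R}" .
  moreover have "tail R = 1 - measure (mu a) {-R<..<R}"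
    unfolding tail_def using mu.finite_measure_compl[of "{-R<..<R}"] by (simp add: Compl_eq_Diff_UNIV)
  ultimately show ?thesis by simp
qed

lemma tail_tendsto_0: "(\<lambda>n. tail (real n)) \<longlonglongrightarrow> 0"
proof -
  have "(\<lambda>n. measure (mu a) (- {- real n<..<real n})) \<longlonglongrightarrow> measure (mu a) (\<Inter>n. - {- real n<..<real n})"
    by (rule mu.finite_Lim_measure_decseq) (auto simp: decseq_def)
  moreover have "(\<Inter>n. - {- real n<..<real n}) = {}"
  proof -
    have "\<exists>n. x \<in> {- real n<..<real n}" for x :: real
    proof -
      obtain n where "\<bar>x\<bar> < real n" using reals_Archimedean2 by blast
      then have "x \<in> {- real n<..<real n}" by auto
      then show ?thesis by blast
    qed
    then show ?thesis by blast
  qed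
  ultimately show ?thesis by (simp add: tail_def)
qed

lemma form_dom_bounded:
  assumes [measurable]: "f \<in> borel_measurable borel" and "\<And>x. 0 \<le> f x" "\<And>x. f x \<le> 1"
    and "energy \<alpha> f < \<infinity>"
  shows "f \<in> form_dom a \<alpha>"
proof -
  have "(f x)\<^sup>2 \<le> 1" for x using assms(2,3)[of x] by (simp add: power_le_one)
  then have "(\<integral>\<^sup>+x. ennreal ((f x)\<^sup>2) \<partial>mu a) \<le> (\<integral>\<^sup>+x. 1 \<partial>mu a)"
    by (intro nn_integral_mono) simp
  also have "\<dots> < \<infinity>" by (simp add: emeasure_mu_UNIV)
  finally show ?thesis using assms by (simp add: form_dom_iff)
qed

text \<open>The approximant u need not be bounded, but the range of f suffices: the p-th moment of u
  is bounded above, and its second moment below, by those of f up to multiples of e, while the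
  energy of u does not exceed that of f.\<close>

lemma beckner_extends_to_form_dom:
  assumes f: "f \<in> form_dom a \<alpha>" and f01: "\<And>x. 0 \<le> f x" "\<And>x. f x \<le> 1"
    and p: "1 \<le> p" "p < 2" and K: "0 \<le> K"
    and ineq: "\<And>u. u \<in> generator_dom a \<alpha> \<Longrightarrow>
      (\<integral>x. (u x)\<^sup>2 \<partial>mu a) - (\<integral>x. \<bar>u x\<bar> powr p \<partial>mu a) powr (2 / p) \<le> K * form \<alpha> u u"
  shows "(\<integral>x. (f x)\<^sup>2 \<partial>mu a) - (\<integral>x. \<bar>f x\<bar> powr p \<partial>mu a) powr (2 / p) \<le> K * form \<alpha> f f"
proof -
  note [measurable] = form_dom_measurable[OF f]
  let ?Q = "\<integral>x. (f x)\<^sup>2 \<partial>mu a" and ?P = "\<integral>x. \<bar>f x\<bar> powr p \<partial>mu a"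
  have P: "0 \<le> ?P" by simp
  have intf: "integrable (mu a) (\<lambda>x. f x powr p)"
    using f01 p by (intro mu.integrable_const_bound[where B=1]) (auto intro!: powr_le1)
  have approx: "?Q - 2 * e - (?P + 4 * e) powr (2 / p) \<le> K * form \<alpha> f f" if e: "0 < e" "e \<le> 1" for e
  proof -
    \<comment> \<open>Accuracy e^2 is chosen because Young's inequality divides the squared distance
      by e.\<close>
    obtain u where u: "u \<in> generator_dom a \<alpha>" "u \<in> form_dom a \<alpha>" "form \<alpha> u u \<le> form \<alpha> f f"
      "(\<integral>x. (u x - f x)\<^sup>2 \<partial>mu a) \<le> e\<^sup>2"
      using generator_dom_approx[OF f, of "e\<^sup>2"] e by auto
    note [measurable] = form_dom_measurable[OF u(2)]
    let ?D = "\<integral>x. (u x - f x)\<^sup>2 \<partial>mu a"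
    note iD = form_dom_diff_integrable_sq[OF u(2) f]
    have De: "?D / e \<le> e" using u(4) e by (simp add: pos_divide_le_eq power2_eq_square)
    have "e * e \<le> e * 1" using e by (intro mult_left_mono) auto
    then have De2: "?D \<le> e" using u(4) by (simp add: power2_eq_square[of e])
    have young: "2 * \<bar>u x - f x\<bar> \<le> e + (u x - f x)\<^sup>2 / e" for x
      by (rule abs_le_weighted_sq[OF e(1)])
    have "(\<integral>x. \<bar>u x\<bar> powr p \<partial>mu a) \<le> (\<integral>x. f x powr p + (e + (u x - f x)\<^sup>2 / e) + 2 * (u x - f x)\<^sup>2 \<partial>mu a)"
    proof (rule integral_mono')
      show "integrable (mu a) (\<lambda>x. f x powr p + (e + (u x - f x)\<^sup>2 / e) + 2 * (u x - f x)\<^sup>2)"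
        using intf iD by auto
      show "\<bar>u x\<bar> powr p \<le> f x powr p + (e + (u x - f x)\<^sup>2 / e) + 2 * (u x - f x)\<^sup>2" for x
        using powr_perturb_le[OF f01(1)[of x] f01(2)[of x] p, of "u x"] young[of x] by linarith
    qed (use e in simp)
    also have "\<dots> = ?P + (e + ?D / e) + 2 * ?D"
      using intf iD f01 by simp
    also have "\<dots> \<le> ?P + 4 * e" using De De2 by linarith
    finally have "(\<integral>x. \<bar>u x\<bar> powr p \<partial>mu a) powr (2 / p) \<le> (?P + 4 * e) powr (2 / p)"
      using p by (intro powr_mono2) auto
    moreover have "?Q - 2 * e \<le> (\<integral>x. (u x)\<^sup>2 \<partial>mu a)"
    proof -
      have "?Q \<le> (\<integral>x. (u x)\<^sup>2 + (e + (u x - f x)\<^sup>2 / e) \<partial>mu a)"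
      proof (rule integral_mono')
        show "integrable (mu a) (\<lambda>x. (u x)\<^sup>2 + (e + (u x - f x)\<^sup>2 / e))"
          using form_dom_integrable_sq[OF u(2)] iD by auto
        fix x
        have "(f x)\<^sup>2 \<le> (u x)\<^sup>2 + 2 * (f x * \<bar>u x - f x\<bar>)"
        proof -
          have "(u x)\<^sup>2 - (f x)\<^sup>2 = (u x - f x)\<^sup>2 + 2 * (f x * (u x - f x))"
            by (simp add: power2_eq_square algebra_simps)
          moreover have "f x * (u x - f x) \<ge> - (f x * \<bar>u x - f x\<bar>)"
            using f01(1)[of x] by (metis abs_ge_minus_self abs_mult abs_of_nonneg minus_le_iff)
          ultimately show ?thesis by (smt (verit) zero_le_power2)
        qed
        also have "f x * \<bar>u x - f x\<bar> \<le> 1 * \<bar>u x - f x\<bar>" using f01 by (intro mult_right_mono) auto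
        finally show "(f x)\<^sup>2 \<le> (u x)\<^sup>2 + (e + (u x - f x)\<^sup>2 / e)" using young[of x] by linarith
      qed (use e in simp)
      also have "\<dots> = (\<integral>x. (u x)\<^sup>2 \<partial>mu a) + (e + ?D / e)"
        using form_dom_integrable_sq[OF u(2)] iD by simp
      finally show ?thesis using De by linarith
    qed
    moreover have "K * form \<alpha> u u \<le> K * form \<alpha> f f" using K u(3) by (intro mult_left_mono)
    ultimately show ?thesis using ineq[OF u(1)] by linarith
  qed
  \<comment> \<open>The moment P may be zero; the exponent 2 / p is positive, so the limit is valid
    there too.\<close>
  have "((\<lambda>e. ?Q - 2 * e - (?P + 4 * e) powr (2 / p)) \<longlongrightarrow> ?Q - 2 * 0 - (?P + 4 * 0) powr (2 / p)) (at_right 0)"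
    using P p by (intro tendsto_intros) (auto simp: eventually_at_right_less intro: eventually_at_rightI[of 0 1])
  moreover have "\<forall>\<^sub>F e in at_right 0. ?Q - 2 * e - (?P + 4 * e) powr (2 / p) \<le> K * form \<alpha> f f"
    using approx by (intro eventually_at_rightI[of 0 1]) auto
  ultimately have "?Q - 2 * 0 - (?P + 4 * 0) powr (2 / p) \<le> K * form \<alpha> f f"
    by (intro tendsto_upperbound) auto
  then show ?thesis by simp
qed

end

section \<open>Energy of the test functions\<close>

definition ramp :: "real \<Rightarrow> real \<Rightarrow> real" where
  "ramp R x = min 1 (max 0 (2 * \<bar>x\<bar> / R - 1))"

lemma ramp_range: "0 \<le> ramp R x" "ramp R x \<le> 1"
  by (auto simp: ramp_def)

lemma ramp_eq_1: "0 < R \<Longrightarrow> R \<le> \<bar>x\<bar> \<Longrightarrow> ramp R x = 1"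
  by (auto simp: ramp_def field_simps)

lemma ramp_eq_0: "0 < R \<Longrightarrow> \<bar>x\<bar> \<le> R / 2 \<Longrightarrow> ramp R x = 0"
  by (auto simp: ramp_def field_simps)

lemma ramp_measurable [measurable]: "ramp R \<in> borel_measurable borel"
  unfolding ramp_def[abs_def] by measurable

lemma ramp_lipschitz:
  assumes "0 < R" shows "\<bar>ramp R x - ramp R y\<bar> \<le> 2 * \<bar>x - y\<bar> / R"
proof -
  have "\<bar>ramp R x - ramp R y\<bar> \<le> \<bar>2 * \<bar>x\<bar> / R - 2 * \<bar>y\<bar> / R\<bar>"
    by (auto simp: ramp_def min_def max_def)
  also have "2 * \<bar>x\<bar> / R - 2 * \<bar>y\<bar> / R = 2 * (\<bar>x\<bar> - \<bar>y\<bar>) / R"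
    by (simp add: diff_divide_distrib right_diff_distrib)
  also have "\<bar>2 * (\<bar>x\<bar> - \<bar>y\<bar>) / R\<bar> = 2 * \<bar>\<bar>x\<bar> - \<bar>y\<bar>\<bar> / R"
    using assms abs_mult[of 2 "\<bar>x\<bar> - \<bar>y\<bar>"] by (simp only: abs_divide abs_of_pos abs_numeral)
  also have "\<dots> \<le> 2 * \<bar>x - y\<bar> / R" using assms by (intro divide_right_mono) auto
  finally show ?thesis .
qed

text \<open>The integral is split at |z| = R. The quadratic factor makes the singularity at 0
  integrable because \<alpha> < 2, and the kernel alone is integrable at infinity. Both pieces scale
  as R^(-\<alpha>), and reflection doubles them.\<close>

lemma nn_integral_powr_cutoff:
  assumes \<alpha>: "1 < \<alpha>" "\<alpha> < 2" and R: "0 < R"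
  shows "(\<integral>\<^sup>+z. ennreal (min 1 (2 * \<bar>z\<bar> / R) ^ 2 / \<bar>z\<bar> powr (1 + \<alpha>)) \<partial>lborel)
    \<le> ennreal ((8 / (2 - \<alpha>) + 2 / \<alpha>) * R powr (- \<alpha>))"
proof -
  define near where "near z = (if z \<in> {0..R} then 4 / R\<^sup>2 * z powr (1 - \<alpha>) else 0)" for z :: real
  define far where "far z = (if z \<in> {R..} then z powr (- 1 - \<alpha>) else 0)" for z :: real
  have [measurable]: "near \<in> borel_measurable borel" "far \<in> borel_measurable borel"
    unfolding near_def far_def by measurable
  have nn: "0 \<le> near z" "0 \<le> far z" for z by (auto simp: near_def far_def)
  have "((\<lambda>z. 4 / R\<^sup>2 * z powr (1 - \<alpha>)) has_integral 4 / R\<^sup>2 * (R powr (1 - \<alpha> + 1) / (1 - \<alpha> + 1))) {0..R}"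
    using \<alpha> R by (intro has_integral_mult_right has_integral_powr_from_0) auto
  then have "(near has_integral 4 / R\<^sup>2 * (R powr (1 - \<alpha> + 1) / (1 - \<alpha> + 1))) UNIV"
    unfolding near_def[abs_def] by (rule has_integral_restrict_UNIV[THEN iffD2])
  from nn_integral_has_integral_lborel[OF _ nn(1) this]
  have near: "(\<integral>\<^sup>+z. near z \<partial>lborel) = ennreal (4 / (2 - \<alpha>) * R powr (- \<alpha>))"
    using \<alpha> R by (simp add: powr_diff powr_minus field_simps power2_eq_square)
  have "((\<lambda>z. z powr (- 1 - \<alpha>)) has_integral - (R powr (- 1 - \<alpha> + 1)) / (- 1 - \<alpha> + 1)) {R..}"
    using \<alpha> R by (intro has_integral_powr_to_inf) auto
  then have "(far has_integral - (R powr (- 1 - \<alpha> + 1)) / (- 1 - \<alpha> + 1)) UNIV"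
    unfolding far_def[abs_def] by (rule has_integral_restrict_UNIV[THEN iffD2])
  from nn_integral_has_integral_lborel[OF _ nn(2) this]
  have far: "(\<integral>\<^sup>+z. far z \<partial>lborel) = ennreal (1 / \<alpha> * R powr (- \<alpha>))"
    using \<alpha> R by simp
  define h where "h z = near z + far z" for z
  have [measurable]: "h \<in> borel_measurable borel" unfolding h_def[abs_def] by measurable
  have hnn: "0 \<le> h z" for z using nn by (simp add: h_def)
  have h: "(\<integral>\<^sup>+z. h z \<partial>lborel) = ennreal ((4 / (2 - \<alpha>) + 1 / \<alpha>) * R powr (- \<alpha>))"
  proof -
    have "(\<integral>\<^sup>+z. h z \<partial>lborel) = (\<integral>\<^sup>+z. ennreal (near z) + ennreal (far z) \<partial>lborel)"
      using nn by (intro nn_integral_cong) (simp add: h_def)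
    also have "\<dots> = ennreal (4 / (2 - \<alpha>) * R powr (- \<alpha>)) + ennreal (1 / \<alpha> * R powr (- \<alpha>))"
      by (subst nn_integral_add) (auto simp: near far)
    finally show ?thesis using \<alpha> by (simp add: distrib_right flip: ennreal_plus)
  qed
  have "(\<integral>\<^sup>+z. ennreal (min 1 (2 * \<bar>z\<bar> / R) ^ 2 / \<bar>z\<bar> powr (1 + \<alpha>)) \<partial>lborel)
    \<le> (\<integral>\<^sup>+z. ennreal (h z) + ennreal (h (0 + (-1) * z)) \<partial>lborel)"
  proof (rule nn_integral_mono)
    fix z :: real
    have pos: "min 1 (2 * \<bar>z\<bar> / R) ^ 2 / \<bar>z\<bar> powr (1 + \<alpha>) \<le> h \<bar>z\<bar>"
    proof (cases "\<bar>z\<bar> \<le> R")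
      case True
      show ?thesis
      proof (cases "z = 0")
        case False
        have "min 1 (2 * \<bar>z\<bar> / R) ^ 2 \<le> (2 * \<bar>z\<bar> / R) ^ 2" using R by (intro power_mono) auto
        then have "min 1 (2 * \<bar>z\<bar> / R) ^ 2 / \<bar>z\<bar> powr (1 + \<alpha>) \<le> (2 * \<bar>z\<bar> / R) ^ 2 / \<bar>z\<bar> powr (1 + \<alpha>)"
          by (intro divide_right_mono) auto
        also have "\<dots> = 4 / R\<^sup>2 * \<bar>z\<bar> powr (1 - \<alpha>)"
          using False R by (simp add: powr_add powr_diff field_simps power2_eq_square)
        also have "\<dots> = near \<bar>z\<bar>" using True by (simp add: near_def)
        finally show ?thesis using nn(2)[of "\<bar>z\<bar>"] by (simp add: h_def)
      qed (use hnn in simp)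
    next
      case False
      have "min 1 (2 * \<bar>z\<bar> / R) ^ 2 \<le> 1" using R by (intro power_le_one) auto
      then have "min 1 (2 * \<bar>z\<bar> / R) ^ 2 / \<bar>z\<bar> powr (1 + \<alpha>) \<le> 1 / \<bar>z\<bar> powr (1 + \<alpha>)"
        by (intro divide_right_mono) auto
      also have "\<dots> = \<bar>z\<bar> powr (- 1 - \<alpha>)"
        using False R by (simp add: powr_minus_divide[symmetric])
      also have "\<dots> = far \<bar>z\<bar>" using False by (simp add: far_def)
      finally show ?thesis using nn(1)[of "\<bar>z\<bar>"] by (simp add: h_def)
    qed
    have "h \<bar>z\<bar> \<le> h z + h (-z)" using hnn[of z] hnn[of "-z"] by (cases "0 \<le> z") auto
    with pos have "ennreal (min 1 (2 * \<bar>z\<bar> / R) ^ 2 / \<bar>z\<bar> powr (1 + \<alpha>)) \<le> ennreal (h z + h (-z))"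
      by (intro ennreal_leI) simp
    then show "ennreal (min 1 (2 * \<bar>z\<bar> / R) ^ 2 / \<bar>z\<bar> powr (1 + \<alpha>)) \<le> ennreal (h z) + ennreal (h (0 + (-1) * z))"
      using hnn by simp
  qed
  also have "\<dots> = (\<integral>\<^sup>+z. ennreal (h z) \<partial>lborel) + (\<integral>\<^sup>+z. ennreal (h (0 + (-1) * z)) \<partial>lborel)"
    by (rule nn_integral_add) measurable
  also have "(\<integral>\<^sup>+z. ennreal (h (0 + (-1) * z)) \<partial>lborel) = (\<integral>\<^sup>+z. ennreal (h z) \<partial>lborel)"
    using nn_integral_real_affine[of "\<lambda>z. ennreal (h z)" "-1" 0] by simp
  also have "(\<integral>\<^sup>+z. ennreal (h z) \<partial>lborel) + (\<integral>\<^sup>+z. ennreal (h z) \<partial>lborel) = ennreal ((8 / (2 - \<alpha>) + 2 / \<alpha>) * R powr (- \<alpha>))"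
    unfolding h using \<alpha> by (subst ennreal_plus[symmetric]) (auto simp: distrib_right[symmetric])
  finally show ?thesis .
qed

definition ramp_const :: "real \<Rightarrow> real" where
  "ramp_const \<alpha> = 4 * stable_const \<alpha> * (8 / (2 - \<alpha>) + 2 / \<alpha>)"

text \<open>The ramp is constant outside [-R, R], so a pair contributes only if one of its points
  lies in this interval. Each of the two possibilities costs the length 2 R times a kernel integral
  of order R^(-\<alpha>), which explains the factor 4 in \<open>ramp_const\<close>.\<close>

lemma energy_ramp_le:
  assumes \<alpha>: "1 < \<alpha>" "\<alpha> < 2" and R: "0 < R"
  shows "energy \<alpha> (ramp R) \<le> ennreal (ramp_const \<alpha> * R powr (1 - \<alpha>))"
proof -
  have \<alpha>': "0 < \<alpha>" using \<alpha> by simp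
  note C = stable_const_pos[OF \<alpha>' \<alpha>(2)]
  define c where "c = (8 / (2 - \<alpha>) + 2 / \<alpha>) * R powr (- \<alpha>)"
  have c: "0 \<le> c" using \<alpha> by (simp add: c_def)
  define g where "g z = min 1 (2 * \<bar>z\<bar> / R) ^ 2 / \<bar>z\<bar> powr (1 + \<alpha>)" for z :: real
  have [measurable]: "g \<in> borel_measurable borel" unfolding g_def[abs_def] by measurable
  have g: "0 \<le> g z" for z by (simp add: g_def)
  let ?I = "{-R..R}"
  have bound: "form_integrand \<alpha> (ramp R) (ramp R) (x, y) \<le> (indicator ?I x + indicator ?I y) * (stable_const \<alpha> * g (x - y))" for x y
  proof (cases "x \<in> ?I \<or> y \<in> ?I")
    case True
    have "\<bar>ramp R x - ramp R y\<bar> \<le> min 1 (2 * \<bar>x - y\<bar> / R)"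
      using ramp_lipschitz[OF R, of x y] ramp_range[of R x] ramp_range[of R y] by auto
    then have "(ramp R x - ramp R y)\<^sup>2 \<le> min 1 (2 * \<bar>x - y\<bar> / R) ^ 2"
      using power_mono[of "\<bar>ramp R x - ramp R y\<bar>" _ 2] by fastforce
    then have "form_integrand \<alpha> (ramp R) (ramp R) (x, y) \<le> min 1 (2 * \<bar>x - y\<bar> / R) ^ 2 * (stable_const \<alpha> / \<bar>x - y\<bar> powr (1 + \<alpha>))"
      unfolding form_integrand_same using C by (intro mult_right_mono) auto
    also have "\<dots> = 1 * (stable_const \<alpha> * g (x - y))" by (simp add: g_def)
    also have "\<dots> \<le> (indicator ?I x + indicator ?I y) * (stable_const \<alpha> * g (x - y))"
      using True C g[of "x - y"] by (intro mult_right_mono) (auto simp: indicator_def)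
    finally show ?thesis .
  next
    case False
    then have "ramp R x = 1" "ramp R y = 1" using R by (auto intro!: ramp_eq_1)
    then show ?thesis using C g[of "x - y"] by (simp add: form_integrand_same)
  qed
  have int1: "(\<integral>\<^sup>+y. ennreal (g (x - y)) \<partial>lborel) \<le> ennreal c" for x
  proof -
    have "(\<integral>\<^sup>+y. ennreal (g (x - y)) \<partial>lborel) = (\<integral>\<^sup>+z. ennreal (g z) \<partial>lborel)"
      using nn_integral_real_affine[of "\<lambda>z. ennreal (g z)" "-1" x] by simp
    also have "\<dots> \<le> ennreal c"
      unfolding g_def c_def by (rule nn_integral_powr_cutoff[OF \<alpha> R])
    finally show ?thesis .
  qed
  have int2: "(\<integral>\<^sup>+x. ennreal (g (x - y)) \<partial>lborel) \<le> ennreal c" for y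
  proof -
    have "g (x - y) = g (y - x)" for x by (simp add: g_def abs_minus_commute)
    then show ?thesis using int1[of y] by simp
  qed
  let ?F = "\<lambda>x y. ennreal (stable_const \<alpha> * g (x - y))"
  have F: "?F x y = ennreal (stable_const \<alpha>) * ennreal (g (x - y))" for x y
    using C g by (simp add: ennreal_mult)
  have "energy \<alpha> (ramp R) = (\<integral>\<^sup>+x. \<integral>\<^sup>+y. ennreal (form_integrand \<alpha> (ramp R) (ramp R) (x, y)) \<partial>lborel \<partial>lborel)"
    by (simp add: energy_eq_energy_at energy_at_def)
  also have "\<dots> \<le> (\<integral>\<^sup>+x. \<integral>\<^sup>+y. indicator ?I x * ?F x y + indicator ?I y * ?F x y \<partial>lborel \<partial>lborel)"
  proof (intro nn_integral_mono)
    fix x y :: real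
    have "ennreal (form_integrand \<alpha> (ramp R) (ramp R) (x, y)) \<le> ennreal ((indicator ?I x + indicator ?I y) * (stable_const \<alpha> * g (x - y)))"
      by (intro ennreal_leI bound)
    also have "\<dots> = indicator ?I x * ?F x y + indicator ?I y * ?F x y"
      using C g[of "x - y"] by (auto simp: indicator_def simp flip: ennreal_plus)
    finally show "ennreal (form_integrand \<alpha> (ramp R) (ramp R) (x, y)) \<le> \<dots>" .
  qed
  also have "\<dots> = (\<integral>\<^sup>+x. (\<integral>\<^sup>+y. indicator ?I x * ?F x y \<partial>lborel) + (\<integral>\<^sup>+y. indicator ?I y * ?F x y \<partial>lborel) \<partial>lborel)"
    by (intro nn_integral_cong nn_integral_add) measurable
  also have "\<dots> = (\<integral>\<^sup>+x. \<integral>\<^sup>+y. indicator ?I x * ?F x y \<partial>lborel \<partial>lborel) + (\<integral>\<^sup>+x. \<integral>\<^sup>+y. indicator ?I y * ?F x y \<partial>lborel \<partial>lborel)"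
    by (intro nn_integral_add) measurable
  also have "(\<integral>\<^sup>+x. \<integral>\<^sup>+y. indicator ?I y * ?F x y \<partial>lborel \<partial>lborel) = (\<integral>\<^sup>+y. \<integral>\<^sup>+x. indicator ?I y * ?F x y \<partial>lborel \<partial>lborel)"
    by (rule lborel_pair.Fubini') measurable
  also have "(\<integral>\<^sup>+x. \<integral>\<^sup>+y. indicator ?I x * ?F x y \<partial>lborel \<partial>lborel) + (\<integral>\<^sup>+y. \<integral>\<^sup>+x. indicator ?I y * ?F x y \<partial>lborel \<partial>lborel)
    \<le> (\<integral>\<^sup>+x. ennreal (stable_const \<alpha> * c) * indicator ?I x \<partial>lborel) + (\<integral>\<^sup>+x. ennreal (stable_const \<alpha> * c) * indicator ?I x \<partial>lborel)"
  proof (intro add_mono nn_integral_mono)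
    fix x :: real
    have "(\<integral>\<^sup>+y. indicator ?I x * ?F x y \<partial>lborel) = indicator ?I x * (ennreal (stable_const \<alpha>) * (\<integral>\<^sup>+y. ennreal (g (x - y)) \<partial>lborel))"
      unfolding F by (simp add: nn_integral_cmult)
    also have "\<dots> \<le> indicator ?I x * (ennreal (stable_const \<alpha>) * ennreal c)"
      by (intro mult_left_mono int1) auto
    finally show "(\<integral>\<^sup>+y. indicator ?I x * ?F x y \<partial>lborel) \<le> ennreal (stable_const \<alpha> * c) * indicator ?I x"
      using C c by (simp add: ennreal_mult mult.commute)
    have "(\<integral>\<^sup>+y. indicator ?I x * ?F y x \<partial>lborel) = indicator ?I x * (ennreal (stable_const \<alpha>) * (\<integral>\<^sup>+y. ennreal (g (y - x)) \<partial>lborel))"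
      unfolding F by (simp add: nn_integral_cmult)
    also have "\<dots> \<le> indicator ?I x * (ennreal (stable_const \<alpha>) * ennreal c)"
      by (intro mult_left_mono int2) auto
    finally show "(\<integral>\<^sup>+y. indicator ?I x * ?F y x \<partial>lborel) \<le> ennreal (stable_const \<alpha> * c) * indicator ?I x"
      using C c by (simp add: ennreal_mult mult.commute)
  qed
  also have "\<dots> = ennreal (stable_const \<alpha> * c * (2 * R)) + ennreal (stable_const \<alpha> * c * (2 * R))"
    using R C c by (simp add: nn_integral_cmult ennreal_mult[symmetric])
  also have "\<dots> = ennreal (4 * stable_const \<alpha> * c * R)"
    using R C c by (simp flip: ennreal_plus)
  also have "4 * stable_const \<alpha> * c * R = ramp_const \<alpha> * R powr (1 - \<alpha>)"
    using R by (simp add: c_def ramp_const_def powr_diff powr_minus_divide)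
  finally show ?thesis .
qed

lemma ln_inverse_ge_1:
  fixes m :: real
  assumes "0 < m" "m \<le> 1 / 3" shows "1 \<le> ln (inverse m)"
proof -
  have "exp 1 \<le> (3::real)" by (rule exp_le)
  also have "3 \<le> inverse m" using assms le_imp_inverse_le[of m "1/3"] by simp
  finally show ?thesis using assms by (simp add: ln_ge_iff)
qed

text \<open>Writing the logarithm as 2 ln (1 / sqrt m) and using ln y \<le> y trades it for half a
  power of m. The threshold 1/3 keeps the logarithm at least 1, since exp 1 \<le> 3.\<close>

lemma mult_ln_inverse_powr_le_sqrt:
  fixes m \<xi> :: real
  assumes "0 < m" "m \<le> 1 / 3" and \<xi>: "0 < \<xi>" "\<xi> \<le> 1"
  shows "m * ln (inverse m) powr \<xi> \<le> 2 * sqrt m"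
proof -
  have "m * ln (inverse m) powr \<xi> \<le> m * ln (inverse m)"
    using assms by (intro mult_left_mono powr_le_self ln_inverse_ge_1 \<xi>) auto
  also have "\<dots> = m * (2 * ln (inverse (sqrt m)))"
    using assms by (simp add: ln_inverse ln_sqrt)
  also have "\<dots> \<le> m * (2 * inverse (sqrt m))"
    using assms ln_le_minus_one[of "inverse (sqrt m)"] by (intro mult_left_mono) auto
  also have "\<dots> = 2 * sqrt m"
    using assms by (simp add: field_simps)
  finally show ?thesis .
qed

section \<open>Necessity of the tail condition\<close>

context speed_measure
begin

lemma form_le_of_energy_le:
  assumes "f \<in> form_dom a \<alpha>" "energy \<alpha> f \<le> ennreal K" "0 \<le> K"
  shows "form \<alpha> f f \<le> K / 2"
  using assms energy_eq_form[OF assms(1)] by simp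

text \<open>Hoelder's inequality against the indicator of B, proved by integrating a pointwise Young
  inequality.\<close>

lemma Lp_norm_le_of_support:
  assumes [measurable]: "f \<in> borel_measurable borel" "B \<in> sets borel"
    and f01: "\<And>x. 0 \<le> f x" "\<And>x. f x \<le> 1" and B: "\<And>x. x \<notin> B \<Longrightarrow> f x = 0"
    and M: "0 < measure (mu a) B" and Q: "0 < (\<integral>x. (f x)\<^sup>2 \<partial>mu a)" and p: "1 \<le> p" "p < 2"
  shows "(\<integral>x. \<bar>f x\<bar> powr p \<partial>mu a) powr (2 / p)
    \<le> (\<integral>x. (f x)\<^sup>2 \<partial>mu a) * measure (mu a) B powr ((2 - p) / p)"
proof -
  define M where "M = measure (mu a) B"
  define Q where "Q = (\<integral>x. (f x)\<^sup>2 \<partial>mu a)"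
  have MQ: "0 < M" "0 < Q" using M Q by (auto simp: M_def Q_def)
  \<comment> \<open>This normalisation makes Young's inequality an equality where f^2 takes its mean
    value Q / M over B, so the integrated bound is sharp.\<close>
  define c where "c = (M / Q) powr ((2 - p) / 2)"
  have c: "0 < c" using MQ by (simp add: c_def)
  have int2: "integrable (mu a) (\<lambda>x. (f x)\<^sup>2)"
    using f01 by (intro mu.integrable_const_bound[where B=1]) (auto simp: power_le_one)
  have intB: "integrable (mu a) (indicator B :: real \<Rightarrow> real)"
    by (intro integrable_real_indicator) (auto simp: mu.emeasure_eq_measure)
  have pw: "\<bar>f x\<bar> powr p \<le> c * (p / 2 * (f x)\<^sup>2 + (2 - p) / 2 * (Q / M) * indicator B x)" for x
  proof (cases "f x = 0")
    case True
    then show ?thesis using c MQ p by simp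
  next
    case False
    then have fx: "0 < f x" "x \<in> B" using f01(1)[of x] B[of x] by auto
    have "((f x)\<^sup>2) powr (p / 2) * (Q / M) powr ((2 - p) / 2) \<le> p / 2 * (f x)\<^sup>2 + (2 - p) / 2 * (Q / M)"
      using fx MQ p by (intro Youngs_inequality_0) (auto simp: field_simps)
    also have "((f x)\<^sup>2) powr (p / 2) = f x powr p"
    proof -
      have "(f x)\<^sup>2 = f x powr 2" using fx by simp
      then show ?thesis by (simp only: powr_powr) simp
    qed
    finally have "c * (f x powr p * (Q / M) powr ((2 - p) / 2)) \<le> c * (p / 2 * (f x)\<^sup>2 + (2 - p) / 2 * (Q / M))"
      using c by (intro mult_left_mono) auto
    moreover have "c * (Q / M) powr ((2 - p) / 2) = 1"
    proof -
      have "c * (Q / M) powr ((2 - p) / 2) = (M / Q * (Q / M)) powr ((2 - p) / 2)"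
        using MQ by (simp only: c_def powr_mult[symmetric] divide_nonneg_pos less_imp_le)
      then show ?thesis using MQ by simp
    qed
    then have "c * (f x powr p * (Q / M) powr ((2 - p) / 2)) = f x powr p"
      by (metis mult.commute mult.left_commute mult.right_neutral)
    ultimately show ?thesis using fx by simp
  qed
  have "(\<integral>x. \<bar>f x\<bar> powr p \<partial>mu a) \<le> (\<integral>x. c * (p / 2 * (f x)\<^sup>2 + (2 - p) / 2 * (Q / M) * indicator B x) \<partial>mu a)"
    using int2 intB c MQ p by (intro integral_mono' pw) auto
  also have "\<dots> = c * (p / 2 * Q + (2 - p) / 2 * (Q / M) * M)"
    using int2 intB by (simp add: Q_def M_def)
  also have "\<dots> = c * Q" using MQ by (simp add: field_simps)
  finally have "(\<integral>x. \<bar>f x\<bar> powr p \<partial>mu a) powr (2 / p) \<le> (c * Q) powr (2 / p)"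
    using p by (intro powr_mono2) auto
  also have "\<dots> = c powr (2 / p) * Q powr (2 / p)" using c MQ by (simp add: powr_mult)
  also have "c powr (2 / p) = (M / Q) powr ((2 - p) / p)"
  proof -
    have "(2 - p) / 2 * (2 / p) = (2 - p) / p" using p by (simp add: field_simps)
    then show ?thesis by (simp only: c_def powr_powr)
  qed
  also have "\<dots> = M powr ((2 - p) / p) / Q powr ((2 - p) / p)" using MQ by (simp add: powr_divide)
  also have "Q powr (2 / p) = Q * Q powr ((2 - p) / p)"
  proof -
    have "Q powr (2 / p) = Q powr (1 + (2 - p) / p)" using p by (simp add: diff_divide_distrib)
    then show ?thesis using MQ by (simp add: powr_add)
  qed
  also have "M powr ((2 - p) / p) / Q powr ((2 - p) / p) * (Q * Q powr ((2 - p) / p)) = Q * M powr ((2 - p) / p)"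
    using MQ by simp
  finally show ?thesis by (simp add: Q_def M_def)
qed

lemma tail_le_of_beckner:
  assumes C: "0 < C" and R: "0 < R" and M: "tail (R / 2) \<le> 1 / 3"
    and ineq: "\<And>u p. u \<in> generator_dom a \<alpha> \<Longrightarrow> 1 \<le> p \<Longrightarrow> p < 2 \<Longrightarrow>
      (\<integral>x. (u x)\<^sup>2 \<partial>mu a) - (\<integral>x. \<bar>u x\<bar> powr p \<partial>mu a) powr (2 / p)
        \<le> C * (2 - p) powr \<xi> * form \<alpha> u u"
  shows "tail R * ln (inverse (tail (R / 2))) powr \<xi> \<le> 3 / 2 * C * ramp_const \<alpha> * R powr (1 - \<alpha>)"
proof -
  define L where "L = ln (inverse (tail (R / 2)))"
  have L: "1 \<le> L" unfolding L_def by (intro ln_inverse_ge_1 tail_pos M)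
  \<comment> \<open>The factor gained from the small support becomes exp (-1/p) \<le> 2/3, so a
    fixed third of the second moment survives in the deficit, while (2 - p)^\<xi> is L^(-\<xi>). The
    bound L \<ge> 1 is what makes p \<ge> 1.\<close>
  define p where "p = 2 - 1 / L"
  have p: "1 \<le> p" "p < 2" "2 - p = 1 / L" using L by (auto simp: p_def)
  let ?f = "ramp R"
  let ?Q = "\<integral>x. (?f x)\<^sup>2 \<partial>mu a" and ?P = "\<integral>x. \<bar>?f x\<bar> powr p \<partial>mu a"
  have rc: "0 < ramp_const \<alpha>"
    using stable_const_pos[OF alpha_pos alpha(2)] alpha by (simp add: ramp_const_def add_pos_pos)
  have en: "energy \<alpha> ?f \<le> ennreal (ramp_const \<alpha> * R powr (1 - \<alpha>))"
    by (rule energy_ramp_le[OF alpha R])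
  have f: "?f \<in> form_dom a \<alpha>"
    using en by (intro form_dom_bounded ramp_range) (auto intro: le_less_trans)
  have form: "form \<alpha> ?f ?f \<le> ramp_const \<alpha> * R powr (1 - \<alpha>) / 2"
    using rc by (intro form_le_of_energy_le f en) auto
  have "tail R = (\<integral>x. indicator (- {-R<..<R}) x \<partial>mu a)" by (simp add: tail_def)
  also have "\<dots> \<le> ?Q"
  proof (rule integral_mono')
    show "integrable (mu a) (\<lambda>x. (?f x)\<^sup>2)" by (rule form_dom_integrable_sq[OF f])
    show "indicator (- {-R<..<R}) x \<le> (?f x)\<^sup>2" for x
      using ramp_eq_1[OF R, of x] by (auto simp: indicator_def abs_if split: if_splits)
  qed simp
  finally have Q: "tail R \<le> ?Q" .
  then have Q0: "0 < ?Q" using tail_pos[of R] by simp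
  have "?P powr (2 / p) \<le> ?Q * tail (R / 2) powr ((2 - p) / p)"
    unfolding tail_def
  proof (rule Lp_norm_le_of_support)
    show "x \<notin> - {- (R / 2)<..<R / 2} \<Longrightarrow> ?f x = 0" for x
      using ramp_eq_0[OF R, of x] by (auto simp: abs_if split: if_splits)
    show "0 < measure (mu a) (- {- (R / 2)<..<R / 2})"
      using tail_pos[of "R / 2"] by (simp add: tail_def)
  qed (use Q0 p ramp_range in auto)
  also have "tail (R / 2) powr ((2 - p) / p) \<le> 2 / 3"
  proof -
    have "(2 - p) / p * ln (tail (R / 2)) = - (1 / p)"
    proof -
      have "ln (tail (R / 2)) = - L" by (simp add: L_def ln_inverse)
      then show ?thesis using L by (simp add: p(3))
    qed
    then have "tail (R / 2) powr ((2 - p) / p) = exp (- (1 / p))"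
      using tail_pos[of "R / 2"] by (simp add: powr_def)
    also have "\<dots> \<le> exp (- (1 / 2))" using p by (simp add: frac_le)
    also have "\<dots> = 1 / exp (1 / 2)" by (simp only: exp_minus inverse_eq_divide)
    also have "\<dots> \<le> 1 / (3 / 2)" using exp_ge_add_one_self[of "1/2 :: real"] by (intro divide_left_mono) auto
    finally show ?thesis by simp
  qed
  finally have "?Q - ?P powr (2 / p) \<ge> ?Q / 3" using Q0 by simp
  moreover have "?Q - ?P powr (2 / p) \<le> C * (2 - p) powr \<xi> * form \<alpha> ?f ?f"
    by (rule beckner_extends_to_form_dom[OF f ramp_range p(1,2) _ ineq[OF _ p(1,2)]]) (use C in simp)
  moreover have "C * (2 - p) powr \<xi> * form \<alpha> ?f ?f \<le> C * (1 / L) powr \<xi> * (ramp_const \<alpha> * R powr (1 - \<alpha>) / 2)"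
    unfolding p(3) using C by (intro mult_left_mono form) auto
  ultimately have "tail R \<le> 3 * (C * (1 / L) powr \<xi> * (ramp_const \<alpha> * R powr (1 - \<alpha>) / 2))"
    using Q by linarith
  then have "tail R * L powr \<xi> \<le> 3 * (C * (1 / L) powr \<xi> * (ramp_const \<alpha> * R powr (1 - \<alpha>) / 2)) * L powr \<xi>"
    by (intro mult_right_mono) auto
  also have "\<dots> = 3 / 2 * C * ramp_const \<alpha> * R powr (1 - \<alpha>) * ((1 / L) powr \<xi> * L powr \<xi>)" by simp
  also have "(1 / L) powr \<xi> * L powr \<xi> = 1" using L by (simp add: powr_divide)
  finally show ?thesis by (simp add: L_def)
qed

lemma tail_condition_of_beckner:
  assumes C: "0 < C" and \<xi>: "0 < \<xi>" "\<xi> \<le> 1"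
    and ineq: "\<And>u p. u \<in> generator_dom a \<alpha> \<Longrightarrow> 1 \<le> p \<Longrightarrow> p < 2 \<Longrightarrow>
      (\<integral>x. (u x)\<^sup>2 \<partial>mu a) - (\<integral>x. \<bar>u x\<bar> powr p \<partial>mu a) powr (2 / p)
        \<le> C * (2 - p) powr \<xi> * form \<alpha> u u"
  shows "\<exists>B. \<forall>R\<ge>0. R powr (\<alpha> - 1) * tail R * ln (inverse (tail R)) powr \<xi> \<le> B"
proof -
  have "\<forall>\<^sub>F n in sequentially. tail (real n) < 1 / 3"
    using tail_tendsto_0 by (rule order_tendstoD) simp
  then obtain n where n: "\<And>m. m \<ge> n \<Longrightarrow> tail (real m) < 1 / 3" unfolding eventually_sequentially by blast
  define R0 where "R0 = real (Suc n)"
  have R0: "0 < R0" "tail R0 \<le> 1 / 3" using n[of "Suc n"] by (auto simp: R0_def)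
  define A where "A = 3 / 2 * C * ramp_const \<alpha>"
  have A: "0 \<le> A"
    using C stable_const_pos[OF alpha_pos alpha(2)] alpha by (simp add: A_def ramp_const_def)
  have main: "tail R * ln (inverse (tail (R / 2))) powr \<xi> \<le> A * R powr (1 - \<alpha>)" if "2 * R0 \<le> R" for R
    using tail_le_of_beckner[OF C _ _ ineq, of R] that R0 tail_antimono[of R0 "R/2"] by (simp add: A_def)
  \<comment> \<open>Starting at 4 R0 leaves room to apply \<open>main\<close> both at R and at
    R/2.\<close>
  have far: "R powr (\<alpha> - 1) * tail R * ln (inverse (tail R)) powr \<xi> \<le> 4 * A" if R: "4 * R0 \<le> R" for R
  proof -
    have R_pos: "0 < R" using R R0 by simp
    let ?m = "tail R" and ?M = "tail (R / 2)"
    have third: "tail S \<le> 1 / 3" if "R0 \<le> S" for S using tail_antimono[OF that] R0 by simp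
    have mM: "?m \<le> ?M" using R_pos by (intro tail_antimono) simp
    have M3: "?M \<le> 1 / 3" using R R0 by (intro third) simp
    \<comment> \<open>If M^2 \<le> m, the logarithms of 1/m and 1/M differ by at most a factor 2.
      Otherwise sqrt m < M, so m with its logarithm is at most 2 M, and M is bounded by
      \<open>main\<close> at radius R/2. The second case costs 2 times 2 A, whence the constant
      4.\<close>
    have key: "?m * ln (inverse ?m) powr \<xi> \<le> 4 * A * R powr (1 - \<alpha>)"
    proof (cases "?M\<^sup>2 \<le> ?m")
      case True
      have "ln (inverse ?m) \<le> 2 * ln (inverse ?M)"
      proof -
        have "ln (?M\<^sup>2) \<le> ln ?m" using True tail_pos[of R] tail_pos[of "R/2"] by simp
        then show ?thesis using tail_pos[of R] tail_pos[of "R/2"] by (simp add: ln_inverse ln_realpow)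
      qed
      then have "ln (inverse ?m) powr \<xi> \<le> (2 * ln (inverse ?M)) powr \<xi>"
        using order_trans[OF zero_le_one ln_inverse_ge_1[of ?m]] tail_pos[of R] mM M3 \<xi>
        by (intro powr_mono2) linarith+
      also have "\<dots> = 2 powr \<xi> * ln (inverse ?M) powr \<xi>"
        using ln_inverse_ge_1[OF tail_pos M3] by (simp add: powr_mult)
      also have "\<dots> \<le> 2 * ln (inverse ?M) powr \<xi>"
        using \<xi> by (intro mult_right_mono powr_le_self) auto
      finally have "?m * ln (inverse ?m) powr \<xi> \<le> ?m * (2 * ln (inverse ?M) powr \<xi>)"
        by (intro mult_left_mono) auto
      also have "\<dots> \<le> 2 * (A * R powr (1 - \<alpha>))" using main[of R] R R0 by simp
      also have "\<dots> \<le> 4 * A * R powr (1 - \<alpha>)" using A by simp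
      finally show ?thesis .
    next
      case False
      have "?m * ln (inverse ?m) powr \<xi> \<le> 2 * sqrt ?m"
        using mM M3 by (intro mult_ln_inverse_powr_le_sqrt tail_pos \<xi>) simp
      moreover have "sqrt ?m \<le> ?M" using False by (intro real_le_lsqrt) auto
      moreover have "?M \<le> 2 * (A * R powr (1 - \<alpha>))"
      proof -
        \<comment> \<open>At radius R/2 the logarithm contains \<open>tail (R / 4)\<close>, which is
          still at most 1/3; the logarithm is thus at least 1 and is discarded.\<close>
        have "?M * 1 \<le> ?M * ln (inverse (tail (R / 2 / 2))) powr \<xi>"
        proof (intro mult_left_mono ge_one_powr_ge_zero)
          show "1 \<le> ln (inverse (tail (R / 2 / 2)))" using R by (intro ln_inverse_ge_1 tail_pos third) simp
        qed (use \<xi> in auto)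
        also have "\<dots> \<le> A * (R / 2) powr (1 - \<alpha>)" using R by (intro main) simp
        also have "(R / 2) powr (1 - \<alpha>) = R powr (1 - \<alpha>) * 2 powr (\<alpha> - 1)"
          using R_pos by (simp add: powr_divide powr_diff powr_minus)
        also have "A * (R powr (1 - \<alpha>) * 2 powr (\<alpha> - 1)) \<le> A * (R powr (1 - \<alpha>) * 2 powr 1)"
          using alpha A by (intro mult_left_mono powr_mono) auto
        finally show ?thesis by simp
      qed
      ultimately show ?thesis by simp
    qed
    have "R powr (\<alpha> - 1) * tail R * ln (inverse (tail R)) powr \<xi> \<le> R powr (\<alpha> - 1) * (4 * A * R powr (1 - \<alpha>))"
      using mult_left_mono[OF key, of "R powr (\<alpha> - 1)"] by (simp add: mult.assoc)
    also have "\<dots> = 4 * A * (R powr (\<alpha> - 1) * R powr (1 - \<alpha>))" by simp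
    also have "R powr (\<alpha> - 1) * R powr (1 - \<alpha>) = 1" using R_pos by (simp add: powr_add[symmetric])
    finally show ?thesis by simp
  qed
  \<comment> \<open>On bounded radii the power and the logarithm are at most their values at 4 R0,
    and the tail is at most 1.\<close>
  define B where "B = (4 * R0) powr (\<alpha> - 1) * 1 * ln (inverse (tail (4 * R0))) powr \<xi>"
  have near: "R powr (\<alpha> - 1) * tail R * ln (inverse (tail R)) powr \<xi> \<le> B" if "0 \<le> R" "R \<le> 4 * R0" for R
    unfolding B_def
  proof (intro mult_mono powr_mono2)
    have "tail (4 * R0) \<le> tail R" using that by (intro tail_antimono)
    then show "ln (inverse (tail R)) \<le> ln (inverse (tail (4 * R0)))"
      using tail_pos[of R] tail_pos[of "4 * R0"] by simp
    show "0 \<le> ln (inverse (tail R))" using tail_pos[of R] by (simp add: one_le_inverse)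
  qed (use that alpha \<xi> in auto)
  have "R powr (\<alpha> - 1) * tail R * ln (inverse (tail R)) powr \<xi> \<le> max B (4 * A)" if "0 \<le> R" for R
    using near[of R] far[of R] that by (cases "R \<le> 4 * R0") (auto simp: le_max_iff_disj)
  then show ?thesis by blast
qed

end

section \<open>From the tail condition to the Beckner inequality\<close>

text \<open>The window from 2 c to 4 c, with c = b 2^k, is used because the slice starting at c is
  saturated from 2 c on.\<close>

lemma ex_dyadic_level:
  fixes b h :: real
  assumes "0 < b" "2 * b \<le> h"
  shows "\<exists>k. 2 * (b * 2 ^ k) \<le> h \<and> h < 4 * (b * 2 ^ k)"
proof -
  obtain n where "h / (2 * b) < 2 ^ n" using real_arch_pow[of 2 "h / (2 * b)"] by auto
  then have ex: "\<exists>n. h < 2 * b * 2 ^ n" using assms by (auto simp: pos_divide_less_eq mult.commute)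
  define n where "n = (LEAST n. h < 2 * b * 2 ^ n)"
  have n: "h < 2 * b * 2 ^ n" unfolding n_def by (rule LeastI_ex[OF ex])
  then obtain k where k: "n = Suc k" using assms by (cases n) auto
  have "\<not> h < 2 * b * 2 ^ k" using not_less_Least[of k "\<lambda>n. h < 2 * b * 2 ^ n"] k by (simp add: n_def)
  then show ?thesis using n k by (intro exI[of _ k]) auto
qed

lemma le_suminf_ennreal:
  fixes F :: "nat \<Rightarrow> ennreal"
  shows "F k \<le> suminf F"
proof -
  have "sum F {k} \<le> suminf F" by (intro sum_le_suminf) auto
  then show ?thesis by simp
qed

text \<open>Since m \<le> 1, also m^2 \<le> m, and Markov's bound gives 2^k \<le> 2 / m. Together
  with 2 \<le> 2 / m this yields 4 / m, the origin of the 4 in the logarithmic profile.\<close>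

lemma log_weight_le_level:
  fixes m t :: real and k :: nat
  assumes \<xi>: "0 < \<xi>" and m: "0 < m" "m \<le> 1" "m \<le> 4 / 4 ^ k" and t: "0 \<le> t" "t \<le> 2 ^ k"
  shows "(1 + ln (2 + t)) powr \<xi> \<le> (1 + ln (4 / m)) powr \<xi>"
proof -
  have "m\<^sup>2 \<le> m * 1" unfolding power2_eq_square using m by (intro mult_left_mono) auto
  also have "\<dots> \<le> (2 / 2 ^ k)\<^sup>2" using m(3) by (simp add: power_divide power2_eq_square power_mult_distrib[symmetric])
  finally have "m \<le> 2 / 2 ^ k" by (rule power2_le_imp_le) simp
  then have "2 ^ k \<le> 2 / m" using m by (simp add: field_simps)
  moreover have "2 \<le> 2 / m" using m by (simp add: field_simps)
  ultimately have "2 + t \<le> 4 / m" using t by linarith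
  then show ?thesis using t \<xi> m by (intro powr_mono2 add_left_mono) (auto simp: add_nonneg_nonneg)
qed

text \<open>Because the centre c + N is at least N, the relative distance is at most h / N + 1. For
  h \<ge> N/2 one has h + N \<le> 3 h; below, (3 N / 2)^2 times the bound 4 for the weight is 9 N^2.
  This is why 9 occurs twice.\<close>

lemma psi_le_log_weight:
  assumes p: "1 \<le> p" "p < 2" and \<xi>: "0 < \<xi>" "\<xi> \<le> 1" and N: "0 < N" and c: "0 \<le> c" and y: "0 \<le> y"
  defines "h \<equiv> \<bar>y - c\<bar>"
  shows "psi p (c + N) y \<le> 8 * (2 - p) powr \<xi> *
    (9 * N\<^sup>2 + 9 * (if N / 2 \<le> h then h\<^sup>2 * (1 + ln (2 + h / N)) powr \<xi> else 0))"
proof -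
  let ?s = "c + N"
  have s: "0 < ?s" using N c by simp
  have h: "0 \<le> h" by (simp add: h_def)
  have d: "\<bar>y - ?s\<bar> \<le> h + N" using N by (simp add: h_def)
  have "\<bar>y - ?s\<bar> / ?s \<le> (h + N) / N" using d N c h by (intro frac_le) auto
  then have "1 + \<bar>y - ?s\<bar> / ?s \<le> 2 + h / N" using N by (simp add: add_divide_distrib)
  moreover have "0 \<le> \<bar>y - ?s\<bar> / ?s" using s by simp
  ultimately have "(1 + ln (1 + \<bar>y - ?s\<bar> / ?s)) powr \<xi> \<le> (1 + ln (2 + h / N)) powr \<xi>"
    using \<xi> by (intro powr_mono2 add_left_mono) auto
  moreover have "(y - ?s)\<^sup>2 \<le> (h + N)\<^sup>2" using d h N by (simp add: abs_le_square_iff[symmetric])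
  ultimately have "(y - ?s)\<^sup>2 * (1 + ln (1 + \<bar>y - ?s\<bar> / ?s)) powr \<xi> \<le> (h + N)\<^sup>2 * (1 + ln (2 + h / N)) powr \<xi>"
    by (intro mult_mono) auto
  also have "\<dots> \<le> 9 * N\<^sup>2 + 9 * (if N / 2 \<le> h then h\<^sup>2 * (1 + ln (2 + h / N)) powr \<xi> else 0)"
  proof (cases "N / 2 \<le> h")
    case True
    then have "(h + N)\<^sup>2 \<le> (3 * h)\<^sup>2" using N h by (intro power_mono) auto
    then have "(h + N)\<^sup>2 * (1 + ln (2 + h / N)) powr \<xi> \<le> (3 * h)\<^sup>2 * (1 + ln (2 + h / N)) powr \<xi>"
      by (intro mult_right_mono) auto
    then show ?thesis using True by (simp add: power_mult_distrib add_increasing)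
  next
    case False
    have hN: "0 \<le> h / N" "h / N \<le> 1 / 2" using False h N by (auto simp: field_simps)
    have "(1 + ln (2 + h / N)) powr \<xi> \<le> 1 + ln (2 + h / N)" using hN by (intro powr_le_self \<xi>) auto
    also have "\<dots> \<le> 4" using ln_le_minus_one[of "2 + h / N"] hN by linarith
    finally have "(h + N)\<^sup>2 * (1 + ln (2 + h / N)) powr \<xi> \<le> (3 / 2 * N)\<^sup>2 * 4"
      using False h N by (intro mult_mono power_mono) auto
    then show ?thesis using False by (simp add: power_mult_distrib power_divide)
  qed
  finally have "8 * (2 - p) powr \<xi> * ((y - ?s)\<^sup>2 * (1 + ln (1 + \<bar>y - ?s\<bar> / ?s)) powr \<xi>) \<le> 8 * (2 - p) powr \<xi> *
    (9 * N\<^sup>2 + 9 * (if N / 2 \<le> h then h\<^sup>2 * (1 + ln (2 + h / N)) powr \<xi> else 0))"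
    by (intro mult_left_mono) auto
  then show ?thesis using psi_le[OF p \<xi> s y] by simp
qed

section \<open>The logarithmic Hardy inequality and sufficiency\<close>

context speed_measure
begin

text \<open>The tail condition is recast in the form used below: R + 1 bounds the distance to a base
  point in [-1, 1], and 1 + ln (4 / m) makes the profile monotone. The range R \<le> 1 is trivial,
  and for R \<ge> 1 the constant 1 + ln 4 is absorbed by the logarithm, which is bounded away from
  0.\<close>

lemma log_profile_tail_bounded:
  assumes \<xi>: "0 < \<xi>" "\<xi> \<le> 1"
    and B: "\<And>R. 0 \<le> R \<Longrightarrow> R powr (\<alpha> - 1) * tail R * ln (inverse (tail R)) powr \<xi> \<le> B"
  shows "\<exists>B'>0. \<forall>R\<ge>0. (R + 1) powr (\<alpha> - 1) * (tail R * (1 + ln (4 / tail R)) powr \<xi>) \<le> B'"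
proof -
  define l1 where "l1 = ln (inverse (tail 1))"
  have l1: "0 < l1" using tail_pos[of 1] tail_less_1[of 1] by (simp add: l1_def ln_inverse)
  define c where "c = 1 + (1 + ln 4) / l1"
  have c: "1 \<le> c" using l1 by (simp add: c_def)
  have B0: "0 \<le> B" using B[of 0] by simp
  have pow2: "(2::real) powr (\<alpha> - 1) \<le> 2" using powr_mono[of "\<alpha> - 1" 1 2] alpha by simp
  have ln4: "ln 4 \<le> (3::real)" using ln_le_minus_one[of "4::real"] by simp
  have near: "(R + 1) powr (\<alpha> - 1) * (tail R * (1 + ln (4 / tail R)) powr \<xi>) \<le> 8" if "0 \<le> R" "R \<le> 1" for R
  proof -
    have "(R + 1) powr (\<alpha> - 1) \<le> 2 powr (\<alpha> - 1)" using that alpha by (intro powr_mono2) auto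
    then have 1: "(R + 1) powr (\<alpha> - 1) \<le> 2" using pow2 by simp
    have "tail R * (1 + ln (4 / tail R)) powr \<xi> \<le> 1 * (1 + ln (4 / 1)) powr \<xi>"
      by (intro log_profile_mono \<xi>) auto
    also have "\<dots> \<le> 1 + ln 4" using powr_le_self[OF \<xi>, of "1 + ln 4"] by simp
    finally have 2: "tail R * (1 + ln (4 / tail R)) powr \<xi> \<le> 4" using ln4 by simp
    show ?thesis using mult_mono[OF 1 2] by simp
  qed
  have far: "(R + 1) powr (\<alpha> - 1) * (tail R * (1 + ln (4 / tail R)) powr \<xi>) \<le> 2 * c * B" if R: "1 \<le> R" for R
  proof -
    let ?m = "tail R" and ?l = "ln (inverse (tail R))"
    have l: "l1 \<le> ?l" unfolding l1_def using tail_antimono[OF R] tail_pos[of R] tail_pos[of 1] by simp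
    have "(R + 1) powr (\<alpha> - 1) \<le> (2 * R) powr (\<alpha> - 1)" using R alpha by (intro powr_mono2) auto
    also have "\<dots> = 2 powr (\<alpha> - 1) * R powr (\<alpha> - 1)" using R by (simp add: powr_mult)
    also have "\<dots> \<le> 2 * R powr (\<alpha> - 1)" by (intro mult_right_mono pow2) auto
    finally have 1: "(R + 1) powr (\<alpha> - 1) \<le> 2 * R powr (\<alpha> - 1)" .
    have "1 + ln (4 / ?m) = (1 + ln 4) + ?l" using tail_pos[of R] by (simp add: ln_div ln_inverse)
    also have "1 + ln 4 \<le> (1 + ln 4) / l1 * ?l"
    proof -
      have "(1 + ln 4) / l1 * l1 \<le> (1 + ln 4) / l1 * ?l" using l l1 by (intro mult_left_mono) auto
      then show ?thesis using l1 by simp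
    qed
    finally have "1 + ln (4 / ?m) \<le> c * ?l" by (simp add: c_def distrib_right)
    moreover have "1 \<le> 4 / ?m" using tail_pos[of R] by (simp add: pos_le_divide_eq order_trans[OF tail_le_1])
    then have "0 \<le> 1 + ln (4 / ?m)" using ln_ge_zero[of "4 / ?m"] by linarith
    ultimately have "(1 + ln (4 / ?m)) powr \<xi> \<le> (c * ?l) powr \<xi>" using \<xi> by (intro powr_mono2) auto
    also have "\<dots> = c powr \<xi> * ?l powr \<xi>" using c l l1 by (simp add: powr_mult)
    also have "\<dots> \<le> c * ?l powr \<xi>" using \<xi> c by (intro mult_right_mono powr_le_self) auto
    finally have 2: "(1 + ln (4 / ?m)) powr \<xi> \<le> c * ?l powr \<xi>" .
    have "(R + 1) powr (\<alpha> - 1) * (?m * (1 + ln (4 / ?m)) powr \<xi>) \<le> (2 * R powr (\<alpha> - 1)) * (?m * (c * ?l powr \<xi>))"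
      using 1 2 c by (intro mult_mono mult_left_mono) auto
    also have "\<dots> = 2 * c * (R powr (\<alpha> - 1) * ?m * ?l powr \<xi>)" by simp
    also have "\<dots> \<le> 2 * c * B" using c R by (intro mult_left_mono B) auto
    finally show ?thesis .
  qed
  have "(R + 1) powr (\<alpha> - 1) * (tail R * (1 + ln (4 / tail R)) powr \<xi>) \<le> 8 + 2 * c * B" if "0 \<le> R" for R
    using near[of R] far[of R] that c B0 by (cases "R \<le> 1") (auto intro: order_trans)
  moreover have "0 < 8 + 2 * c * B" using c B0 by (simp add: add_pos_nonneg)
  ultimately show ?thesis by blast
qed

text \<open>A capacitary estimate: \<open>h\<close> vanishes at a point near the origin, so its truncation at level
  \<open>b\<close> climbs from \<open>0\<close> to \<open>b\<close>, which costs energy at least of order \<open>b\<^sup>2 / dist\<^bsup>\<alpha> - 1\<^esup>\<close>.\<close>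

lemma level_set_log_profile_le:
  assumes \<xi>: "0 < \<xi>" "\<xi> \<le> 1"
    and B': "0 < B'" "\<And>R. 0 \<le> R \<Longrightarrow> (R + 1) powr (\<alpha> - 1) * (tail R * (1 + ln (4 / tail R)) powr \<xi>) \<le> B'"
    and h [measurable]: "h \<in> borel_measurable borel" and fin: "energy \<alpha> h < \<infinity>"
    and x0: "\<bar>x0\<bar> \<le> 1" "energy_at \<alpha> h x0 < \<infinity>" "h x0 = 0" and b: "0 < b"
  defines "m \<equiv> measure (mu a) {x. 2 * b \<le> h x}"
  shows "ennreal (b\<^sup>2 * (m * (1 + ln (4 / m)) powr \<xi>)) \<le> ennreal (B' * holder_const \<alpha>) * energy \<alpha> (\<lambda>x. trunc_level b (h x))"
proof -
  define g where "g = (\<lambda>x. trunc_level b (h x))"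
  have g [measurable]: "g \<in> borel_measurable borel" unfolding g_def trunc_level_def by measurable
  have g_h: "\<bar>g x - g y\<bar> \<le> \<bar>h x - h y\<bar>" for x y
    unfolding g_def using b by (intro trunc_level_contraction) simp
  have "energy \<alpha> g \<le> energy \<alpha> h" using g_h by (intro energy_mono alpha_pos alpha(2))
  then have "energy \<alpha> g < \<infinity>" using fin by (rule le_less_trans)
  then obtain e where e: "energy \<alpha> g = ennreal e" "0 \<le> e" by (cases "energy \<alpha> g") auto
  have at: "energy_at \<alpha> g x < \<infinity>" if "energy_at \<alpha> h x < \<infinity>" for x
    using energy_at_mono[OF alpha_pos alpha(2) g_h] that by (rule le_less_trans)
  note K = holder_const_pos[OF alpha]
  have climb: "AE x in mu a. 2 * b \<le> h x \<longrightarrow> b\<^sup>2 \<le> holder_const \<alpha> * e * (\<bar>x\<bar> + 1) powr (\<alpha> - 1)"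
    unfolding AE_mu_iff using AE_energy_at_finite[OF h fin]
  proof eventually_elim
    case (elim x)
    show ?case
    proof
      assume "2 * b \<le> h x"
      then have "g x = b" "g x0 = 0" using b x0(3) by (auto simp: g_def trunc_level_def)
      then have "b\<^sup>2 \<le> holder_const \<alpha> * e * \<bar>x - x0\<bar> powr (\<alpha> - 1)"
        using holder_of_energy_at_finite[OF alpha g e at[OF elim] at[OF x0(2)]] by simp
      also have "\<dots> \<le> holder_const \<alpha> * e * (\<bar>x\<bar> + 1) powr (\<alpha> - 1)"
        using K e x0(1) alpha by (intro mult_left_mono powr_mono2) auto
      finally show "b\<^sup>2 \<le> \<dots>" .
    qed
  qed
  have m01: "0 \<le> m" "m \<le> 1" by (auto simp: m_def measure_mu_le_1)
  have "b\<^sup>2 * (m * (1 + ln (4 / m)) powr \<xi>) \<le> B' * holder_const \<alpha> * e"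
  proof (cases "e = 0")
    \<comment> \<open>With zero energy the climb is impossible, so the level set is null. The case
      is separate because the radius below divides by e.\<close>
    case True
    then have "AE x in mu a. x \<notin> {x. 2 * b \<le> h x}" using climb b by auto
    then have "{x. 2 * b \<le> h x} \<in> null_sets (mu a)" by (subst AE_iff_null_sets) auto
    then have "m = 0" by (simp add: m_def measure_def null_setsD1)
    then show ?thesis using True by simp
  next
    case False
    then have e0: "0 < e" using e by simp
    \<comment> \<open>The radius at which the Hoelder bound just permits a climb of height b: points
      of the level set satisfy |x| + 1 \<ge> \<rho>.\<close>
    define \<rho> where "\<rho> = (b\<^sup>2 / (holder_const \<alpha> * e)) powr (1 / (\<alpha> - 1))"
    have \<rho>: "\<rho> powr (\<alpha> - 1) = b\<^sup>2 / (holder_const \<alpha> * e)" "0 \<le> \<rho>"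
      using b K e0 alpha by (auto simp: \<rho>_def powr_powr)
    define R where "R = max 0 (\<rho> - 1)"
    have R: "0 \<le> R" "\<rho> \<le> R + 1" by (auto simp: R_def)
    have "AE x in mu a. x \<in> {x. 2 * b \<le> h x} \<longrightarrow> x \<in> - {-R<..<R}"
      using climb
    proof eventually_elim
      case (elim x)
      show ?case
      proof
        assume "x \<in> {x. 2 * b \<le> h x}"
        then have "\<rho> powr (\<alpha> - 1) \<le> (\<bar>x\<bar> + 1) powr (\<alpha> - 1)"
          using elim K e0 by (simp add: \<rho>(1) pos_divide_le_eq mult.commute)
        then have "\<rho> \<le> \<bar>x\<bar> + 1"
          using powr_less_mono2[of "\<alpha> - 1" "\<bar>x\<bar> + 1" \<rho>] alpha by (cases "\<rho> \<le> \<bar>x\<bar> + 1") auto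
        then have "R \<le> \<bar>x\<bar>" by (simp add: R_def)
        then show "x \<in> - {-R<..<R}" by auto
      qed
    qed
    then have "m \<le> tail R" unfolding m_def tail_def by (intro mu.finite_measure_mono_AE) auto
    then have "m * (1 + ln (4 / m)) powr \<xi> \<le> tail R * (1 + ln (4 / tail R)) powr \<xi>"
      using m01 by (intro log_profile_mono \<xi>) auto
    then have "\<rho> powr (\<alpha> - 1) * (m * (1 + ln (4 / m)) powr \<xi>) \<le> (R + 1) powr (\<alpha> - 1) * (tail R * (1 + ln (4 / tail R)) powr \<xi>)"
      using R \<rho>(2) m01 alpha by (intro mult_mono[OF powr_mono2]) auto
    also have "\<dots> \<le> B'" by (rule B'(2)[OF R(1)])
    finally show ?thesis using K e0 by (simp add: \<rho>(1) field_simps)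
  qed
  then have "ennreal (b\<^sup>2 * (m * (1 + ln (4 / m)) powr \<xi>)) \<le> ennreal (B' * holder_const \<alpha> * e)" by (rule ennreal_leI)
  also have "\<dots> = ennreal (B' * holder_const \<alpha>) * energy \<alpha> g"
    unfolding e(1) using B'(1) K e(2) by (intro ennreal_mult) auto
  finally show ?thesis by (simp add: g_def)
qed

text \<open>Maz'ya's truncation method, with a logarithmic weight that is controlled on each dyadic level
  by Markov's inequality.\<close>

lemma log_weighted_hardy:
  assumes \<xi>: "0 < \<xi>" "\<xi> \<le> 1"
    and B': "0 < B'" "\<And>R. 0 \<le> R \<Longrightarrow> (R + 1) powr (\<alpha> - 1) * (tail R * (1 + ln (4 / tail R)) powr \<xi>) \<le> B'"
    and h [measurable]: "h \<in> borel_measurable borel" and h0: "\<And>x. 0 \<le> h x" and fin: "energy \<alpha> h < \<infinity>"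
    and x0: "\<bar>x0\<bar> \<le> 1" "energy_at \<alpha> h x0 < \<infinity>" "h x0 = 0"
    and int: "integrable (mu a) (\<lambda>x. (h x)\<^sup>2)" and N: "0 < N" "(\<integral>x. (h x)\<^sup>2 \<partial>mu a) = N\<^sup>2"
  shows "(\<integral>\<^sup>+x. ennreal (if N / 2 \<le> h x then (h x)\<^sup>2 * (1 + ln (2 + h x / N)) powr \<xi> else 0) \<partial>mu a)
    \<le> ennreal (16 * B' * holder_const \<alpha>) * energy \<alpha> h"
proof -
  \<comment> \<open>The lowest saturation height 2 b_0 is N/2, where the weighted integral
    begins.\<close>
  define b where "b k = N / 4 * 2 ^ k" for k :: nat
  have b: "0 < b k" for k using N by (simp add: b_def)
  define A where "A k = {x. 2 * b k \<le> h x}" for k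
  have A [measurable]: "A k \<in> sets borel" for k unfolding A_def by measurable
  define m where "m k = measure (mu a) (A k)" for k
  have m01: "0 \<le> m k" "m k \<le> 1" for k by (auto simp: m_def measure_mu_le_1)
  have markov: "m k \<le> 4 / 4 ^ k" for k
  proof -
    have "(\<integral>x. (2 * b k)\<^sup>2 * indicator (A k) x \<partial>mu a) \<le> (\<integral>x. (h x)\<^sup>2 \<partial>mu a)"
    proof (intro integral_mono' int)
      show "(2 * b k)\<^sup>2 * indicator (A k) x \<le> (h x)\<^sup>2" for x
        using power_mono[of "2 * b k" "h x" 2] b[of k] by (simp add: A_def indicator_def)
    qed simp
    then have "(2 * b k)\<^sup>2 * m k \<le> N\<^sup>2" by (simp add: N(2) m_def)
    moreover have "(2 * b k)\<^sup>2 = N\<^sup>2 * (4 ^ k / 4)"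
      by (simp add: b_def power_mult_distrib power_divide power2_eq_square power_mult_distrib[symmetric])
    ultimately have "N\<^sup>2 * (4 ^ k / 4 * m k) \<le> N\<^sup>2 * 1" by (metis mult.assoc mult.right_neutral)
    then have "4 ^ k / 4 * m k \<le> 1" using N(1) by (subst (asm) mult_le_cancel_left_pos) auto
    then show ?thesis by (simp add: field_simps)
  qed
  \<comment> \<open>The factor 16 is 4^2, since h < 4 b_k on the k-th dyadic range.\<close>
  define w where "w k = 16 * (b k)\<^sup>2 * (1 + ln (4 / m k)) powr \<xi>" for k
  have w: "0 \<le> w k" for k by (simp add: w_def)
  let ?Z = "\<lambda>x. if N / 2 \<le> h x then (h x)\<^sup>2 * (1 + ln (2 + h x / N)) powr \<xi> else 0"
  \<comment> \<open>At m = 0 the quotient 4 / m takes a default value and w no longer dominates the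
    weight; such level sets are null and are discarded.\<close>
  have "AE x in mu a. \<forall>k. m k = 0 \<longrightarrow> x \<notin> A k"
    unfolding AE_all_countable
  proof
    fix k
    show "AE x in mu a. m k = 0 \<longrightarrow> x \<notin> A k"
    proof (cases "m k = 0")
      case True
      then have "A k \<in> null_sets (mu a)" by (intro null_setsI) (simp_all add: m_def mu.emeasure_eq_measure)
      then show ?thesis using AE_not_in by auto
    qed simp
  qed
  then have pw: "AE x in mu a. ennreal (?Z x) \<le> (\<Sum>k. ennreal (w k) * indicator (A k) x)"
  proof eventually_elim
    case (elim x)
    show ?case
    proof (cases "N / 2 \<le> h x")
      case True
      then obtain k where k: "2 * b k \<le> h x" "h x < 4 * b k"
        using ex_dyadic_level[of "N / 4" "h x"] N(1) by (auto simp: b_def)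
      then have xA: "x \<in> A k" by (simp add: A_def)
      then have "0 < m k" using elim m01(1)[of k] by (metis less_eq_real_def)
      moreover have "h x / N \<le> 2 ^ k" using k(2) N(1) by (simp add: b_def field_simps)
      ultimately have "(1 + ln (2 + h x / N)) powr \<xi> \<le> (1 + ln (4 / m k)) powr \<xi>"
        using h0[of x] N(1) by (intro log_weight_le_level[where k=k] \<xi> m01 markov) auto
      moreover have "(h x)\<^sup>2 \<le> (4 * b k)\<^sup>2" using k(2) h0[of x] by (intro power_mono) auto
      ultimately have "?Z x \<le> (4 * b k)\<^sup>2 * (1 + ln (4 / m k)) powr \<xi>"
        using True by (auto intro: mult_mono)
      also have "\<dots> = w k" by (simp add: w_def power_mult_distrib)
      finally have "ennreal (?Z x) \<le> ennreal (w k) * indicator (A k) x" using xA by (simp add: ennreal_leI)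
      also have "\<dots> \<le> (\<Sum>k. ennreal (w k) * indicator (A k) x)"
        by (rule le_suminf_ennreal[of "\<lambda>k. ennreal (w k) * indicator (A k) x" k])
      finally show ?thesis .
    qed simp
  qed
  have "(\<integral>\<^sup>+x. ennreal (?Z x) \<partial>mu a) \<le> (\<integral>\<^sup>+x. (\<Sum>k. ennreal (w k) * indicator (A k) x) \<partial>mu a)"
    by (rule nn_integral_mono_AE[OF pw])
  also have "\<dots> = (\<Sum>k. \<integral>\<^sup>+x. ennreal (w k) * indicator (A k) x \<partial>mu a)"
    by (rule nn_integral_suminf) measurable
  also have "\<dots> \<le> (\<Sum>k. ennreal (16 * B' * holder_const \<alpha>) * energy \<alpha> (\<lambda>x. trunc_level (b k) (h x)))"
  proof (intro suminf_le)
    fix k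
    have "(\<integral>\<^sup>+x. ennreal (w k) * indicator (A k) x \<partial>mu a) = ennreal (w k * m k)"
      using w m01 by (simp add: nn_integral_cmult mu.emeasure_eq_measure m_def ennreal_mult)
    also have "w k * m k = 16 * ((b k)\<^sup>2 * (m k * (1 + ln (4 / m k)) powr \<xi>))" by (simp add: w_def)
    also have "ennreal \<dots> = 16 * ennreal ((b k)\<^sup>2 * (m k * (1 + ln (4 / m k)) powr \<xi>))"
      using m01 by (subst ennreal_mult) auto
    also have "\<dots> \<le> 16 * (ennreal (B' * holder_const \<alpha>) * energy \<alpha> (\<lambda>x. trunc_level (b k) (h x)))"
      unfolding m_def A_def
      by (intro mult_left_mono level_set_log_profile_le[OF \<xi> B' h fin x0 b]) simp_all
    also have "\<dots> = ennreal (16 * B' * holder_const \<alpha>) * energy \<alpha> (\<lambda>x. trunc_level (b k) (h x))"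
      using B'(1) holder_const_pos[OF alpha] by (simp add: ennreal_mult mult.assoc)
    finally show "(\<integral>\<^sup>+x. ennreal (w k) * indicator (A k) x \<partial>mu a)
      \<le> ennreal (16 * B' * holder_const \<alpha>) * energy \<alpha> (\<lambda>x. trunc_level (b k) (h x))" .
  qed auto
  also have "\<dots> = ennreal (16 * B' * holder_const \<alpha>) * (\<Sum>k. energy \<alpha> (\<lambda>x. trunc_level (b k) (h x)))"
    by simp
  also have "\<dots> \<le> ennreal (16 * B' * holder_const \<alpha>) * energy \<alpha> h"
    unfolding b_def using N(1) by (intro mult_left_mono energy_trunc_level_suminf_le alpha_pos alpha(2) h) auto
  finally show ?thesis .
qed

lemma beckner_le_psi:
  assumes f: "f \<in> form_dom a \<alpha>" and p: "1 \<le> p" "p < 2" and s: "0 < s"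
  shows "integrable (mu a) (\<lambda>x. psi p s \<bar>f x\<bar>)"
    and "(\<integral>x. (f x)\<^sup>2 \<partial>mu a) - (\<integral>x. \<bar>f x\<bar> powr p \<partial>mu a) powr (2 / p) \<le> (\<integral>x. psi p s \<bar>f x\<bar> \<partial>mu a)"
proof -
  note [measurable] = form_dom_measurable[OF f]
  note f2 = form_dom_integrable_sq[OF f]
  have fp: "integrable (mu a) (\<lambda>x. \<bar>f x\<bar> powr p)"
  proof (rule Bochner_Integration.integrable_bound)
    show "integrable (mu a) (\<lambda>x. 1 + (f x)\<^sup>2)" using f2 by simp
    have "\<bar>f x\<bar> powr p \<le> 1 + (f x)\<^sup>2" for x
    proof (cases "\<bar>f x\<bar> \<le> 1")
      case True
      then have "\<bar>f x\<bar> powr p \<le> 1" using p by (intro powr_le1) auto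
      then show ?thesis by (simp add: add_increasing2)
    next
      case False
      then have "\<bar>f x\<bar> powr p \<le> \<bar>f x\<bar> powr 2" using p by (intro powr_mono) auto
      then show ?thesis using False by simp
    qed
    then show "AE x in mu a. norm (\<bar>f x\<bar> powr p) \<le> norm (1 + (f x)\<^sup>2)" by simp
  qed measurable
  show "integrable (mu a) (\<lambda>x. psi p s \<bar>f x\<bar>)"
    unfolding psi_def using f2 fp by auto
  have "(\<integral>x. psi p s \<bar>f x\<bar> \<partial>mu a) = (\<integral>x. (f x)\<^sup>2 \<partial>mu a)
      - (2 / p) * (s powr (2 - p) * (\<integral>x. \<bar>f x\<bar> powr p \<partial>mu a)) + ((2 - p) / p) * s\<^sup>2"
    unfolding psi_def using f2 fp by simp
  then show "(\<integral>x. (f x)\<^sup>2 \<partial>mu a) - (\<integral>x. \<bar>f x\<bar> powr p \<partial>mu a) powr (2 / p) \<le> (\<integral>x. psi p s \<bar>f x\<bar> \<partial>mu a)"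
    using powr_tangent_le[OF p s, of "\<integral>x. \<bar>f x\<bar> powr p \<partial>mu a"] by simp
qed

text \<open>Supplies the base point. The bound 1 on its modulus matches the shift R + 1 in the tail
  profile.\<close>

lemma ex_energy_at_finite_near_0:
  assumes [measurable]: "f \<in> borel_measurable borel" and "energy \<alpha> f < \<infinity>"
  obtains x where "\<bar>x\<bar> \<le> 1" "energy_at \<alpha> f x < \<infinity>"
proof -
  have "\<exists>x. \<bar>x\<bar> \<le> 1 \<and> energy_at \<alpha> f x < \<infinity>"
  proof (rule ccontr)
    assume *: "\<not> ?thesis"
    have "AE x in lborel. x \<notin> {-1..1::real}"
      using AE_energy_at_finite[OF assms]
    proof eventually_elim
      case (elim x)
      then show ?case using * by (auto simp: abs_le_iff)
    qed
    then have "{-1..1::real} \<in> null_sets lborel" by (simp add: AE_iff_null_sets)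
    then show False by (simp add: null_sets_def)
  qed
  then show ?thesis using that by blast
qed

text \<open>The constant is 6912 = 8 * 27 * 32: 8 from the bound on \<open>psi\<close>, 27 = 9 * 2 +
  9 from estimating N^2 by twice the integral of Z, and 32 = 16 * 2 from the Hardy inequality and
  \<open>energy\<close> being twice \<open>form\<close>.\<close>

lemma beckner_of_tail_condition:
  assumes \<xi>: "0 < \<xi>" "\<xi> \<le> 1"
    and B': "0 < B'" "\<And>R. 0 \<le> R \<Longrightarrow> (R + 1) powr (\<alpha> - 1) * (tail R * (1 + ln (4 / tail R)) powr \<xi>) \<le> B'"
    and f: "f \<in> form_dom a \<alpha>" and p: "1 \<le> p" "p < 2"
  shows "(\<integral>x. (f x)\<^sup>2 \<partial>mu a) - (\<integral>x. \<bar>f x\<bar> powr p \<partial>mu a) powr (2 / p)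
    \<le> 6912 * B' * holder_const \<alpha> * (2 - p) powr \<xi> * form \<alpha> f f"
proof -
  note [measurable] = form_dom_measurable[OF f]
  note K = holder_const_pos[OF alpha]
  have fin: "energy \<alpha> f < \<infinity>" using f by (simp add: form_dom_iff)
  obtain x0 where x0: "\<bar>x0\<bar> \<le> 1" "energy_at \<alpha> f x0 < \<infinity>"
    using ex_energy_at_finite_near_0[OF _ fin] by auto
  define c where "c = \<bar>f x0\<bar>"
  have c: "0 \<le> c" by (simp add: c_def)
  define h where "h x = \<bar>\<bar>f x\<bar> - c\<bar>" for x
  have [measurable]: "h \<in> borel_measurable borel" unfolding h_def[abs_def] by measurable
  have h_f: "\<bar>h x - h y\<bar> \<le> \<bar>f x - f y\<bar>" for x y by (simp add: h_def)
  have h0: "0 \<le> h x" for x by (simp add: h_def)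
  have en: "energy \<alpha> h \<le> energy \<alpha> f" using h_f by (intro energy_mono alpha_pos alpha(2))
  then have fin_h: "energy \<alpha> h < \<infinity>" using fin by (rule le_less_trans)
  have "energy_at \<alpha> h x0 \<le> energy_at \<alpha> f x0" by (intro energy_at_mono alpha_pos alpha(2) h_f)
  then have x0h: "energy_at \<alpha> h x0 < \<infinity>" "h x0 = 0"
    using x0(2) by (auto intro: le_less_trans simp: h_def c_def)
  have int: "integrable (mu a) (\<lambda>x. (h x)\<^sup>2)"
  proof (rule Bochner_Integration.integrable_bound)
    show "integrable (mu a) (\<lambda>x. 2 * (f x)\<^sup>2 + 2 * c\<^sup>2)" using form_dom_integrable_sq[OF f] by simp
    have "(h x)\<^sup>2 \<le> 2 * (f x)\<^sup>2 + 2 * c\<^sup>2" for x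
      using zero_le_power2[of "\<bar>f x\<bar> + c"] by (simp add: h_def power2_eq_square algebra_simps)
    then show "AE x in mu a. norm ((h x)\<^sup>2) \<le> norm (2 * (f x)\<^sup>2 + 2 * c\<^sup>2)" by simp
  qed measurable
  define N where "N = sqrt (\<integral>x. (h x)\<^sup>2 \<partial>mu a)"
  have N2: "(\<integral>x. (h x)\<^sup>2 \<partial>mu a) = N\<^sup>2" by (simp add: N_def)
  have rhs: "0 \<le> 6912 * B' * holder_const \<alpha> * (2 - p) powr \<xi> * form \<alpha> f f"
    using B'(1) K form_nonneg[of f] by simp
  show ?thesis
  proof (cases "N = 0")
    \<comment> \<open>Here |f| is almost everywhere constant and the deficit is zero. The centre c +
      N could vanish in this case, so \<open>psi\<close> is not applied.\<close>
    case True
    then have "AE x in mu a. (h x)\<^sup>2 = 0"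
      using integral_nonneg_eq_0_iff_AE[OF int] N2 by simp
    then have "AE x in mu a. \<bar>f x\<bar> = c" by eventually_elim (simp add: h_def)
    then have fc: "AE x in mu a. (f x)\<^sup>2 = c\<^sup>2" "AE x in mu a. \<bar>f x\<bar> powr p = c powr p"
      by (eventually_elim, metis power2_abs, eventually_elim, simp)
    have "(\<integral>x. (f x)\<^sup>2 \<partial>mu a) = (\<integral>x. c\<^sup>2 \<partial>mu a)" using fc(1) by (intro integral_cong_AE) auto
    moreover have "(\<integral>x. \<bar>f x\<bar> powr p \<partial>mu a) = (\<integral>x. c powr p \<partial>mu a)" using fc(2) by (intro integral_cong_AE) auto
    moreover have "(c powr p) powr (2 / p) = c\<^sup>2"
      using p c by (cases "c = 0") (auto simp: powr_powr)
    ultimately show ?thesis using rhs by simp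
  next
    case False
    have "0 \<le> N" by (simp add: N_def)
    then have N: "0 < N" using False by simp
    define Z where "Z x = (if N / 2 \<le> h x then (h x)\<^sup>2 * (1 + ln (2 + h x / N)) powr \<xi> else 0)" for x
    have [measurable]: "Z \<in> borel_measurable borel" unfolding Z_def[abs_def] by measurable
    have Z0: "0 \<le> Z x" for x by (simp add: Z_def)
    have "(\<integral>\<^sup>+x. ennreal (Z x) \<partial>mu a) \<le> ennreal (16 * B' * holder_const \<alpha>) * energy \<alpha> h"
      unfolding Z_def by (rule log_weighted_hardy[OF \<xi> B' _ h0 fin_h x0(1) x0h int N N2]) simp_all
    also have "\<dots> \<le> ennreal (16 * B' * holder_const \<alpha>) * energy \<alpha> f"
      by (intro mult_left_mono en) simp
    also have "\<dots> = ennreal (32 * B' * holder_const \<alpha> * form \<alpha> f f)"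
      using B'(1) K form_nonneg[of f] by (simp add: energy_eq_form[OF f] ennreal_mult[symmetric] mult_ac)
    finally have Zle: "(\<integral>\<^sup>+x. ennreal (Z x) \<partial>mu a) \<le> ennreal (32 * B' * holder_const \<alpha> * form \<alpha> f f)" .
    have intZ: "integrable (mu a) Z"
      using Zle Z0 by (intro integrableI_bounded) (auto intro: le_less_trans)
    have "(\<integral>\<^sup>+x. ennreal (Z x) \<partial>mu a) = ennreal (\<integral>x. Z x \<partial>mu a)"
      using Z0 by (intro nn_integral_eq_integral intZ) auto
    moreover have "0 \<le> 32 * B' * holder_const \<alpha> * form \<alpha> f f"
      using B'(1) K form_nonneg[of f] by simp
    ultimately have T: "(\<integral>x. Z x \<partial>mu a) \<le> 32 * B' * holder_const \<alpha> * form \<alpha> f f"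
      using Zle by (simp only: ennreal_le_iff)
    have "N\<^sup>2 \<le> (\<integral>x. N\<^sup>2 / 4 + Z x \<partial>mu a)"
      unfolding N2[symmetric]
    proof (rule integral_mono')
      show "integrable (mu a) (\<lambda>x. (\<integral>x. (h x)\<^sup>2 \<partial>mu a) / 4 + Z x)" using intZ by simp
      fix x
      show "(h x)\<^sup>2 \<le> (\<integral>x. (h x)\<^sup>2 \<partial>mu a) / 4 + Z x"
      proof (cases "N / 2 \<le> h x")
        case True
        have "(h x)\<^sup>2 * 1 \<le> (h x)\<^sup>2 * (1 + ln (2 + h x / N)) powr \<xi>"
          using h0[of x] N \<xi> by (intro mult_left_mono ge_one_powr_ge_zero) (auto simp: add_increasing2)
        then have "(h x)\<^sup>2 \<le> Z x" using True by (simp add: Z_def)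
        then show ?thesis unfolding N2 by (simp add: add_increasing)
      next
        case False
        then have "(h x)\<^sup>2 \<le> (N / 2)\<^sup>2" using h0[of x] by (intro power_mono) auto
        then show ?thesis unfolding N2 using Z0[of x] by (simp add: power_divide)
      qed
      show "0 \<le> (\<integral>x. (h x)\<^sup>2 \<partial>mu a) / 4 + Z x" unfolding N2 using Z0[of x] by simp
    qed
    also have "\<dots> = N\<^sup>2 / 4 + (\<integral>x. Z x \<partial>mu a)" using intZ by simp
    \<comment> \<open>The part h < N/2 contributes at most N^2 / 4, which is absorbed on the left.
      This replaces a Poincare inequality.\<close>
    finally have NT: "N\<^sup>2 \<le> 2 * (\<integral>x. Z x \<partial>mu a)" using zero_le_power2[of N] by linarith
    have s: "0 < c + N" using c N by simp
    have "(\<integral>x. (f x)\<^sup>2 \<partial>mu a) - (\<integral>x. \<bar>f x\<bar> powr p \<partial>mu a) powr (2 / p) \<le> (\<integral>x. psi p (c + N) \<bar>f x\<bar> \<partial>mu a)"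
      by (rule beckner_le_psi(2)[OF f p s])
    also have "\<dots> \<le> (\<integral>x. 8 * (2 - p) powr \<xi> * (9 * N\<^sup>2 + 9 * Z x) \<partial>mu a)"
    proof (rule integral_mono)
      show "integrable (mu a) (\<lambda>x. psi p (c + N) \<bar>f x\<bar>)" by (rule beckner_le_psi(1)[OF f p s])
      show "integrable (mu a) (\<lambda>x. 8 * (2 - p) powr \<xi> * (9 * N\<^sup>2 + 9 * Z x))" using intZ by simp
      show "psi p (c + N) \<bar>f x\<bar> \<le> 8 * (2 - p) powr \<xi> * (9 * N\<^sup>2 + 9 * Z x)" for x
        unfolding Z_def h_def by (intro psi_le_log_weight p \<xi> N c) simp
    qed
    also have "\<dots> = 8 * (2 - p) powr \<xi> * (9 * N\<^sup>2 + 9 * (\<integral>x. Z x \<partial>mu a))" using intZ by simp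
    also have "\<dots> \<le> 8 * (2 - p) powr \<xi> * (27 * (32 * B' * holder_const \<alpha> * form \<alpha> f f))"
      using NT T by (intro mult_left_mono) auto
    also have "\<dots> = 6912 * B' * holder_const \<alpha> * (2 - p) powr \<xi> * form \<alpha> f f" by simp
    finally show ?thesis .
  qed
qed

end

theorem theorem1p6:
  fixes a :: "real \<Rightarrow> real" and \<alpha> \<xi> :: real
  assumes "1 < \<alpha>" and "\<alpha> < 2"
    and "continuous_on UNIV a"
    and "\<And>x. 0 < a x"
    and "(\<integral>x. 1 / a x \<partial>lborel) = 1"
    and "0 < \<xi>" and "\<xi> \<le> 1"
  shows "(\<exists>C>0. \<forall>f \<in> generator_dom a \<alpha>.
            (SUP p\<in>{1..<2}. ereal
              (((\<integral>x. (f x)\<^sup>2 \<partial>mu a) - (\<integral>x. \<bar>f x\<bar> powr p \<partial>mu a) powr (2 / p))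
                / (C * (2 - p) powr \<xi>)))
            \<le> ereal (form \<alpha> f f))
     \<longleftrightarrow>
         (SUP x. ereal
           (\<bar>x\<bar> powr (\<alpha> - 1) * measure (mu a) (- {-\<bar>x\<bar><..<\<bar>x\<bar>})
             * ln (inverse (measure (mu a) (- {-\<bar>x\<bar><..<\<bar>x\<bar>}))) powr \<xi>)) < \<infinity>"
    (is "(\<exists>C>0. ?beckner C) \<longleftrightarrow> (SUP x. ereal (?tail x)) < \<infinity>")
proof -
  interpret speed_measure a \<alpha> by unfold_locales (use assms in auto)
  have tail_eq: "?tail x = \<bar>x\<bar> powr (\<alpha> - 1) * tail \<bar>x\<bar> * ln (inverse (tail \<bar>x\<bar>)) powr \<xi>" for x
    by (simp add: tail_def)
  \<comment> \<open>Positivity of \<open>C * (2 - p) powr \<xi>\<close> turns the supremum of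
    quotients into one inequality for each p in [1, 2).\<close>
  have beckner_iff: "?beckner C \<longleftrightarrow> (\<forall>f \<in> generator_dom a \<alpha>. \<forall>p\<in>{1..<2}.
      (\<integral>x. (f x)\<^sup>2 \<partial>mu a) - (\<integral>x. \<bar>f x\<bar> powr p \<partial>mu a) powr (2 / p) \<le> C * (2 - p) powr \<xi> * form \<alpha> f f)"
    if "0 < C" for C
    using that by (auto simp: SUP_le_iff pos_divide_le_eq mult_ac)
  show ?thesis
  proof
    assume "\<exists>C>0. ?beckner C"
    then obtain C where "0 < C" "?beckner C" by blast
    then have "\<exists>B. \<forall>R\<ge>0. R powr (\<alpha> - 1) * tail R * ln (inverse (tail R)) powr \<xi> \<le> B"
      by (intro tail_condition_of_beckner[of C] assms) (auto simp: beckner_iff)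
    then obtain B where "\<And>x. ?tail x \<le> B" unfolding tail_eq by (metis abs_ge_zero)
    then have "(SUP x. ereal (?tail x)) \<le> ereal B" by (intro SUP_least) simp
    then show "(SUP x. ereal (?tail x)) < \<infinity>" by (rule le_less_trans) simp
  next
    assume "(SUP x. ereal (?tail x)) < \<infinity>"
    then have "\<exists>B. (SUP x. ereal (?tail x)) \<le> ereal B"
      by (cases "SUP x. ereal (?tail x)") auto
    then obtain B where B: "(SUP x. ereal (?tail x)) \<le> ereal B" ..
    have "R powr (\<alpha> - 1) * tail R * ln (inverse (tail R)) powr \<xi> \<le> B" if "0 \<le> R" for R
      using order_trans[OF SUP_upper[of R UNIV "\<lambda>x. ereal (?tail x)"] B] that unfolding tail_eq by simp
    then obtain B' where B': "0 < B'"
      "\<And>R. 0 \<le> R \<Longrightarrow> (R + 1) powr (\<alpha> - 1) * (tail R * (1 + ln (4 / tail R)) powr \<xi>) \<le> B'"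
      using log_profile_tail_bounded[OF assms(6,7)] by meson
    define C where "C = 6912 * B' * holder_const \<alpha>"
    have C: "0 < C" using B'(1) holder_const_pos[OF alpha] by (simp add: C_def)
    \<comment> \<open>Sufficiency is proved on the whole form domain, which contains the generator
      domain.\<close>
    have "f \<in> form_dom a \<alpha>" if "f \<in> generator_dom a \<alpha>" for f
      using that by (auto simp: generator_dom_def generator_def)
    then have "?beckner C"
      unfolding beckner_iff[OF C] using beckner_of_tail_condition[OF assms(6,7) B'] by (auto simp: C_def)
    then show "\<exists>C>0. ?beckner C" using C by blast
  qed
qed

end
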